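(* Let $\mu$ be the fermion point process with Papangelou intensity $r$, and let $d$, $c$ be coefficients, all as described in the context (in particular $c$ satisfies the support condition and the balance condition stated there). 1) Assume that, for each $\Lambda\in\mathcal B_0(X)$, the functions $$\gamma\mapsto\int_\Lambda\gamma(dx)\,d(x,\gamma\setminus x)\quad\text{and}\quad\gamma\mapsto\int_\Lambda\nu(dx)\,b(x,\gamma)$$ belong to $L^2(\Gamma,\mu)$, where $b(x,\gamma):=r(x,\gamma)d(x,\gamma)$ for $x\in X$, $\gamma\in\Gamma$. Then, for each $F\in\mathcal FC_{\mathrm b}(C_0(X),\Gamma)$, $$(H_{\mathrm G}F)(\gamma)=-\int_X\nu(dx)\,b(x,\gamma)(D_x^+F)(\gamma)-\int_X\gamma(dx)\,d(x,\gamma\setminus x)(D_x^-F)(\gamma)\qquad\mu\text{-a.e.},$$ and $(H_{\mathrm G},D(H_{\mathrm G}))$ is the Friedrichs extension of $(H_{\mathrm G},\mathcal FC_{\mathrm b}(C_0(X),\Gamma))$ in $L^2(\Gamma,\mu)$. 2) Assume that, for each $\Lambda\in\mathcal B_0(X)$, the function $$\gamma\mapsto\int_X\gamma(dx)\int_X\nu(dy)\,c(x,y,\gamma\setminus x)\,(\chi_\Lambda(x)+\chi_\Lambda(y))$$ belongs to $L^2(\Gamma,\mu)$. Then, for each $F\in\mathcal FC_{\mathrm b}(C_0(X),\Gamma)$, $$(H_{\mathrm K}F)(\gamma)=-2\int_X\gamma(dx)\int_X\nu(dy)\,c(x,y,\gamma\setminus x)(D_{xy}^{-+}F)(\gamma)\qquad\mu\text{-a.e.},$$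 and $(H_{\mathrm K},D(H_{\mathrm K}))$ is the Friedrichs extension of $(H_{\mathrm K},\mathcal FC_{\mathrm b}(C_0(X),\Gamma))$ in $L^2(\Gamma,\mu)$.
   Context: Setting. $X$ is a locally compact, second countable Hausdorff (hence Polish) space, $\mathcal B(X)$ its Borel $\sigma$-algebra, $\mathcal B_0(X)$ the collection of relatively compact Borel sets, $\nu$ a Radon non-atomic measure on $X$, $C_0(X)$ the continuous real functions with compact support, $\chi_A$ the indicator of $A$. The configuration space $\Gamma$ is the set of all locally finite subsets $\gamma\subset X$; $\gamma$ is identified with the Radon measure $\sum_{x\in\gamma}\varepsilon_x$ ($\varepsilon_x$ the Dirac measure), so $\int f\,d\gamma=\langle f,\gamma\rangle=\sum_{x\in\gamma}f(x)$. $\Gamma$ carries the vague topology and its Borel $\sigma$-algebra. One writes $x$ for $\{x\}$ in $\gamma\setminus x$, $\gamma\cup x$. Fermion process. $K$ is a bounded Hermitian operator on $L^2(X,\nu)$ with $\mathbf 0\le K\le\mathbf 1$, locally of trace class (i.e. $\operatorname{Tr}(\chi_\Lambda K\chi_\Lambda)<\infty$ for all $\Lambda\in\mathcal B_0(X)$), and such that $1$ is not in the spectrum of $K$. $K$ is an integral operator with kernel chosen as $K(x,y)=\int_XK_1(x,z)K_1(z,y)\,\nu(dz)$, $K_1$ a version of the kernel of $\sqrt K$. $\mu$ is the fermion (determinantal) point process of $K$: the unique probability measure on $\Gamma$ with correlation functions $k^{(n)}_\mu(x_1,\dots,x_n)=\det(K(x_i,x_j))_{i,j=1}^n$, i.e.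 $\int_\Gamma\sum_{\{x_1,\dots,x_n\}\subset\gamma}f(x_1,\dots,x_n)\,\mu(d\gamma)=\frac1{n!}\int_{X^n}f\,k^{(n)}_\mu\,d\nu^{\otimes n}$ for all measurable symmetric $f:X^n\to[0,\infty]$. It is known that $\mu$ has a Papangelou intensity: a measurable $r:X\times\Gamma\to[0,+\infty]$, fixed throughout, with $$\int_\Gamma\mu(d\gamma)\int_X\gamma(dx)F(x,\gamma)=\int_\Gamma\mu(d\gamma)\int_X\nu(dx)\,r(x,\gamma)F(x,\gamma\cup x)$$ for all measurable $F:X\times\Gamma\to[0,\infty]$. Coefficients. $d:X\times\Gamma\to[0,\infty)$ and $c:X\times X\times\Gamma\to[0,\infty)$ are measurable. Support condition: $c(x,y,\gamma)=c(x,y,\gamma)\chi_{\{r(x,\gamma)>0,\,r(y,\gamma)>0\}}$. Balance condition: $r(x,\gamma)c(x,y,\gamma)=r(y,\gamma)c(y,x,\gamma)$. Forms. $\mathcal FC_{\mathrm b}(C_0(X),\Gamma)$ is the set of functions $F(\gamma)=g(\langle\varphi_1,\gamma\rangle,\dots,\langle\varphi_N,\gamma\rangle)$ with $N\in\mathbb N$, $\varphi_i\in C_0(X)$, $g:\mathbb R^N\to\mathbb R$ continuous and bounded. Put $(D_x^-F)(\gamma)=F(\gamma\setminus x)-F(\gamma)$, $(D_x^+F)(\gamma)=F(\gamma\cup x)-F(\gamma)$, $(D_{xy}^{-+}F)(\gamma)=F(\gamma\setminus x\cup y)-F(\gamma)$. For $F,G\in\mathcal FC_{\mathrm b}(C_0(X),\Gamma)$,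 $$\mathcal E_{\mathrm G}(F,G)=\int_\Gamma\mu(d\gamma)\int_X\gamma(dx)\,d(x,\gamma\setminus x)(D_x^-F)(\gamma)(D_x^-G)(\gamma),$$ $$\mathcal E_{\mathrm K}(F,G)=\int_\Gamma\mu(d\gamma)\int_X\gamma(dx)\int_X\nu(dy)\,c(x,y,\gamma\setminus x)(D_{xy}^{-+}F)(\gamma)(D_{xy}^{-+}G)(\gamma).$$ For $\sharp\in\{\mathrm G,\mathrm K\}$, $(\mathcal E_\sharp,D(\mathcal E_\sharp))$ denotes the closure of $(\mathcal E_\sharp,\mathcal FC_{\mathrm b}(C_0(X),\Gamma))$ on (real) $L^2(\Gamma,\mu)$ (under the assumptions of part 1, resp. 2, this form is closable), and $(H_\sharp,D(H_\sharp))$ is its generator: the non-negative self-adjoint operator with $\mathcal E_\sharp(F,G)=(H_\sharp F,G)_{L^2(\mu)}$ for $F\in D(H_\sharp)$, $G\in D(\mathcal E_\sharp)$. The formulas in the claim include the assertion that $\mathcal FC_{\mathrm b}(C_0(X),\Gamma)\subset D(H_\sharp)$. *)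

theory Defs
  imports "HOL-Probability.Probability" "Jordan_Normal_Form.Determinant"
begin

section \<open>The underlying space\<close>

text \<open>On a locally compact second countable Hausdorff space every Borel measure that is finite on
  compact sets is regular, so no regularity condition is listed.\<close>

definition radon_measure :: "'x::topological_space measure \<Rightarrow> bool" where
  "radon_measure \<nu> \<longleftrightarrow> sets \<nu> = sets borel \<and> (\<forall>C. compact C \<longrightarrow> emeasure \<nu> C < \<infinity>)"

definition non_atomic :: "'x measure \<Rightarrow> bool" where
  "non_atomic \<nu> \<longleftrightarrow>
     (\<forall>A\<in>sets \<nu>. 0 < emeasure \<nu> A \<longrightarrow>
        (\<exists>B\<in>sets \<nu>. B \<subseteq> A \<and> 0 < emeasure \<nu> B \<and> emeasure \<nu> B < emeasure \<nu> A))"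

definition rel_compact_borel :: "'x::topological_space set set" where
  "rel_compact_borel = {\<Lambda> \<in> sets borel. compact (closure \<Lambda>)}"

definition C0 :: "('x::topological_space \<Rightarrow> real) set" where
  "C0 = {f. continuous_on UNIV f \<and> compact (closure {x. f x \<noteq> 0})}"


section \<open>Square-integrable functions\<close>

text \<open>Elements of $L^2$ are represented by functions; identities between them are stated almost
  everywhere.\<close>

definition square_integrable ::
    "'a measure \<Rightarrow> ('a \<Rightarrow> 'b::{real_normed_vector, second_countable_topology}) \<Rightarrow> bool" where
  "square_integrable M f \<longleftrightarrow> f \<in> borel_measurable M \<and> integrable M (\<lambda>x. (norm (f x))\<^sup>2)"

definition square_integrable_ennreal :: "'a measure \<Rightarrow> ('a \<Rightarrow> ennreal) \<Rightarrow> bool" where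
  "square_integrable_ennreal M f \<longleftrightarrow> f \<in> borel_measurable M \<and> (\<integral>\<^sup>+ x. (f x)\<^sup>2 \<partial>M) < \<infinity>"

definition l2_norm :: "'a measure \<Rightarrow> ('a \<Rightarrow> 'b::real_normed_vector) \<Rightarrow> real" where
  "l2_norm M f = sqrt (\<integral>x. (norm (f x))\<^sup>2 \<partial>M)"

definition l2_inner :: "'a measure \<Rightarrow> ('a \<Rightarrow> real) \<Rightarrow> ('a \<Rightarrow> real) \<Rightarrow> real" where
  "l2_inner M f g = (\<integral>x. f x * g x \<partial>M)"

definition l2_cinner :: "'a measure \<Rightarrow> ('a \<Rightarrow> complex) \<Rightarrow> ('a \<Rightarrow> complex) \<Rightarrow> complex" where
  "l2_cinner M f g = (\<integral>x. f x * cnj (g x) \<partial>M)"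


section \<open>Bounded operators on complex $L^2$\<close>

definition bounded_operator :: "'a measure \<Rightarrow> (('a \<Rightarrow> complex) \<Rightarrow> ('a \<Rightarrow> complex)) \<Rightarrow> bool" where
  "bounded_operator M A \<longleftrightarrow>
     (\<forall>f. square_integrable M f \<longrightarrow> square_integrable M (A f)) \<and>
     (\<forall>f g. square_integrable M f \<longrightarrow> square_integrable M g \<longrightarrow> (AE x in M. f x = g x) \<longrightarrow>
        (AE x in M. A f x = A g x)) \<and>
     (\<forall>f g. square_integrable M f \<longrightarrow> square_integrable M g \<longrightarrow>
        (AE x in M. A (\<lambda>y. f y + g y) x = A f x + A g x)) \<and>
     (\<forall>a f. square_integrable M f \<longrightarrow> (AE x in M. A (\<lambda>y. a * f y) x = a * A f x)) \<and>
     (\<exists>C. \<forall>f. square_integrable M f \<longrightarrow> l2_norm M (A f) \<le> C * l2_norm M f)"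

definition hermitian :: "'a measure \<Rightarrow> (('a \<Rightarrow> complex) \<Rightarrow> ('a \<Rightarrow> complex)) \<Rightarrow> bool" where
  "hermitian M A \<longleftrightarrow>
     (\<forall>f g. square_integrable M f \<longrightarrow> square_integrable M g \<longrightarrow>
        l2_cinner M (A f) g = l2_cinner M f (A g))"

text \<open>Comparison of Hermitian operators, for which the quadratic forms are real.\<close>

definition operator_le ::
    "'a measure \<Rightarrow> (('a \<Rightarrow> complex) \<Rightarrow> ('a \<Rightarrow> complex)) \<Rightarrow> (('a \<Rightarrow> complex) \<Rightarrow> ('a \<Rightarrow> complex)) \<Rightarrow> bool"
  where
  "operator_le M A B \<longleftrightarrow>
     (\<forall>f. square_integrable M f \<longrightarrow> Re (l2_cinner M (A f) f) \<le> Re (l2_cinner M (B f) f))"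

definition orthonormal_basis :: "'a measure \<Rightarrow> ('a \<Rightarrow> complex) set \<Rightarrow> bool" where
  "orthonormal_basis M E \<longleftrightarrow>
     (\<forall>e\<in>E. square_integrable M e) \<and>
     (\<forall>e\<in>E. \<forall>e'\<in>E. l2_cinner M e e' = (if e = e' then 1 else 0)) \<and>
     (\<forall>f. square_integrable M f \<longrightarrow> (\<forall>e\<in>E. l2_cinner M f e = 0) \<longrightarrow> (AE x in M. f x = 0))"

text \<open>Only used for non-negative operators, for which the trace is the same in all bases.\<close>

definition finite_trace :: "'a measure \<Rightarrow> (('a \<Rightarrow> complex) \<Rightarrow> ('a \<Rightarrow> complex)) \<Rightarrow> bool" where
  "finite_trace M A \<longleftrightarrow>
     (\<exists>E. orthonormal_basis M E \<and> (\<lambda>e. l2_cinner M (A e) e) summable_on E)"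

definition locally_trace_class ::
    "'x::topological_space measure \<Rightarrow> (('x \<Rightarrow> complex) \<Rightarrow> ('x \<Rightarrow> complex)) \<Rightarrow> bool" where
  "locally_trace_class \<nu> K \<longleftrightarrow>
     (\<forall>\<Lambda>\<in>rel_compact_borel.
        finite_trace \<nu> (\<lambda>f x. indicator \<Lambda> x * K (\<lambda>y. indicator \<Lambda> y * f y) x))"

definition operator_spectrum :: "'a measure \<Rightarrow> (('a \<Rightarrow> complex) \<Rightarrow> ('a \<Rightarrow> complex)) \<Rightarrow> complex set" where
  "operator_spectrum M A =
     {z. \<not> (\<exists>R. bounded_operator M R \<and>
              (\<forall>f. square_integrable M f \<longrightarrow>
                 (AE x in M. R (\<lambda>y. z * f y - A f y) x = f x) \<and>
                 (AE x in M. z * R f x - A (R f) x = f x)))}"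

definition is_operator_sqrt ::
    "'a measure \<Rightarrow> (('a \<Rightarrow> complex) \<Rightarrow> ('a \<Rightarrow> complex)) \<Rightarrow> (('a \<Rightarrow> complex) \<Rightarrow> ('a \<Rightarrow> complex)) \<Rightarrow> bool"
  where
  "is_operator_sqrt M A S \<longleftrightarrow>
     bounded_operator M S \<and> hermitian M S \<and> operator_le M (\<lambda>f x. 0) S \<and>
     (\<forall>f. square_integrable M f \<longrightarrow> (AE x in M. S (S f) x = A f x))"

definition has_kernel ::
    "'a measure \<Rightarrow> (('a \<Rightarrow> complex) \<Rightarrow> ('a \<Rightarrow> complex)) \<Rightarrow> ('a \<Rightarrow> 'a \<Rightarrow> complex) \<Rightarrow> bool" where
  "has_kernel M A k \<longleftrightarrow>
     case_prod k \<in> borel_measurable (M \<Otimes>\<^sub>M M) \<and>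
     (\<forall>f. square_integrable M f \<longrightarrow>
        (AE x in M. integrable M (\<lambda>y. k x y * f y) \<and> A f x = (\<integral>y. k x y * f y \<partial>M)))"

definition composed_kernel :: "'a measure \<Rightarrow> ('a \<Rightarrow> 'a \<Rightarrow> complex) \<Rightarrow> 'a \<Rightarrow> 'a \<Rightarrow> complex" where
  "composed_kernel M k1 x y = (\<integral>z. k1 x z * k1 z y \<partial>M)"


section \<open>Configuration space\<close>

definition configs :: "'x::topological_space set set" where
  "configs = {\<gamma>. \<forall>C. compact C \<longrightarrow> finite (\<gamma> \<inter> C)}"

text \<open>Throughout, integration with respect to the measure $\sum_{x\in\gamma}\varepsilon_x$ is
  integration with respect to the counting measure on \<open>\<gamma>\<close>.\<close>

definition pairing :: "('x \<Rightarrow> real) \<Rightarrow> 'x set \<Rightarrow> real" where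
  "pairing f \<gamma> = (\<integral>x. f x \<partial>count_space \<gamma>)"

definition vague_topology :: "'x::topological_space set topology" where
  "vague_topology =
     topology_generated_by {{\<gamma> \<in> configs. pairing f \<gamma> \<in> U} | f U. f \<in> C0 \<and> open U}"

definition config_space :: "'x::topological_space set measure" where
  "config_space = sigma configs {U. openin vague_topology U}"


section \<open>Fermion point processes and the Papangelou intensity\<close>

text \<open>Points of $X^n$ are extensional functions on \<open>{..<n}\<close>. The chosen enumeration of a finite set
  is only applied inside symmetric functions.\<close>

definition enumeration :: "nat \<Rightarrow> 'x set \<Rightarrow> nat \<Rightarrow> 'x" where
  "enumeration n \<eta> = (SOME x. x \<in> extensional {..<n} \<and> bij_betw x {..<n} \<eta>)"

definition symmetric_fun :: "nat \<Rightarrow> ((nat \<Rightarrow> 'x) \<Rightarrow> 'b) \<Rightarrow> bool" where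
  "symmetric_fun n f \<longleftrightarrow>
     (\<forall>x\<in>extensional {..<n}. \<forall>\<pi>. \<pi> permutes {..<n} \<longrightarrow> f (x \<circ> \<pi>) = f x)"

definition has_correlation_functions ::
    "'x measure \<Rightarrow> 'x set measure \<Rightarrow> (nat \<Rightarrow> (nat \<Rightarrow> 'x) \<Rightarrow> ennreal) \<Rightarrow> bool" where
  "has_correlation_functions \<nu> \<mu> k \<longleftrightarrow>
     (\<forall>n\<ge>1. \<forall>f \<in> borel_measurable (Pi\<^sub>M {..<n} (\<lambda>_. \<nu>)). symmetric_fun n f \<longrightarrow>
        (\<integral>\<^sup>+ \<gamma>. (\<integral>\<^sup>+ \<eta>. f (enumeration n \<eta>) \<partial>count_space {\<eta>. \<eta> \<subseteq> \<gamma> \<and> card \<eta> = n}) \<partial>\<mu>)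
        = ennreal (1 / fact n) * (\<integral>\<^sup>+ x. f x * k n x \<partial>Pi\<^sub>M {..<n} (\<lambda>_. \<nu>)))"

text \<open>For the kernel of a non-negative Hermitian operator, chosen as \<^const>\<open>composed_kernel\<close> of the
  kernel of its square root, the determinants below are real and non-negative almost everywhere.\<close>

definition det_correlation :: "('x \<Rightarrow> 'x \<Rightarrow> complex) \<Rightarrow> nat \<Rightarrow> (nat \<Rightarrow> 'x) \<Rightarrow> ennreal" where
  "det_correlation k n x = ennreal (Re (Determinant.det (mat n n (\<lambda>(i, j). k (x i) (x j)))))"

definition fermion_process ::
    "'x::topological_space measure \<Rightarrow> ('x \<Rightarrow> 'x \<Rightarrow> complex) \<Rightarrow> 'x set measure \<Rightarrow> bool" where
  "fermion_process \<nu> k \<mu> \<longleftrightarrow>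
     prob_space \<mu> \<and> sets \<mu> = sets config_space \<and>
     has_correlation_functions \<nu> \<mu> (det_correlation k)"

definition papangelou_intensity ::
    "'x::topological_space measure \<Rightarrow> 'x set measure \<Rightarrow> ('x \<Rightarrow> 'x set \<Rightarrow> ennreal) \<Rightarrow> bool" where
  "papangelou_intensity \<nu> \<mu> r \<longleftrightarrow>
     case_prod r \<in> borel_measurable (borel \<Otimes>\<^sub>M config_space) \<and>
     (\<forall>F. case_prod F \<in> borel_measurable (borel \<Otimes>\<^sub>M config_space) \<longrightarrow>
        (\<integral>\<^sup>+ \<gamma>. (\<integral>\<^sup>+ x. F x \<gamma> \<partial>count_space \<gamma>) \<partial>\<mu>)
        = (\<integral>\<^sup>+ \<gamma>. (\<integral>\<^sup>+ x. r x \<gamma> * F x (insert x \<gamma>) \<partial>\<nu>) \<partial>\<mu>))"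


section \<open>Cylinder functions and the two bilinear forms\<close>

text \<open>Points of $\mathbb{R}^N$ are extensional functions on \<open>{..<N}\<close>.\<close>

definition cylinder_functions :: "('x::topological_space set \<Rightarrow> real) set" where
  "cylinder_functions =
     {F. \<exists>(N::nat) \<phi> g. (\<forall>i<N. \<phi> i \<in> C0) \<and>
           continuous_map (product_topology (\<lambda>_. euclideanreal) {..<N}) euclideanreal g \<and>
           bounded (g ` extensional {..<N}) \<and>
           (\<forall>\<gamma>\<in>configs. F \<gamma> = g (\<lambda>i\<in>{..<N}. pairing (\<phi> i) \<gamma>))}"

definition D_minus :: "'x \<Rightarrow> ('x set \<Rightarrow> real) \<Rightarrow> 'x set \<Rightarrow> real" where
  "D_minus x F \<gamma> = F (\<gamma> - {x}) - F \<gamma>"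

definition D_plus :: "'x \<Rightarrow> ('x set \<Rightarrow> real) \<Rightarrow> 'x set \<Rightarrow> real" where
  "D_plus x F \<gamma> = F (insert x \<gamma>) - F \<gamma>"

definition D_minus_plus :: "'x \<Rightarrow> 'x \<Rightarrow> ('x set \<Rightarrow> real) \<Rightarrow> 'x set \<Rightarrow> real" where
  "D_minus_plus x y F \<gamma> = F (insert y (\<gamma> - {x})) - F \<gamma>"

definition glauber_form ::
    "'x set measure \<Rightarrow> ('x \<Rightarrow> 'x set \<Rightarrow> real) \<Rightarrow> ('x set \<Rightarrow> real) \<Rightarrow> ('x set \<Rightarrow> real) \<Rightarrow> real" where
  "glauber_form \<mu> d F G =
     (\<integral>\<gamma>. (\<integral>x. d x (\<gamma> - {x}) * D_minus x F \<gamma> * D_minus x G \<gamma> \<partial>count_space \<gamma>) \<partial>\<mu>)"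

definition kawasaki_form ::
    "'x measure \<Rightarrow> 'x set measure \<Rightarrow> ('x \<Rightarrow> 'x \<Rightarrow> 'x set \<Rightarrow> real) \<Rightarrow>
     ('x set \<Rightarrow> real) \<Rightarrow> ('x set \<Rightarrow> real) \<Rightarrow> real" where
  "kawasaki_form \<nu> \<mu> c F G =
     (\<integral>\<gamma>. (\<integral>x. (\<integral>y. c x y (\<gamma> - {x}) * D_minus_plus x y F \<gamma> * D_minus_plus x y G \<gamma> \<partial>\<nu>)
            \<partial>count_space \<gamma>) \<partial>\<mu>)"


section \<open>Closures, generators and Friedrichs extensions in real $L^2$\<close>

definition form_approx ::
    "'a measure \<Rightarrow> (('a \<Rightarrow> real) \<Rightarrow> ('a \<Rightarrow> real) \<Rightarrow> real) \<Rightarrow> ('a \<Rightarrow> real) set \<Rightarrow>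
     ('a \<Rightarrow> real) \<Rightarrow> (nat \<Rightarrow> 'a \<Rightarrow> real) \<Rightarrow> bool" where
  "form_approx M E D u s \<longleftrightarrow>
     (\<forall>n. s n \<in> D) \<and>
     (\<lambda>n. l2_norm M (\<lambda>x. s n x - u x)) \<longlonglongrightarrow> 0 \<and>
     (\<forall>\<epsilon>>0. \<exists>n0. \<forall>m\<ge>n0. \<forall>n\<ge>n0. E (\<lambda>x. s m x - s n x) (\<lambda>x. s m x - s n x) < \<epsilon>)"

definition closure_dom ::
    "'a measure \<Rightarrow> (('a \<Rightarrow> real) \<Rightarrow> ('a \<Rightarrow> real) \<Rightarrow> real) \<Rightarrow> ('a \<Rightarrow> real) set \<Rightarrow> ('a \<Rightarrow> real) set"
  where
  "closure_dom M E D = {u. square_integrable M u \<and> (\<exists>s. form_approx M E D u s)}"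

text \<open>The limit is independent of the approximating sequences precisely because the form is
  closable.\<close>

definition closure_form ::
    "'a measure \<Rightarrow> (('a \<Rightarrow> real) \<Rightarrow> ('a \<Rightarrow> real) \<Rightarrow> real) \<Rightarrow> ('a \<Rightarrow> real) set \<Rightarrow>
     ('a \<Rightarrow> real) \<Rightarrow> ('a \<Rightarrow> real) \<Rightarrow> real" where
  "closure_form M E D u v =
     (THE l. \<forall>s t. form_approx M E D u s \<longrightarrow> form_approx M E D v t \<longrightarrow>
                (\<lambda>n. E (s n) (t n)) \<longlonglongrightarrow> l)"

text \<open>An operator is given by a map \<open>A\<close> and its domain \<open>D\<close>; values of \<open>A\<close> outside \<open>D\<close> are
  irrelevant. A domain need not be closed under almost everywhere equality (cylinder functions are
  not), but the domain of a self-adjoint operator, as defined below, is.\<close>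

definition linear_operator ::
    "'a measure \<Rightarrow> (('a \<Rightarrow> real) \<Rightarrow> ('a \<Rightarrow> real)) \<Rightarrow> ('a \<Rightarrow> real) set \<Rightarrow> bool" where
  "linear_operator M A D \<longleftrightarrow>
     (\<lambda>_. 0) \<in> D \<and>
     (\<forall>u\<in>D. square_integrable M u \<and> square_integrable M (A u)) \<and>
     (\<forall>u\<in>D. \<forall>v\<in>D. (AE x in M. u x = v x) \<longrightarrow> (AE x in M. A u x = A v x)) \<and>
     (\<forall>u\<in>D. \<forall>v\<in>D. (\<lambda>x. u x + v x) \<in> D \<and>
        (AE x in M. A (\<lambda>y. u y + v y) x = A u x + A v x)) \<and>
     (\<forall>a. \<forall>u\<in>D. (\<lambda>x. a * u x) \<in> D \<and> (AE x in M. A (\<lambda>y. a * u y) x = a * A u x))"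

definition l2_dense :: "'a measure \<Rightarrow> ('a \<Rightarrow> real) set \<Rightarrow> bool" where
  "l2_dense M D \<longleftrightarrow>
     (\<forall>u. square_integrable M u \<longrightarrow> (\<forall>\<epsilon>>0. \<exists>v\<in>D. l2_norm M (\<lambda>x. u x - v x) < \<epsilon>))"

definition symmetric_operator ::
    "'a measure \<Rightarrow> (('a \<Rightarrow> real) \<Rightarrow> ('a \<Rightarrow> real)) \<Rightarrow> ('a \<Rightarrow> real) set \<Rightarrow> bool" where
  "symmetric_operator M A D \<longleftrightarrow>
     linear_operator M A D \<and> l2_dense M D \<and>
     (\<forall>u\<in>D. \<forall>v\<in>D. l2_inner M (A u) v = l2_inner M u (A v))"

definition nonneg_operator ::
    "'a measure \<Rightarrow> (('a \<Rightarrow> real) \<Rightarrow> ('a \<Rightarrow> real)) \<Rightarrow> ('a \<Rightarrow> real) set \<Rightarrow> bool" where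
  "nonneg_operator M A D \<longleftrightarrow> (\<forall>u\<in>D. 0 \<le> l2_inner M (A u) u)"

definition adjoint_graph ::
    "'a measure \<Rightarrow> (('a \<Rightarrow> real) \<Rightarrow> ('a \<Rightarrow> real)) \<Rightarrow> ('a \<Rightarrow> real) set \<Rightarrow>
     (('a \<Rightarrow> real) \<times> ('a \<Rightarrow> real)) set" where
  "adjoint_graph M A D =
     {(v, w). square_integrable M v \<and> square_integrable M w \<and>
              (\<forall>u\<in>D. l2_inner M (A u) v = l2_inner M u w)}"

definition operator_graph ::
    "'a measure \<Rightarrow> (('a \<Rightarrow> real) \<Rightarrow> ('a \<Rightarrow> real)) \<Rightarrow> ('a \<Rightarrow> real) set \<Rightarrow>
     (('a \<Rightarrow> real) \<times> ('a \<Rightarrow> real)) set" where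
  "operator_graph M A D = {(v, w). v \<in> D \<and> square_integrable M w \<and> (AE x in M. w x = A v x)}"

definition self_adjoint ::
    "'a measure \<Rightarrow> (('a \<Rightarrow> real) \<Rightarrow> ('a \<Rightarrow> real)) \<Rightarrow> ('a \<Rightarrow> real) set \<Rightarrow> bool" where
  "self_adjoint M A D \<longleftrightarrow>
     linear_operator M A D \<and> l2_dense M D \<and> adjoint_graph M A D = operator_graph M A D"

text \<open>The operator with the following properties is unique (up to almost everywhere equality of
  its values), since a self-adjoint operator has no proper self-adjoint extension.\<close>

definition is_generator ::
    "'a measure \<Rightarrow> (('a \<Rightarrow> real) \<Rightarrow> ('a \<Rightarrow> real) \<Rightarrow> real) \<Rightarrow> ('a \<Rightarrow> real) set \<Rightarrow>
     (('a \<Rightarrow> real) \<Rightarrow> ('a \<Rightarrow> real)) \<Rightarrow> ('a \<Rightarrow> real) set \<Rightarrow> bool" where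
  "is_generator M E DE H DH \<longleftrightarrow>
     self_adjoint M H DH \<and> nonneg_operator M H DH \<and> DH \<subseteq> DE \<and>
     (\<forall>u\<in>DH. \<forall>v\<in>DE. E u v = l2_inner M (H u) v)"

definition is_closure_generator ::
    "'a measure \<Rightarrow> (('a \<Rightarrow> real) \<Rightarrow> ('a \<Rightarrow> real) \<Rightarrow> real) \<Rightarrow> ('a \<Rightarrow> real) set \<Rightarrow>
     (('a \<Rightarrow> real) \<Rightarrow> ('a \<Rightarrow> real)) \<Rightarrow> ('a \<Rightarrow> real) set \<Rightarrow> bool" where
  "is_closure_generator M E D H DH \<longleftrightarrow>
     is_generator M (closure_form M E D) (closure_dom M E D) H DH"

text \<open>The Friedrichs extension of a non-negative symmetric operator \<open>A\<close> is the generator of the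
  closure of the form $(u, v) \mapsto (Au, v)$ on the domain of \<open>A\<close>.\<close>

definition is_friedrichs_extension ::
    "'a measure \<Rightarrow> (('a \<Rightarrow> real) \<Rightarrow> ('a \<Rightarrow> real)) \<Rightarrow> ('a \<Rightarrow> real) set \<Rightarrow>
     (('a \<Rightarrow> real) \<Rightarrow> ('a \<Rightarrow> real)) \<Rightarrow> ('a \<Rightarrow> real) set \<Rightarrow> bool" where
  "is_friedrichs_extension M A DA H DH \<longleftrightarrow>
     symmetric_operator M A DA \<and> nonneg_operator M A DA \<and>
     is_closure_generator M (\<lambda>u v. l2_inner M (A u) v) DA H DH"

end

theory Submission
  imports Defs
begin

text \<open>The Papangelou identity rewrites the part of the form in which the second function is evaluated
  after the transition: for the Glauber form it turns the sum over \<open>\<gamma>\<close> into the birth integral, and for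
  the Kawasaki form, together with the balance condition, it shows that a jump and its reversal have the
  same weight. Hence on cylinder functions each form is \<open>(F, G) \<mapsto> (A F, G)\<close> with \<open>A\<close> the claimed
  expression, which lies in $L^2$ by the integrability assumptions. A form represented in this way is
  closable, the generator of its closure extends \<open>A\<close>, and, the two forms being equal on cylinder
  functions, this generator is the Friedrichs extension.\<close>

section \<open>Forms represented by an operator\<close>

text \<open>Several obstacles shape the proof. The Papangelou identity speaks of non-negative,
  jointly measurable integrands, whereas the forms are signed; positive and negative parts are
  therefore transferred separately and recombined once both are finite. Since the inner measure, the
  points of \<gamma>, varies with \<gamma>, integrability is formulated for measures depending on a
  parameter. Joint measurability has to be extracted from the vague topology: numbers of points in
  relatively compact open sets determine the Borel structure, and membership, insertion and removal
  of a point are read off from such counts. When the difference of G is split into two values of G,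
  the remaining difference of F supplies the relatively compact set that the integrability
  assumptions require, while G is merely bounded. Closability rests on
  \<open>E (w m) (w n) = l2_inner M (A (w m)) (w n)\<close>, which tends to 0 as n grows with m
  fixed; freezing m avoids any bound on A.\<close>

lemma quadratic_nonneg_imp_discrim:
  fixes a b c :: real
  assumes "\<And>t. 0 \<le> a + 2 * b * t + c * t\<^sup>2"
  shows "b\<^sup>2 \<le> a * c"
proof (cases "c = 0")
  case True
  have "b = 0"
  proof (rule ccontr)
    assume "b \<noteq> 0"
    \<comment> \<open>For \<open>c = 0\<close> the expression is affine in t and equals -1 at this
      point.\<close>
    with assms[of "- (a + 1) / (2 * b)"] True show False
      by (simp add: field_simps)
  qed
  with True show ?thesis by simp
next
  case False
  have "0 \<le> c"
  proof (rule ccontr)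
    assume "\<not> 0 \<le> c"
    then have c: "c < 0" by simp
    \<comment> \<open>Large enough that \<open>c * t\<close> falls below
      \<open>- (1 + \<bar>a\<bar> + 2 * \<bar>b\<bar>)\<close>, and at least 1: in the quadratic
      term \<open>2 * \<bar>b\<bar>\<close> then absorbs the linear term,
      \<open>\<bar>a\<bar>\<close> absorbs the constant, and the 1 leaves a negative rest.\<close>
    define t where "t = (1 + \<bar>a\<bar> + 2 * \<bar>b\<bar>) / (- c) + 1"
    have t: "t \<ge> 1" using c by (simp add: t_def divide_nonneg_neg)
    have "c * t = - (1 + \<bar>a\<bar> + 2 * \<bar>b\<bar>) + c"
      using c by (simp add: t_def field_simps)
    then have ct: "c * t < - (1 + \<bar>a\<bar> + 2 * \<bar>b\<bar>)" using c by simp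
    have "c * t\<^sup>2 = (c * t) * t" by (simp add: power2_eq_square)
    also have "\<dots> \<le> - (1 + \<bar>a\<bar> + 2 * \<bar>b\<bar>) * t"
      using ct t by (intro mult_right_mono) auto
    finally have "a + 2 * b * t + c * t\<^sup>2 \<le> a + (2 * b - 1 - \<bar>a\<bar> - 2 * \<bar>b\<bar>) * t"
      by (simp add: algebra_simps)
    also have "\<dots> \<le> a + (- 1 - \<bar>a\<bar>) * t"
      using t by (intro add_left_mono mult_right_mono) auto
    also have "\<dots> \<le> a + (- 1 - \<bar>a\<bar>) * 1"
      using t by (intro add_left_mono mult_left_mono_neg) auto
    also have "\<dots> < 0" by simp
    finally show False using assms[of t] by simp
  qed
  with False have c: "0 < c" by simp
  \<comment> \<open>The point \<open>- b / c\<close> is the minimum of the quadratic.\<close>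
  have "0 \<le> a + 2 * b * (- b / c) + c * (- b / c)\<^sup>2" by (rule assms)
  also have "\<dots> = a - b\<^sup>2 / c"
    using c by (simp add: power2_eq_square field_simps)
  finally show ?thesis using c by (simp add: field_simps)
qed

section \<open>Inner product and norm on real $L^2$, elements being functions\<close>

lemma square_integrable_real:
  fixes f :: "'a \<Rightarrow> real"
  shows "square_integrable M f \<longleftrightarrow> f \<in> borel_measurable M \<and> integrable M (\<lambda>x. (f x)\<^sup>2)"
  by (simp add: square_integrable_def)

lemma square_integrable_mult:
  fixes f g :: "'a \<Rightarrow> real"
  assumes "square_integrable M f" "square_integrable M g"
  shows "integrable M (\<lambda>x. f x * g x)"
proof (rule Bochner_Integration.integrable_bound)
  show "integrable M (\<lambda>x. (f x)\<^sup>2 + (g x)\<^sup>2)"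
    using assms by (auto simp: square_integrable_real)
  show "(\<lambda>x. f x * g x) \<in> borel_measurable M"
    using assms by (auto simp: square_integrable_real)
  have "\<bar>a * b\<bar> \<le> a\<^sup>2 + b\<^sup>2" for a b :: real
  proof -
    have "0 \<le> (\<bar>a\<bar> - \<bar>b\<bar>)\<^sup>2" by simp
    then have "2 * \<bar>a * b\<bar> \<le> a\<^sup>2 + b\<^sup>2" by (simp add: power2_diff abs_mult)
    moreover have "\<bar>a * b\<bar> \<ge> 0" by simp
    ultimately show ?thesis by linarith
  qed
  then show "AE x in M. norm (f x * g x) \<le> norm ((f x)\<^sup>2 + (g x)\<^sup>2)"
    by (simp add: abs_of_nonneg)
qed

lemma square_integrable_scale:
  fixes f :: "'a \<Rightarrow> real"
  assumes "square_integrable M f"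
  shows "square_integrable M (\<lambda>x. a * f x)"
  using assms by (auto simp: square_integrable_real power_mult_distrib)

lemma square_integrable_add:
  fixes f g :: "'a \<Rightarrow> real"
  assumes "square_integrable M f" "square_integrable M g"
  shows "square_integrable M (\<lambda>x. f x + g x)"
  using assms square_integrable_mult[OF assms] unfolding square_integrable_real
  by (auto simp: power2_sum mult.assoc)

lemma square_integrable_diff:
  fixes f g :: "'a \<Rightarrow> real"
  assumes "square_integrable M f" "square_integrable M g"
  shows "square_integrable M (\<lambda>x. f x - g x)"
  using square_integrable_add[OF assms(1) square_integrable_scale[OF assms(2), of "-1"]] by simp

lemma l2_norm_square:
  fixes f :: "'a \<Rightarrow> real"
  shows "(l2_norm M f)\<^sup>2 = l2_inner M f f"
  by (simp add: l2_norm_def l2_inner_def power2_eq_square)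

lemma l2_norm_nonneg: "0 \<le> l2_norm M f"
  by (simp add: l2_norm_def)

lemma l2_norm_minus_commute:
  fixes f g :: "'a \<Rightarrow> real"
  shows "l2_norm M (\<lambda>x. f x - g x) = l2_norm M (\<lambda>x. g x - f x)"
  by (simp add: l2_norm_def power2_commute)

lemma l2_inner_commute: "l2_inner M f g = l2_inner M g f"
  by (simp add: l2_inner_def mult.commute)

lemma l2_inner_add_right:
  assumes "square_integrable M f" "square_integrable M g" "square_integrable M h"
  shows "l2_inner M f (\<lambda>x. g x + h x) = l2_inner M f g + l2_inner M f h"
  using assms by (simp add: l2_inner_def distrib_left square_integrable_mult)

lemma l2_inner_scale_right: "l2_inner M f (\<lambda>x. a * g x) = a * l2_inner M f g"
  by (simp add: l2_inner_def mult.left_commute)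

lemma l2_inner_diff_right:
  assumes "square_integrable M f" "square_integrable M g" "square_integrable M h"
  shows "l2_inner M f (\<lambda>x. g x - h x) = l2_inner M f g - l2_inner M f h"
  using assms by (simp add: l2_inner_def right_diff_distrib square_integrable_mult)

lemma l2_inner_cong_AE:
  assumes "AE x in M. f x = f' x" "AE x in M. g x = g' x"
    and "square_integrable M f" "square_integrable M f'"
    and "square_integrable M g" "square_integrable M g'"
  shows "l2_inner M f g = l2_inner M f' g'"
  unfolding l2_inner_def
proof (rule integral_cong_AE)
  show "AE x in M. f x * g x = f' x * g' x" using assms(1,2) by eventually_elim simp
qed (use assms in \<open>auto simp: square_integrable_real\<close>)

lemma l2_Cauchy_Schwarz:
  assumes "square_integrable M f" "square_integrable M g"
  shows "\<bar>l2_inner M f g\<bar> \<le> l2_norm M f * l2_norm M g"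
proof -
  have "0 \<le> l2_inner M f f + 2 * l2_inner M f g * t + l2_inner M g g * t\<^sup>2" for t
  proof -
    have "0 \<le> l2_inner M (\<lambda>x. f x + t * g x) (\<lambda>x. f x + t * g x)"
      by (simp add: l2_norm_square[symmetric])
    also have "\<dots> = (\<integral>x. f x * f x + 2 * t * (f x * g x) + t\<^sup>2 * (g x * g x) \<partial>M)"
      unfolding l2_inner_def
      by (intro Bochner_Integration.integral_cong refl) (simp add: power2_eq_square algebra_simps)
    also have "\<dots> = l2_inner M f f + 2 * t * l2_inner M f g + t\<^sup>2 * l2_inner M g g"
      using assms by (simp add: l2_inner_def square_integrable_mult)
    finally show ?thesis by (simp add: algebra_simps)
  qed
  then have "(l2_inner M f g)\<^sup>2 \<le> l2_inner M f f * l2_inner M g g"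
    by (rule quadratic_nonneg_imp_discrim)
  also have "\<dots> = (l2_norm M f * l2_norm M g)\<^sup>2"
    by (simp add: l2_norm_square power_mult_distrib)
  finally have "\<bar>l2_inner M f g\<bar> \<le> \<bar>l2_norm M f * l2_norm M g\<bar>"
    by (simp add: abs_le_square_iff)
  then show ?thesis by (simp add: l2_norm_nonneg)
qed

text \<open>Expand the square and bound the cross term by Cauchy-Schwarz. The halved form is the one
  in which density of \<open>D\<close> is checked.\<close>

lemma l2_norm_triangle_less:
  fixes f g :: "'a \<Rightarrow> real"
  assumes sq: "square_integrable M f" "square_integrable M g"
    and less: "l2_norm M f < e / 2" "l2_norm M g < e / 2"
  shows "l2_norm M (\<lambda>x. f x + g x) < e"
proof -
  have e: "0 < e" using less l2_norm_nonneg[of M f] by linarith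
  have "(l2_norm M (\<lambda>x. f x + g x))\<^sup>2 = (\<integral>x. f x * f x + 2 * (f x * g x) + g x * g x \<partial>M)"
    unfolding l2_norm_square l2_inner_def
    by (intro Bochner_Integration.integral_cong refl) (simp add: algebra_simps)
  also have "\<dots> = (l2_norm M f)\<^sup>2 + 2 * l2_inner M f g + (l2_norm M g)\<^sup>2"
    using sq unfolding l2_norm_square by (simp add: l2_inner_def square_integrable_mult)
  also have "\<dots> \<le> (l2_norm M f + l2_norm M g)\<^sup>2"
    using l2_Cauchy_Schwarz[OF sq] by (simp add: power2_sum)
  also have "\<dots> < e\<^sup>2"
    using less e by (intro power_strict_mono) (auto simp: l2_norm_nonneg)
  finally show ?thesis using e by (rule_tac power_less_imp_less_base) auto
qed

lemma l2_inner_tendsto: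
  assumes f: "square_integrable M f" and s: "\<And>n. square_integrable M (s n)"
    and v: "square_integrable M v"
    and lim: "(\<lambda>n. l2_norm M (\<lambda>x. s n x - v x)) \<longlonglongrightarrow> 0"
  shows "(\<lambda>n. l2_inner M f (s n)) \<longlonglongrightarrow> l2_inner M f v"
proof (rule Lim_null[THEN iffD2], rule Lim_null_comparison)
  show "\<forall>\<^sub>F n in sequentially. norm (l2_inner M f (s n) - l2_inner M f v)
          \<le> l2_norm M f * l2_norm M (\<lambda>x. s n x - v x)"
    using l2_Cauchy_Schwarz[OF f square_integrable_diff[OF s v]]
    by (simp add: l2_inner_diff_right[OF f s v])
  show "(\<lambda>n. l2_norm M f * l2_norm M (\<lambda>x. s n x - v x)) \<longlonglongrightarrow> 0"
    using tendsto_mult_right_zero[OF lim] .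
qed

section \<open>Closure and generator of a form represented by an operator\<close>

locale represented_form =
  fixes M :: "'a measure" and D :: "('a \<Rightarrow> real) set"
    and E :: "('a \<Rightarrow> real) \<Rightarrow> ('a \<Rightarrow> real) \<Rightarrow> real"
    and A :: "('a \<Rightarrow> real) \<Rightarrow> ('a \<Rightarrow> real)"
  assumes zero: "(\<lambda>_. 0) \<in> D"
    and add: "u \<in> D \<Longrightarrow> v \<in> D \<Longrightarrow> (\<lambda>x. u x + v x) \<in> D"
    and scale: "u \<in> D \<Longrightarrow> (\<lambda>x. a * u x) \<in> D"
    and sq: "u \<in> D \<Longrightarrow> square_integrable M u"
    and sqA: "u \<in> D \<Longrightarrow> square_integrable M (A u)"
    and represents: "u \<in> D \<Longrightarrow> v \<in> D \<Longrightarrow> E u v = l2_inner M (A u) v"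
    and sym: "u \<in> D \<Longrightarrow> v \<in> D \<Longrightarrow> E u v = E v u"
    and nonneg: "u \<in> D \<Longrightarrow> 0 \<le> E u u"
begin

lemma diff: "u \<in> D \<Longrightarrow> v \<in> D \<Longrightarrow> (\<lambda>x. u x - v x) \<in> D"
  using add[OF _ scale[of v "-1"], of u] by simp

text \<open>Bilinearity of \<open>E\<close> is a consequence of the representation: on the right it
  is linearity of the inner product, on the left it follows by \<open>sym\<close>.\<close>

lemma E_add_right: "u \<in> D \<Longrightarrow> v \<in> D \<Longrightarrow> w \<in> D \<Longrightarrow> E u (\<lambda>x. v x + w x) = E u v + E u w"
  by (simp add: represents add l2_inner_add_right sq sqA)

lemma E_diff_right: "u \<in> D \<Longrightarrow> v \<in> D \<Longrightarrow> w \<in> D \<Longrightarrow> E u (\<lambda>x. v x - w x) = E u v - E u w"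
  by (simp add: represents diff l2_inner_diff_right sq sqA)

lemma E_scale_right: "u \<in> D \<Longrightarrow> v \<in> D \<Longrightarrow> E u (\<lambda>x. a * v x) = a * E u v"
  by (simp add: represents scale l2_inner_scale_right)

lemma E_add_left: "u \<in> D \<Longrightarrow> v \<in> D \<Longrightarrow> w \<in> D \<Longrightarrow> E (\<lambda>x. v x + w x) u = E v u + E w u"
  using E_add_right[of u v w] by (simp add: sym add)

lemma E_diff_left: "u \<in> D \<Longrightarrow> v \<in> D \<Longrightarrow> w \<in> D \<Longrightarrow> E (\<lambda>x. v x - w x) u = E v u - E w u"
  using E_diff_right[of u v w] by (simp add: sym diff)

lemma E_scale_left: "u \<in> D \<Longrightarrow> v \<in> D \<Longrightarrow> E (\<lambda>x. a * v x) u = a * E v u"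
  using E_scale_right[of u v a] by (simp add: sym scale)

lemma E_Cauchy_Schwarz:
  assumes u: "u \<in> D" and v: "v \<in> D"
  shows "\<bar>E u v\<bar> \<le> sqrt (E u u) * sqrt (E v v)"
proof -
  have "0 \<le> E u u + 2 * E u v * t + E v v * t\<^sup>2" for t
  proof -
    have tv: "(\<lambda>x. t * v x) \<in> D" by (rule scale[OF v])
    have "0 \<le> E (\<lambda>x. u x + t * v x) (\<lambda>x. u x + t * v x)"
      by (intro nonneg add u tv)
    also have "\<dots> = E u u + t * E u v + (t * E v u + t * (t * E v v))"
      by (simp add: E_add_left E_add_right E_scale_left E_scale_right add u v tv)
    finally show ?thesis using sym[OF u v] by (simp add: algebra_simps power2_eq_square)
  qed
  then have "(E u v)\<^sup>2 \<le> E u u * E v v"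
    by (rule quadratic_nonneg_imp_discrim)
  then have "sqrt ((E u v)\<^sup>2) \<le> sqrt (E u u * E v v)" by (rule real_sqrt_le_mono)
  then show ?thesis by (simp add: real_sqrt_mult)
qed

text \<open>The right side minus the left side is the form at u - 2v, which is non-negative. The
  estimate bounds a form-Cauchy sequence by one of its members.\<close>

lemma E_diff_le:
  assumes u: "u \<in> D" and v: "v \<in> D"
  shows "E u u \<le> 2 * E (\<lambda>x. u x - v x) (\<lambda>x. u x - v x) + 2 * E v v"
proof -
  have v2: "(\<lambda>x. 2 * v x) \<in> D" by (rule scale[OF v])
  have "0 \<le> E (\<lambda>x. u x - 2 * v x) (\<lambda>x. u x - 2 * v x)"
    by (intro nonneg diff u v2)
  also have "\<dots> = E u u - 4 * E u v + 4 * E v v"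
    using sym[OF v u] by (simp add: E_diff_left E_diff_right E_scale_left E_scale_right diff u v v2)
  finally show ?thesis
    using sym[OF v u] by (simp add: E_diff_left E_diff_right diff u v)
qed

lemma form_approxD:
  assumes "form_approx M E D u s"
  shows "s n \<in> D" "(\<lambda>n. l2_norm M (\<lambda>x. s n x - u x)) \<longlonglongrightarrow> 0"
    "e > 0 \<Longrightarrow> \<exists>n0. \<forall>m\<ge>n0. \<forall>n\<ge>n0. E (\<lambda>x. s m x - s n x) (\<lambda>x. s m x - s n x) < e"
  using assms by (auto simp: form_approx_def)

lemma E_zero: "E (\<lambda>_. 0) (\<lambda>_. 0) = 0"
  by (simp add: represents zero l2_inner_def)

lemma form_approx_const: "u \<in> D \<Longrightarrow> form_approx M E D u (\<lambda>_. u)"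
  by (simp add: form_approx_def E_zero l2_norm_def)

lemma domain_subset_closure_dom: "D \<subseteq> closure_dom M E D"
  using form_approx_const sq by (auto simp: closure_dom_def)

text \<open>The Cauchy property for \<epsilon> = 1 compares every late member with
  \<open>s n0\<close> through \<open>E_diff_le\<close>.\<close>

lemma form_approx_eventually_bounded:
  assumes "form_approx M E D u s"
  obtains C n0 where "C > 0" "\<And>n. n \<ge> n0 \<Longrightarrow> E (s n) (s n) \<le> C"
proof -
  note s = form_approxD[OF assms]
  obtain n0 where n0: "\<forall>m\<ge>n0. \<forall>n\<ge>n0. E (\<lambda>x. s m x - s n x) (\<lambda>x. s m x - s n x) < 1"
    using s(3)[of 1] by auto
  have "E (s n) (s n) \<le> 2 + 2 * E (s n0) (s n0)" if "n \<ge> n0" for n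
    using E_diff_le[OF s(1)[of n] s(1)[of n0]] n0[rule_format, OF that order_refl] by linarith
  then show thesis using that[of "2 + 2 * E (s n0) (s n0)" n0] nonneg[OF s(1)[of n0]] by auto
qed

text \<open>This is closability. Split \<open>E (w n) (w n)\<close> into the form of
  \<open>w n - w m\<close> with \<open>w n\<close>, small by Cauchy-Schwarz and boundedness, and
  \<open>E (w m) (w n)\<close>, which is the inner product of the single $L^2$ function
  \<open>A (w m)\<close> with \<open>w n\<close> and vanishes as n grows.\<close>

lemma form_approx_zero_tendsto:
  assumes w: "form_approx M E D (\<lambda>_. 0) w"
  shows "(\<lambda>n. E (w n) (w n)) \<longlonglongrightarrow> 0"
proof (rule LIMSEQ_I)
  fix e :: real assume e: "0 < e"
  note wD = form_approxD[OF w]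
  obtain C n1 where C: "C > 0" "\<And>n. n \<ge> n1 \<Longrightarrow> E (w n) (w n) \<le> C"
    using form_approx_eventually_bounded[OF w] by blast
  define d where "d = e\<^sup>2 / (4 * C)"
  have d: "d > 0" using e C by (simp add: d_def)
  have sqdC: "sqrt d * sqrt C = e / 2"
    using e C unfolding real_sqrt_mult[symmetric] d_def
    by (simp add: real_sqrt_divide)
  obtain n0 where n0: "\<forall>m\<ge>n0. \<forall>n\<ge>n0. E (\<lambda>x. w m x - w n x) (\<lambda>x. w m x - w n x) < d"
    using wD(3)[OF d] by auto
  define m where "m = n0"
  have "(\<lambda>n. l2_inner M (A (w m)) (w n)) \<longlonglongrightarrow> l2_inner M (A (w m)) (\<lambda>_. 0)"
    by (rule l2_inner_tendsto) (use wD sq sqA zero in auto)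
  then have "(\<lambda>n. E (w m) (w n)) \<longlonglongrightarrow> 0"
    using wD(1) by (simp add: represents l2_inner_def)
  from LIMSEQ_D[OF this, of "e / 2"] e obtain n2 where
    n2: "\<And>n. n \<ge> n2 \<Longrightarrow> \<bar>E (w m) (w n)\<bar> < e / 2" by auto
  have "\<bar>E (w n) (w n)\<bar> < e" if n: "n \<ge> n0" "n \<ge> n1" "n \<ge> n2" for n
  proof -
    let ?z = "\<lambda>x. w n x - w m x"
    have "E (w n) (w n) = E ?z (w n) + E (w m) (w n)"
      by (simp add: E_diff_left wD)
    moreover have "\<bar>E ?z (w n)\<bar> \<le> sqrt (E ?z ?z) * sqrt (E (w n) (w n))"
      by (intro E_Cauchy_Schwarz diff wD)
    moreover have "\<dots> \<le> sqrt d * sqrt C"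
    proof (intro mult_mono real_sqrt_le_mono)
      show "E ?z ?z \<le> d"
        using n0[rule_format, of n m] n by (simp add: m_def)
    qed (use C(2)[OF n(2)] d nonneg[OF wD(1)] in auto)
    ultimately show ?thesis using n2[OF n(3)] sqdC by linarith
  qed
  then show "\<exists>no. \<forall>n\<ge>no. norm (E (w n) (w n) - 0) < e"
    by (intro exI[of _ "max n0 (max n1 n2)"]) auto
qed

text \<open>Replacing \<open>t\<close> by the constant sequence u costs
  \<open>E (s n) (w n)\<close>, where w approximates 0; closability and Cauchy-Schwarz send it to 0.
  What remains is the inner product of \<open>A u\<close> with \<open>s n\<close>. With one argument
  in \<open>D\<close> the limit is thus explicit, and this is the case needed to identify the
  generator on \<open>D\<close>.\<close>

lemma form_approx_tendsto:
  assumes u: "u \<in> D" and v: "square_integrable M v"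
    and s: "form_approx M E D v s" and t: "form_approx M E D u t"
  shows "(\<lambda>n. E (s n) (t n)) \<longlonglongrightarrow> l2_inner M (A u) v"
proof -
  note sD = form_approxD[OF s] and tD = form_approxD[OF t]
  define w where "w n = (\<lambda>x. t n x - u x)" for n
  have w: "w n \<in> D" for n by (simp add: w_def diff tD u)
  have "form_approx M E D (\<lambda>_. 0) w"
    using t w unfolding form_approx_def by (simp add: w_def)
  from form_approx_zero_tendsto[OF this] have wlim: "(\<lambda>n. E (w n) (w n)) \<longlonglongrightarrow> 0" .
  obtain C n0 where C: "C > 0" "\<And>n. n \<ge> n0 \<Longrightarrow> E (s n) (s n) \<le> C"
    using form_approx_eventually_bounded[OF s] by blast
  have "(\<lambda>n. E (s n) (w n)) \<longlonglongrightarrow> 0"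
  proof (rule Lim_null_comparison)
    show "\<forall>\<^sub>F n in sequentially. norm (E (s n) (w n)) \<le> sqrt C * sqrt (E (w n) (w n))"
    proof (rule eventually_sequentiallyI)
      fix n assume n: "n0 \<le> n"
      have "norm (E (s n) (w n)) \<le> sqrt (E (s n) (s n)) * sqrt (E (w n) (w n))"
        using E_Cauchy_Schwarz[OF sD(1) w] by simp
      also have "\<dots> \<le> sqrt C * sqrt (E (w n) (w n))"
        using C(2)[OF n] by (intro mult_right_mono real_sqrt_le_mono) (auto simp: nonneg w)
      finally show "norm (E (s n) (w n)) \<le> sqrt C * sqrt (E (w n) (w n))" .
    qed
    show "(\<lambda>n. sqrt C * sqrt (E (w n) (w n))) \<longlonglongrightarrow> 0"
      using tendsto_mult_right_zero[OF tendsto_real_sqrt[OF wlim, simplified]] .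
  qed
  moreover have "(\<lambda>n. l2_inner M (A u) (s n)) \<longlonglongrightarrow> l2_inner M (A u) v"
    by (rule l2_inner_tendsto) (use sD sq sqA u v in auto)
  ultimately have "(\<lambda>n. l2_inner M (A u) (s n) + E (s n) (w n)) \<longlonglongrightarrow> l2_inner M (A u) v + 0"
    by (intro tendsto_add)
  moreover have "l2_inner M (A u) (s n) + E (s n) (w n) = E (s n) (t n)" for n
  proof -
    have "E (s n) (w n) = E (s n) (t n) - E (s n) u"
      unfolding w_def by (rule E_diff_right) (auto simp: sD tD u)
    moreover have "E (s n) u = l2_inner M (A u) (s n)"
      using sym[OF sD(1) u] represents[OF u sD(1)] by simp
    ultimately show ?thesis by simp
  qed
  ultimately show ?thesis by simp
qed

text \<open>The description by \<open>THE\<close> needs existence and uniqueness of the limit.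
  Uniqueness uses that approximating pairs exist at all: for v by membership in the closure domain,
  for u by the constant sequence.\<close>

lemma closure_form_eq:
  assumes u: "u \<in> D" and v: "v \<in> closure_dom M E D"
  shows "closure_form M E D v u = l2_inner M (A u) v"
  unfolding closure_form_def
proof (rule the_equality)
  have vsq: "square_integrable M v" using v by (simp add: closure_dom_def)
  show "\<forall>s t. form_approx M E D v s \<longrightarrow> form_approx M E D u t \<longrightarrow>
      (\<lambda>n. E (s n) (t n)) \<longlonglongrightarrow> l2_inner M (A u) v"
    using form_approx_tendsto[OF u vsq] by blast
  fix l assume l: "\<forall>s t. form_approx M E D v s \<longrightarrow> form_approx M E D u t \<longrightarrow>
      (\<lambda>n. E (s n) (t n)) \<longlonglongrightarrow> l"
  obtain s where s: "form_approx M E D v s" using v by (auto simp: closure_dom_def)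
  from l s form_approx_const[OF u] have "(\<lambda>n. E (s n) u) \<longlonglongrightarrow> l" by blast
  with form_approx_tendsto[OF u vsq s form_approx_const[OF u]]
  show "l = l2_inner M (A u) v" by (rule LIMSEQ_unique[rotated])
qed

text \<open>The Friedrichs extension is defined through the form built from its own operator, which
  agrees with \<open>E\<close> on \<open>D\<close>. The closure sees nothing else, since
  approximating sequences and their differences stay in \<open>D\<close>.\<close>

lemma closure_cong:
  assumes eq: "\<And>u v. u \<in> D \<Longrightarrow> v \<in> D \<Longrightarrow> E' u v = E u v"
  shows "closure_dom M E' D = closure_dom M E D" "closure_form M E' D = closure_form M E D"
proof -
  have approx: "form_approx M E' D u s \<longleftrightarrow> form_approx M E D u s" for u s
    unfolding form_approx_def by (auto simp: eq diff)
  then show "closure_dom M E' D = closure_dom M E D"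
    by (simp add: closure_dom_def)
  show "closure_form M E' D = closure_form M E D"
  proof (intro ext)
    fix u v
    have "(\<lambda>n. E' (s n) (t n)) = (\<lambda>n. E (s n) (t n))"
      if "form_approx M E D u s" "form_approx M E D v t" for s t
      using that by (auto simp: form_approxD(1) eq)
    then show "closure_form M E' D u v = closure_form M E D u v"
      unfolding closure_form_def approx by (auto intro!: arg_cong[where f = The] ext)
  qed
qed

text \<open>Density of \<open>D\<close> is not an assumption: the generator is densely defined on elements of the
  closure, which \<open>D\<close> approximates.\<close>

lemma closure_generator_extends:
  assumes gen: "is_closure_generator M E D H DH"
  shows "D \<subseteq> DH" "u \<in> D \<Longrightarrow> AE x in M. H u x = A u x"
    "is_friedrichs_extension M H D H DH"
proof -
  have sa: "self_adjoint M H DH" and nn: "nonneg_operator M H DH"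
    and sub: "DH \<subseteq> closure_dom M E D"
    and repr: "\<And>u v. u \<in> DH \<Longrightarrow> v \<in> closure_dom M E D \<Longrightarrow> closure_form M E D u v = l2_inner M (H u) v"
    using gen by (auto simp: is_closure_generator_def is_generator_def)
  have lin: "linear_operator M H DH" and dense: "l2_dense M DH"
    and graph: "adjoint_graph M H DH = operator_graph M H DH"
    using sa by (auto simp: self_adjoint_def)
  \<comment> \<open>Every v in \<open>DH\<close> satisfies (H v, u) = (v, A u), so the pair (u, A u)
    lies in the graph of the adjoint of H. Self-adjointness identifies this graph with that of H and
    thereby puts u into \<open>DH\<close>.\<close>
  have ext: "u \<in> DH \<and> (AE x in M. H u x = A u x)" if u: "u \<in> D" for u
  proof -
    have "l2_inner M (H v) u = l2_inner M v (A u)" if v: "v \<in> DH" for v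
    proof -
      have "l2_inner M (H v) u = closure_form M E D v u"
        using repr[OF v] domain_subset_closure_dom u by auto
      also have "\<dots> = l2_inner M (A u) v"
        using closure_form_eq[OF u] v sub by blast
      finally show ?thesis by (simp add: l2_inner_commute)
    qed
    then have "(u, A u) \<in> adjoint_graph M H DH"
      using u sq sqA by (auto simp: adjoint_graph_def)
    then have "u \<in> DH" "AE x in M. A u x = H u x"
      unfolding graph by (auto simp: operator_graph_def)
    then show ?thesis by auto
  qed
  show D: "D \<subseteq> DH" using ext by auto
  show "AE x in M. H u x = A u x" if "u \<in> D" for u using ext that by auto
  have Hsq: "square_integrable M (H u)" if "u \<in> DH" for u
    using lin that by (simp add: linear_operator_def)
  have lin': "linear_operator M H D"
    using lin D unfolding linear_operator_def
    by (intro conjI zero ballI allI add scale impI) blast+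
  have dense': "l2_dense M D"
    unfolding l2_dense_def
  proof (intro allI impI)
    fix u :: "'a \<Rightarrow> real" and e :: real
    assume u: "square_integrable M u" and e: "0 < e"
    obtain v where v: "v \<in> DH" "l2_norm M (\<lambda>x. u x - v x) < e / 2"
      using dense u e unfolding l2_dense_def by (meson half_gt_zero)
    then have vsq: "square_integrable M v" and "\<exists>s. form_approx M E D v s"
      using sub by (auto simp: closure_dom_def)
    then obtain s where s: "form_approx M E D v s" by blast
    note sD = form_approxD[OF s]
    from LIMSEQ_D[OF sD(2), of "e / 2"] e obtain n where "norm (l2_norm M (\<lambda>x. s n x - v x)) < e / 2"
      by auto
    then have n: "l2_norm M (\<lambda>x. v x - s n x) < e / 2"
      by (simp add: l2_norm_minus_commute[of M v])
    have "l2_norm M (\<lambda>x. (u x - v x) + (v x - s n x)) < e"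
      by (intro l2_norm_triangle_less square_integrable_diff u vsq sq sD(1) v(2) n)
    then show "\<exists>v\<in>D. l2_norm M (\<lambda>x. u x - v x) < e" using sD(1) by auto
  qed
  \<comment> \<open>The same graph equality read backwards: H is contained in its adjoint.\<close>
  have sym': "l2_inner M (H u) v = l2_inner M u (H v)" if "u \<in> D" "v \<in> D" for u v
  proof -
    have "(v, H v) \<in> operator_graph M H DH"
      using that D Hsq by (auto simp: operator_graph_def)
    then have "(v, H v) \<in> adjoint_graph M H DH" using graph by simp
    then show ?thesis using that D by (auto simp: adjoint_graph_def)
  qed
  \<comment> \<open>This agreement on \<open>D\<close> lets \<open>closure_cong\<close> replace the
    form of H by \<open>E\<close>, for whose closure H is the generator by
    \<open>gen\<close>.\<close>
  have eqE: "l2_inner M (H u) v = E u v" if "u \<in> D" "v \<in> D" for u v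
    unfolding represents[OF that]
    by (rule l2_inner_cong_AE) (use that ext sq sqA Hsq in auto)
  have nonneg': "nonneg_operator M H D"
    using nn D by (auto simp: nonneg_operator_def)
  show "is_friedrichs_extension M H D H DH"
    unfolding is_friedrichs_extension_def symmetric_operator_def is_closure_generator_def
    using lin' dense' sym' nonneg' gen[unfolded is_closure_generator_def]
    by (simp add: closure_cong[of "\<lambda>u v. l2_inner M (H u) v", OF eqE])
qed

end

section \<open>The Borel structure of the configuration space\<close>

lemma configs_finite_Int:
  assumes "\<gamma> \<in> configs" "compact (closure U)"
  shows "finite (\<gamma> \<inter> U)"
  using assms closure_subset[of U] by (auto simp: configs_def intro: finite_subset[of _ "\<gamma> \<inter> closure U"])

lemma configs_insert: "\<gamma> \<in> configs \<Longrightarrow> insert x \<gamma> \<in> configs"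
  by (auto simp: configs_def Int_insert_left)

lemma configs_remove: "\<gamma> \<in> configs \<Longrightarrow> \<gamma> - {x} \<in> configs"
  unfolding configs_def by (auto intro: rev_finite_subset)

text \<open>T is any finite window containing all points of \<gamma> where f does not vanish; it
  will be a trace of \<gamma> on a set containing the support, or a finite set of displaced
  points.\<close>

lemma pairing_eq_sum:
  assumes "finite T" "T \<subseteq> \<gamma>" "\<And>x. x \<in> \<gamma> \<Longrightarrow> x \<notin> T \<Longrightarrow> f x = 0"
  shows "pairing f \<gamma> = sum f T"
proof -
  have fin: "finite {a \<in> \<gamma>. f a \<noteq> 0}"
    using assms by (intro finite_subset[OF _ assms(1)]) auto
  show ?thesis
    unfolding pairing_def lebesgue_integral_count_space_finite_support[OF fin]
    using assms by (intro sum.mono_neutral_cong_left) auto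
qed

lemma topspace_vague_topology: "topspace vague_topology = configs"
proof -
  have "(\<lambda>_. 0) \<in> C0" by (simp add: C0_def)
  then show ?thesis
    unfolding vague_topology_def topology_generated_by_topspace by blast
qed

lemma openin_vague_pairing:
  "f \<in> C0 \<Longrightarrow> open U \<Longrightarrow> openin vague_topology {\<gamma> \<in> configs. pairing f \<gamma> \<in> U}"
  unfolding vague_topology_def by (rule topology_generated_by_Basis) blast

lemma openin_vague_subset: "openin vague_topology U \<Longrightarrow> U \<subseteq> configs"
  using openin_subset topspace_vague_topology by blast

lemma space_config_space [simp]: "space config_space = configs"
  unfolding config_space_def by (rule space_measure_of) (auto dest: openin_vague_subset)

lemma sets_config_space: "sets config_space = sigma_sets configs {U. openin vague_topology U}"
  unfolding config_space_def by (rule sets_measure_of) (auto dest: openin_vague_subset)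

lemma pairwise_disjoint_neighbourhoods:
  fixes A :: "'x::t2_space set"
  assumes "finite A"
  shows "\<exists>N. (\<forall>x\<in>A. open (N x) \<and> x \<in> N x) \<and> (\<forall>x\<in>A. \<forall>y\<in>A. x \<noteq> y \<longrightarrow> N x \<inter> N y = {})"
  using assms
proof (induction A)
  case empty
  then show ?case by simp
next
  case (insert a A)
  from insert.IH obtain N where N: "\<And>x. x \<in> A \<Longrightarrow> open (N x) \<and> x \<in> N x"
    "\<And>x y. x \<in> A \<Longrightarrow> y \<in> A \<Longrightarrow> x \<noteq> y \<Longrightarrow> N x \<inter> N y = {}" by metis
  have "\<forall>x\<in>A. \<exists>U V. open U \<and> open V \<and> x \<in> U \<and> a \<in> V \<and> U \<inter> V = {}"
    using insert.hyps by (metis hausdorff)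
  then obtain U V where UV: "\<And>x. x \<in> A \<Longrightarrow> open (U x) \<and> open (V x) \<and> x \<in> U x \<and> a \<in> V x \<and> U x \<inter> V x = {}"
    by metis
  \<comment> \<open>The new point gets the intersection of the finitely many sets separating it from
    the old points; each old neighbourhood shrinks to its own side of the separation.\<close>
  define N' where "N' x = (if x = a then \<Inter>y\<in>A. V y else N x \<inter> U x)" for x
  have "open (\<Inter>y\<in>A. V y)" using insert.hyps UV by (intro open_INT) auto
  then have "\<forall>x\<in>insert a A. open (N' x) \<and> x \<in> N' x"
    using N(1) UV by (auto simp: N'_def)
  moreover have "N' x \<inter> N' y = {}" if "x \<in> insert a A" "y \<in> insert a A" "x \<noteq> y" for x y
  proof -
    have *: "N' a \<inter> N' z = {}" if "z \<in> A" for z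
      using that UV[OF that] insert.hyps(2) by (auto simp: N'_def)
    consider "x = a" "y \<in> A" | "y = a" "x \<in> A" | "x \<in> A" "y \<in> A" "x \<noteq> a" "y \<noteq> a"
      using \<open>x \<in> insert a A\<close> \<open>y \<in> insert a A\<close> \<open>x \<noteq> y\<close> by blast
    then show ?thesis
    proof cases
      case 3
      then show ?thesis using \<open>x \<noteq> y\<close> N(2)[of x y] by (auto simp: N'_def)
    qed (use * in auto)
  qed
  ultimately show ?case by blast
qed

text \<open>The union of the closures is compact, hence closed, and so contains the closure of the
  union.\<close>

lemma compact_closure_UN:
  fixes V :: "'i \<Rightarrow> 'x::t2_space set"
  assumes "finite A" "\<And>x. x \<in> A \<Longrightarrow> compact (closure (V x))"
  shows "compact (closure (\<Union>x\<in>A. V x))"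
proof -
  have c: "compact (\<Union>x\<in>A. closure (V x))" using assms by (intro compact_UN) auto
  have "closure (\<Union>x\<in>A. V x) \<subseteq> (\<Union>x\<in>A. closure (V x))"
    using closure_subset by (intro closure_minimal compact_imp_closed[OF c]) blast
  with c show ?thesis by (metis closed_closure compact_Int_closed inf.absorb2)
qed

text \<open>\<open>SOME\<close> fixes one countable basis per type, so that the basis and the
  exhaustion are constants without parameters. In a locally compact Hausdorff space, the members
  with compact closure still form a basis.\<close>

definition rc_basis :: "'x::second_countable_topology set set" where
  "rc_basis = {U. U \<in> (SOME B. countable B \<and> topological_basis B) \<and> compact (closure U)}"

definition exhaustion :: "nat \<Rightarrow> 'x::second_countable_topology set" where
  "exhaustion n = (\<Union>i<n. from_nat_into rc_basis i)"

section \<open>Countable bases and vague Borel sets over a locally compact space\<close>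

context
  assumes lc: "locally compact (UNIV :: 'x::{second_countable_topology, t2_space} set)"
begin

lemma some_basis:
  "countable (SOME B. countable B \<and> topological_basis (B :: 'x set set))"
  "topological_basis (SOME B. countable B \<and> topological_basis (B :: 'x set set))"
proof -
  have "\<exists>B. countable B \<and> topological_basis (B :: 'x set set)" by (rule ex_countable_basis)
  from someI_ex[OF this]
  show "countable (SOME B. countable B \<and> topological_basis (B :: 'x set set))"
    "topological_basis (SOME B. countable B \<and> topological_basis (B :: 'x set set))" by auto
qed

lemma countable_rc_basis: "countable (rc_basis :: 'x set set)"
  using some_basis(1) by (rule countable_subset[rotated]) (auto simp: rc_basis_def)

lemma rc_basisD:
  assumes "U \<in> (rc_basis :: 'x set set)" shows "open U" "compact (closure U)"
  using assms topological_basis_open[OF some_basis(2)] by (auto simp: rc_basis_def)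

text \<open>Local compactness gives an open u around x and a compact v with u inside v inside W. A
  basis member inside u has its closure inside v, because compact sets are closed in a Hausdorff
  space, and so has compact closure.\<close>

lemma rc_basis_ex:
  assumes "open W" "(x :: 'x) \<in> W"
  shows "\<exists>U\<in>rc_basis. x \<in> U \<and> U \<subseteq> W"
proof -
  obtain u v where uv: "open u" "compact v" "x \<in> u" "u \<subseteq> v" "v \<subseteq> W"
    using lc assms unfolding locally_def by (metis open_openin top_greatest subtopology_UNIV)
  obtain U where U: "U \<in> (SOME B. countable B \<and> topological_basis (B :: 'x set set))" "x \<in> U" "U \<subseteq> u"
    using topological_basisE[OF some_basis(2) uv(1,3)] by blast
  have "closure U \<subseteq> v"
    using U uv by (intro closure_minimal compact_imp_closed) auto
  then have "compact (closure U)"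
    using uv(2) by (metis closed_closure compact_Int_closed inf.absorb2)
  with U uv show ?thesis by (auto simp: rc_basis_def)
qed

lemma exhaustion:
  "open (exhaustion n :: 'x set)" "compact (closure (exhaustion n :: 'x set))"
  "incseq (exhaustion :: nat \<Rightarrow> 'x set)" "(\<Union>n. exhaustion n) = (UNIV :: 'x set)"
proof -
  have ne: "(rc_basis :: 'x set set) \<noteq> {}" using rc_basis_ex[of UNIV undefined] by auto
  have mem: "from_nat_into rc_basis i \<in> (rc_basis :: 'x set set)" for i
    by (rule from_nat_into[OF ne])
  show "open (exhaustion n :: 'x set)"
    unfolding exhaustion_def using rc_basisD(1)[OF mem] by blast
  show "compact (closure (exhaustion n :: 'x set))"
    unfolding exhaustion_def using rc_basisD(2)[OF mem] by (intro compact_closure_UN) auto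
  show "incseq (exhaustion :: nat \<Rightarrow> 'x set)"
    by (force simp: incseq_def exhaustion_def)
  have "x \<in> (\<Union>n. exhaustion n)" for x :: 'x
  proof -
    obtain U where U: "U \<in> rc_basis" "x \<in> U" using rc_basis_ex[of UNIV x] by auto
    then obtain i where "U = from_nat_into rc_basis i"
      using from_nat_into_surj[OF countable_rc_basis] by metis
    \<comment> \<open>\<open>exhaustion n\<close> collects the indices below n, so the set with
      index i enters at \<open>Suc i\<close>.\<close>
    with U show "x \<in> (\<Union>n. exhaustion n)"
      by (auto simp: exhaustion_def intro!: exI[of _ "Suc i"])
  qed
  then show "(\<Union>n. exhaustion n) = (UNIV :: 'x set)" by blast
qed

text \<open>A point outside \<gamma> has a relatively compact open neighbourhood meeting \<gamma> in
  finitely many points, and these can be removed from it.\<close>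

lemma configs_closed:
  assumes "\<gamma> \<in> (configs :: 'x set set)" shows "closed \<gamma>"
  unfolding closed_def
proof (subst open_subopen, intro ballI)
  fix x assume x: "x \<in> - \<gamma>"
  obtain U where U: "U \<in> rc_basis" "x \<in> U" using rc_basis_ex[of UNIV x] by auto
  have "finite (\<gamma> \<inter> U)" using assms U rc_basisD by (intro configs_finite_Int) auto
  then have "open (U - (\<gamma> \<inter> U))"
    using rc_basisD(1)[OF U(1)] by (intro open_Diff finite_imp_closed)
  then show "\<exists>T. open T \<and> x \<in> T \<and> T \<subseteq> - \<gamma>"
    using x U by (intro exI[of _ "U - (\<gamma> \<inter> U)"]) auto
qed

lemma configs_countable:
  assumes "\<gamma> \<in> (configs :: 'x set set)" shows "countable \<gamma>"
proof -
  have "countable (\<Union>n. \<gamma> \<inter> exhaustion n)"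
    using configs_finite_Int[OF assms exhaustion(2)] by (intro countable_UN countableI_type countable_finite)
  then show ?thesis by (simp add: exhaustion(4) flip: Int_UN_distrib)
qed

text \<open>Urysohn's lemma for the finite set A and the complement of W, a finite union of
  relatively compact basis sets. W is returned too: f vanishes outside it, so that pairing a
  configuration with f becomes a finite sum over points in U.\<close>

lemma C0_bump:
  assumes "finite A" "open U" "A \<subseteq> (U :: 'x set)"
  obtains f W where "f \<in> C0" "open W" "W \<subseteq> U" "compact (closure W)"
    "\<And>x. 0 \<le> f x" "\<And>x. f x \<le> 1" "\<And>x. x \<in> A \<Longrightarrow> f x = 1" "\<And>x. x \<notin> W \<Longrightarrow> f x = 0"
proof -
  obtain V where V: "\<And>x. x \<in> A \<Longrightarrow> V x \<in> rc_basis \<and> x \<in> V x \<and> V x \<subseteq> U"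
    using rc_basis_ex[OF assms(2)] assms(3) by (metis subsetD)
  define W where "W = (\<Union>x\<in>A. V x)"
  have W: "open W" "W \<subseteq> U" "A \<subseteq> W"
    using V rc_basisD(1) by (auto simp: W_def)
  have cW: "compact (closure W)"
    unfolding W_def using V rc_basisD(2) assms(1) by (intro compact_closure_UN) auto
  have "locally_compact_space (euclidean :: 'x topology)"
    unfolding locally_compact_space_def
  proof (intro ballI)
    fix x :: 'x
    obtain U where "U \<in> rc_basis" "x \<in> U" using rc_basis_ex[of UNIV x] by auto
    then show "\<exists>U K. openin euclidean U \<and> compactin euclidean K \<and> x \<in> U \<and> U \<subseteq> K"
      using rc_basisD closure_subset by (intro exI[of _ U] exI[of _ "closure U"]) auto
  qed
  moreover have "Hausdorff_space (euclidean :: 'x topology)"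
    unfolding Hausdorff_space_def by (metis disjnt_def hausdorff open_openin)
  ultimately have cr: "completely_regular_space (euclidean :: 'x topology)"
    by (intro locally_compact_regular_imp_completely_regular_space) auto
  obtain f where f: "continuous_map euclidean (top_of_set {0..1::real}) f" "f ` (- W) \<subseteq> {0}" "f ` A \<subseteq> {1}"
  proof (rule Urysohn_completely_regular_compact_closed[OF _ cr, of 0 1 A "- W"])
    show "compactin euclidean A" using assms(1) by (simp add: finite_imp_compact)
  qed (use W in \<open>auto simp: disjnt_def\<close>)
  have "continuous_on UNIV f" "\<And>x. 0 \<le> f x \<and> f x \<le> 1"
    using f(1) by (auto simp: continuous_map_in_subtopology image_subset_iff)
  moreover have "compact (closure {x. f x \<noteq> 0})"
  proof -
    have "closure {x. f x \<noteq> 0} \<subseteq> closure W" using f(2) by (intro closure_mono) auto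
    then show ?thesis using cW
      by (metis closed_closure compact_Int_closed inf.absorb2)
  qed
  ultimately show thesis
    using W cW f by (intro that[of f W]) (auto simp: C0_def image_subset_iff)
qed

text \<open>Take a bump f with f = 1 on A: near \<gamma> the pairing exceeds n - 1, and since f
  \<le> 1 it is at most the number of points in W. The statement asks for a finite subset of n
  points because \<open>card\<close> is 0 on infinite sets and U may contain infinitely many points
  of \<gamma>.\<close>

lemma openin_vague_card_ge:
  assumes "open U"
  shows "openin vague_topology {\<gamma> \<in> (configs :: 'x set set). \<exists>A. A \<subseteq> \<gamma> \<inter> U \<and> finite A \<and> card A = n}"
    (is "openin _ ?S")
proof (subst openin_subopen, intro ballI)
  fix \<gamma> assume "\<gamma> \<in> ?S"
  then obtain A where \<gamma>: "\<gamma> \<in> configs" and A: "A \<subseteq> \<gamma>" "A \<subseteq> U" "finite A" "card A = n" by auto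
  obtain f W where f: "f \<in> C0" "open W" "W \<subseteq> U" "compact (closure W)"
    "\<And>x. 0 \<le> f x" "\<And>x. f x \<le> 1" "\<And>x. x \<in> A \<Longrightarrow> f x = 1" "\<And>x. x \<notin> W \<Longrightarrow> f x = 0"
    using C0_bump[OF A(3) assms A(2)] by metis
  have pair: "pairing f \<gamma>' = sum f (\<gamma>' \<inter> W)" "finite (\<gamma>' \<inter> W)" if "\<gamma>' \<in> configs" for \<gamma>'
    using configs_finite_Int[OF that f(4)] f(8) by (auto intro!: pairing_eq_sum)
  \<comment> \<open>The pairing with \<gamma> itself is at least n, and a number of points strictly
    above n - 1 is at least n.\<close>
  let ?T = "{\<gamma> \<in> configs. pairing f \<gamma> \<in> {real n - 1 <..}}"
  have "A \<subseteq> W" using f(7,8) zero_neq_one by (metis subsetI)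
  then have "sum f A \<le> sum f (\<gamma> \<inter> W)"
    using A pair(2)[OF \<gamma>] f(5) by (intro sum_mono2) auto
  moreover have "sum f A = real n" using A(4) f(7) by simp
  ultimately have "\<gamma> \<in> ?T" using \<gamma> pair(1)[OF \<gamma>] by simp
  moreover have "openin vague_topology ?T" by (rule openin_vague_pairing[OF f(1)]) simp
  moreover have "?T \<subseteq> ?S"
  proof
    fix \<gamma>' assume g': "\<gamma>' \<in> ?T"
    then have "real n - 1 < sum f (\<gamma>' \<inter> W)" using pair(1)[of \<gamma>'] by simp
    also have "\<dots> \<le> real (card (\<gamma>' \<inter> W))"
      using sum_bounded_above[of "\<gamma>' \<inter> W" f 1] f(6) by simp
    finally have "n \<le> card (\<gamma>' \<inter> W)" by linarith
    then obtain B where "B \<subseteq> \<gamma>' \<inter> W" "card B = n" "finite B"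
      using pair(2)[of \<gamma>'] g' by (metis (no_types, lifting) mem_Collect_eq obtain_subset_with_card_n)
    with g' f(3) show "\<gamma>' \<in> ?S" by auto
  qed
  ultimately show "\<exists>T. openin vague_topology T \<and> \<gamma> \<in> T \<and> T \<subseteq> ?S" by blast
qed

text \<open>The sets where the count is at least n are vaguely open, and each level set is a
  difference of two of them. Compactness of the closure keeps all counts finite.\<close>

lemma measurable_card_open:
  assumes "open U" "compact (closure (U :: 'x set))"
  shows "(\<lambda>\<gamma>. card (\<gamma> \<inter> U)) \<in> measurable config_space (count_space UNIV)"
proof -
  have ge: "{\<gamma> \<in> configs. n \<le> card (\<gamma> \<inter> U)} \<in> sets config_space" for n
  proof -
    have "{\<gamma> \<in> configs. n \<le> card (\<gamma> \<inter> U)} = {\<gamma> \<in> configs. \<exists>A. A \<subseteq> \<gamma> \<inter> U \<and> finite A \<and> card A = n}"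
      using configs_finite_Int[OF _ assms(2)]
      by (intro Collect_cong conj_cong refl) (metis card_mono obtain_subset_with_card_n)
    then show ?thesis
      using openin_vague_card_ge[OF assms(1), of n] by (auto simp: sets_config_space)
  qed
  have "(\<lambda>\<gamma>. card (\<gamma> \<inter> U)) -` {n} \<inter> space config_space \<in> sets config_space" for n
  proof -
    have "(\<lambda>\<gamma>. card (\<gamma> \<inter> U)) -` {n} \<inter> space config_space
        = {\<gamma> \<in> configs. n \<le> card (\<gamma> \<inter> U)} - {\<gamma> \<in> configs. Suc n \<le> card (\<gamma> \<inter> U)}"
      by auto
    then show ?thesis using ge by auto
  qed
  then show ?thesis by (subst measurable_count_space_eq2_countable) auto
qed

text \<open>As \<open>rc_basis\<close> is countable, there are only countably many pairs \<open>(P, Q)\<close>, so that every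
  vaguely open set is a countable union of sets described by numbers of points.\<close>

lemma vague_neighbourhood_cell:
  fixes \<gamma>0 :: "'x set"
  assumes U: "openin vague_topology U" "\<gamma>0 \<in> U"
  shows "\<exists>P Q. finite P \<and> finite Q \<and> P \<subseteq> rc_basis \<and> Q \<subseteq> rc_basis \<and>
    (\<forall>V\<in>P. card (\<gamma>0 \<inter> V) = 1) \<and> (\<forall>V\<in>Q. card (\<gamma>0 \<inter> V) = 0) \<and>
    (\<forall>\<gamma>\<in>configs. (\<forall>V\<in>P. card (\<gamma> \<inter> V) = 1) \<longrightarrow> (\<forall>V\<in>Q. card (\<gamma> \<inter> V) = 0) \<longrightarrow> \<gamma> \<in> U)"
proof -
  \<comment> \<open>Abstracting over U makes the claim inductive along the generation of the
    topology; for an intersection the finite families are united.\<close>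
  define cell where "cell U P Q \<longleftrightarrow> finite P \<and> finite Q \<and> P \<subseteq> rc_basis \<and> Q \<subseteq> rc_basis \<and>
    (\<forall>V\<in>P. card (\<gamma>0 \<inter> V) = 1) \<and> (\<forall>V\<in>Q. card (\<gamma>0 \<inter> V) = 0) \<and>
    (\<forall>\<gamma>\<in>configs. (\<forall>V\<in>P. card (\<gamma> \<inter> V) = 1) \<longrightarrow> (\<forall>V\<in>Q. card (\<gamma> \<inter> V) = 0) \<longrightarrow> \<gamma> \<in> U)"
    for U and P Q :: "'x set set"
  have "generate_topology_on {{\<gamma> \<in> configs. pairing f \<gamma> \<in> U} | f U. f \<in> C0 \<and> open U} U"
    using U(1) unfolding vague_topology_def by (rule openin_topology_generated_by)
  then have "\<exists>P Q. cell U P Q" using U(2)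
  proof (induction U)
    case Empty
    then show ?case by simp
  next
    case (Int a b)
    then obtain P Q P' Q' where "cell a P Q" "cell b P' Q'" by blast
    then have "cell (a \<inter> b) (P \<union> P') (Q \<union> Q')" by (simp add: cell_def ball_Un)
    then show ?case by blast
  next
    case (UN K)
    then obtain k where "k \<in> K" "\<gamma>0 \<in> k" by blast
    with UN.IH obtain P Q where "cell k P Q" by blast
    then have "cell (\<Union>K) P Q" using \<open>k \<in> K\<close> by (auto simp: cell_def)
    then show ?case by blast
  next
    case (Basis s)
    then obtain f U where s: "s = {\<gamma> \<in> configs. pairing f \<gamma> \<in> U}" and f: "f \<in> C0" and U: "open U" by blast
    have \<gamma>0: "\<gamma>0 \<in> configs" "pairing f \<gamma>0 \<in> U" using Basis.prems s by auto
    obtain e where e: "e > 0" "\<And>y. dist y (pairing f \<gamma>0) < e \<Longrightarrow> y \<in> U"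
      using U \<gamma>0(2) unfolding open_dist by blast
    define C where "C = closure {x. f x \<noteq> 0}"
    have C: "compact C" "\<And>x. x \<notin> C \<Longrightarrow> f x = 0" and contf: "continuous_on UNIV f"
      using f closure_subset[of "{x. f x \<noteq> 0}"] by (auto simp: C0_def C_def)
    define A where "A = \<gamma>0 \<inter> C"
    have A: "finite A" using C(1) \<gamma>0(1) by (auto simp: A_def configs_def)
    obtain N where N: "\<And>x. x \<in> A \<Longrightarrow> open (N x) \<and> x \<in> N x"
      "\<And>x y. x \<in> A \<Longrightarrow> y \<in> A \<Longrightarrow> x \<noteq> y \<Longrightarrow> N x \<inter> N y = {}"
      using pairwise_disjoint_neighbourhoods[OF A] by metis
    \<comment> \<open>One point moves for each element of \<open>A\<close>, changing f by less than
      d; the added 1 keeps the total strictly below e and covers empty \<open>A\<close>.\<close>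
    define d where "d = e / (real (card A) + 1)"
    have d: "d > 0" using e(1) by (simp add: d_def)
    \<comment> \<open>Three demands on the set around x: sets of different points are disjoint, it
      contains no other point of \<open>\<gamma>0\<close>, and f differs from its value at x by less
      than d on it.\<close>
    have "\<exists>V\<in>rc_basis. x \<in> V \<and> V \<subseteq> N x \<inter> (- (\<gamma>0 - {x})) \<inter> {y. \<bar>f y - f x\<bar> < d}" if x: "x \<in> A" for x
    proof (rule rc_basis_ex)
      have "open {y. \<bar>f y - f x\<bar> < d}"
        by (intro open_Collect_less continuous_intros contf)
      moreover have "open (- (\<gamma>0 - {x}))"
        using configs_closed[OF configs_remove[OF \<gamma>0(1)]] by blast
      ultimately show "open (N x \<inter> (- (\<gamma>0 - {x})) \<inter> {y. \<bar>f y - f x\<bar> < d})"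
        using N x by blast
      show "x \<in> N x \<inter> (- (\<gamma>0 - {x})) \<inter> {y. \<bar>f y - f x\<bar> < d}" using N x d by auto
    qed
    then obtain V where V: "\<And>x. x \<in> A \<Longrightarrow> V x \<in> rc_basis" "\<And>x. x \<in> A \<Longrightarrow> x \<in> V x"
      "\<And>x. x \<in> A \<Longrightarrow> V x \<subseteq> N x \<inter> (- (\<gamma>0 - {x})) \<inter> {y. \<bar>f y - f x\<bar> < d}" by metis
    \<comment> \<open>The part of the support left uncovered is compact and misses
      \<open>\<gamma>0\<close>. Finitely many basis sets missing \<open>\<gamma>0\<close> cover it,
      and demanding that they contain no points excludes stray points where f could be
      non-zero.\<close>
    have compR: "compact (C - (\<Union>x\<in>A. V x))"
      using C(1) V(1) rc_basisD(1) by (intro compact_diff) auto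
    have "\<exists>W\<in>rc_basis. y \<in> W \<and> W \<subseteq> - \<gamma>0" if y: "y \<in> C - (\<Union>x\<in>A. V x)" for y
    proof (rule rc_basis_ex)
      show "open (- \<gamma>0)" using configs_closed[OF \<gamma>0(1)] by blast
      show "y \<in> - \<gamma>0" using y V(2) by (auto simp: A_def)
    qed
    then have "C - (\<Union>x\<in>A. V x) \<subseteq> \<Union>{W \<in> rc_basis. W \<subseteq> - \<gamma>0}" by blast
    then obtain Q where Q: "Q \<subseteq> {W \<in> rc_basis. W \<subseteq> - \<gamma>0}" "finite Q" "C - (\<Union>x\<in>A. V x) \<subseteq> \<Union>Q"
      using compactE[OF compR] rc_basisD(1) by (metis (no_types, lifting) mem_Collect_eq)
    have "cell s (V ` A) Q"
      unfolding cell_def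
    proof (intro conjI ballI impI)
      fix W assume "W \<in> V ` A"
      then obtain x where x: "x \<in> A" "W = V x" by blast
      then have "\<gamma>0 \<inter> W = {x}" using V(2,3)[OF x(1)] by (auto simp: A_def)
      then show "card (\<gamma>0 \<inter> W) = 1" by simp
    next
      fix W assume "W \<in> Q"
      then have "\<gamma>0 \<inter> W = {}" using Q(1) by auto
      then show "card (\<gamma>0 \<inter> W) = 0" by simp
    next
      fix \<gamma> assume \<gamma>: "\<gamma> \<in> configs" and P1: "\<forall>W\<in>V ` A. card (\<gamma> \<inter> W) = 1"
        and Q0: "\<forall>W\<in>Q. card (\<gamma> \<inter> W) = 0"
      have "\<forall>x\<in>A. \<exists>z. \<gamma> \<inter> V x = {z}" using P1 by (auto simp: card_1_singleton_iff)
      then obtain z where z: "\<And>x. x \<in> A \<Longrightarrow> \<gamma> \<inter> V x = {z x}" by metis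
      have zV: "z x \<in> V x" "z x \<in> \<gamma>" if "x \<in> A" for x using z[OF that] by auto
      have zN: "z x \<in> N x" "\<bar>f (z x) - f x\<bar> < d" if "x \<in> A" for x
        using zV[OF that] V(3)[OF that] by auto
      have inj: "inj_on z A"
      proof (rule inj_onI, rule ccontr)
        fix x y assume "x \<in> A" "y \<in> A" "z x = z y" "x \<noteq> y"
        then show False using N(2)[of x y] zN(1)[of x] zN(1)[of y] by auto
      qed
      \<comment> \<open>\<open>card\<close> is also 0 on infinite sets, so emptiness is concluded
        only after finiteness.\<close>
      have Q_disj: "\<gamma> \<inter> W = {}" if "W \<in> Q" for W
      proof -
        have "finite (\<gamma> \<inter> W)" using that Q(1) rc_basisD(2) \<gamma> by (intro configs_finite_Int) auto
        moreover have "card (\<gamma> \<inter> W) = 0" using Q0 that by (rule bspec)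
        ultimately show ?thesis by (simp only: card_0_eq)
      qed
      have sub: "y \<in> z ` A" if y: "y \<in> \<gamma>" "y \<in> C" for y
      proof -
        have "y \<notin> \<Union>Q" using Q_disj y(1) by auto
        then have "y \<notin> C - (\<Union>x\<in>A. V x)" using Q(3) by (meson subsetD)
        then obtain x where "x \<in> A" "y \<in> V x" using y(2) by auto
        then have "y = z x" using z[of x] y(1) by auto
        then show ?thesis using \<open>x \<in> A\<close> by simp
      qed
      have "pairing f \<gamma> = sum f (z ` A)"
        using A zV sub C(2) by (intro pairing_eq_sum) auto
      also have "\<dots> = (\<Sum>x\<in>A. f (z x))" using inj by (simp add: sum.reindex)
      finally have "pairing f \<gamma> - pairing f \<gamma>0 = (\<Sum>x\<in>A. f (z x) - f x)"
        using pairing_eq_sum[of A \<gamma>0 f] A C(2) by (auto simp: A_def sum_subtractf)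
      then have "\<bar>pairing f \<gamma> - pairing f \<gamma>0\<bar> \<le> (\<Sum>x\<in>A. \<bar>f (z x) - f x\<bar>)" by simp
      also have "\<dots> \<le> real (card A) * d"
        using zN(2) by (intro sum_bounded_above less_imp_le) auto
      also have "\<dots> < e" using e(1) by (simp add: d_def field_simps)
      finally have "pairing f \<gamma> \<in> U" by (intro e(2)) (simp add: dist_real_def)
      then show "\<gamma> \<in> s" using \<gamma> s by simp
    qed (use A Q V in auto)
    then show ?case by blast
  qed
  then show ?thesis by (simp only: cell_def)
qed

text \<open>The cells inside U are indexed by pairs of finite subsets of a countable basis, and the
  preimage of each is a finite conjunction of conditions on counts. By this criterion insertion and
  removal of a point are shown to be measurable.\<close>

lemma measurable_configI:
  fixes T :: "'b \<Rightarrow> 'x set"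
  assumes T: "\<And>w. w \<in> space M \<Longrightarrow> T w \<in> configs"
    and card: "\<And>U. open U \<Longrightarrow> compact (closure U) \<Longrightarrow>
      (\<lambda>w. card (T w \<inter> U)) \<in> measurable M (count_space UNIV)"
  shows "T \<in> measurable M config_space"
  unfolding config_space_def
proof (rule measurable_measure_of)
  show "{U. openin vague_topology U} \<subseteq> Pow configs" by (auto dest: openin_vague_subset)
  show "T \<in> space M \<rightarrow> configs" using T by auto
  fix U :: "'x set set" assume "U \<in> {U. openin vague_topology U}"
  then have U: "openin vague_topology U" by simp
  define cell where "cell = (\<lambda>(P, Q). {\<gamma> \<in> configs. (\<forall>V\<in>P. card (\<gamma> \<inter> V) = 1) \<and> (\<forall>V\<in>Q. card (\<gamma> \<inter> (V :: 'x set)) = 0)})"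
  define I :: "('x set set \<times> 'x set set) set"
    where "I = {p \<in> {P. finite P \<and> P \<subseteq> rc_basis} \<times> {Q. finite Q \<and> Q \<subseteq> rc_basis}. cell p \<subseteq> U}"
  have cnt: "countable I"
    unfolding I_def using countable_Collect_finite_subset[OF countable_rc_basis]
    by (intro countable_Collect countable_SIGMA) (simp_all only: conj_commute)
  have "U = (\<Union>p\<in>I. cell p)"
  proof (intro equalityI subsetI)
    fix \<gamma> assume g: "\<gamma> \<in> U"
    from vague_neighbourhood_cell[OF U g] obtain P Q where PQ: "finite P" "finite Q" "P \<subseteq> rc_basis" "Q \<subseteq> rc_basis"
      "\<forall>V\<in>P. card (\<gamma> \<inter> V) = 1" "\<forall>V\<in>Q. card (\<gamma> \<inter> V) = 0"
      "\<forall>\<gamma>\<in>configs. (\<forall>V\<in>P. card (\<gamma> \<inter> V) = 1) \<longrightarrow> (\<forall>V\<in>Q. card (\<gamma> \<inter> V) = 0) \<longrightarrow> \<gamma> \<in> U"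
      by blast
    have "(P, Q) \<in> I" "\<gamma> \<in> cell (P, Q)"
      using PQ g openin_vague_subset[OF U] by (auto simp: I_def cell_def)
    then show "\<gamma> \<in> (\<Union>p\<in>I. cell p)" by blast
  qed (auto simp: I_def)
  then have "T -` U \<inter> space M = (\<Union>p\<in>I. T -` cell p \<inter> space M)" by auto
  moreover have "T -` cell p \<inter> space M \<in> sets M" if "p \<in> I" for p
  proof -
    obtain P Q where p: "p = (P, Q)" "finite P" "finite Q" "P \<subseteq> rc_basis" "Q \<subseteq> rc_basis"
      using \<open>p \<in> I\<close> by (cases p) (auto simp: I_def)
    have meas: "(\<lambda>w. card (T w \<inter> V)) \<in> measurable M (count_space UNIV)" if "V \<in> P \<union> Q" for V
      using that p rc_basisD by (intro card) auto
    have "T -` cell p \<inter> space M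
      = {w \<in> space M. (\<forall>V\<in>P. card (T w \<inter> V) = 1) \<and> (\<forall>V\<in>Q. card (T w \<inter> V) = 0)}"
      using T by (auto simp: p(1) cell_def)
    also have "\<dots> \<in> sets M"
    proof -
      have "Measurable.pred M (\<lambda>w. card (T w \<inter> V) = k)" if "V \<in> P \<union> Q" for V k
        using meas[OF that] by measurable
      then show ?thesis
        unfolding pred_def[symmetric] using p(2,3)
        by (intro pred_intros_logic pred_intros_finite) auto
    qed
    finally show ?thesis .
  qed
  ultimately show "T -` U \<inter> space M \<in> sets M"
    using cnt sets.countable_UN''[of I "\<lambda>p. T -` cell p \<inter> space M" M] by simp
qed

end

section \<open>Integration along configurations and cylinder functions\<close>

lemma nn_integral_count_space_indicator_finite:
  assumes "finite (\<gamma> \<inter> A)"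
  shows "(\<integral>\<^sup>+ x. indicator A x \<partial>count_space \<gamma>) = of_nat (card (\<gamma> \<inter> A))"
  using assms by (subst nn_integral_indicator') (auto simp: Int_commute)

section \<open>Measurability of sums over points and of insertion and removal\<close>

context
  assumes lc: "locally compact (UNIV :: 'x::{second_countable_topology, t2_space} set)"
begin

text \<open>The counting measure varies with \<gamma>, so a pi-lambda argument is run twice: from
  open sets to Borel sets in the point variable, then from rectangles to all product sets.
  Truncation to \<open>exhaustion n\<close> keeps the sums finite, which makes complementation a
  legitimate subtraction.\<close>

lemma measurable_nn_integral_config_indicator:
  assumes "Q \<in> sets (borel \<Otimes>\<^sub>M (config_space :: 'x set measure))"
  shows "(\<lambda>\<gamma>. \<integral>\<^sup>+ x. indicator Q (x, \<gamma>) * indicator (exhaustion n) x \<partial>count_space \<gamma>)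
    \<in> borel_measurable config_space"
proof -
  define I :: "('x \<times> 'x set) set \<Rightarrow> 'x set \<Rightarrow> ennreal"
    where "I Q \<gamma> = (\<integral>\<^sup>+ x. indicator Q (x, \<gamma>) * indicator (exhaustion n) x \<partial>count_space \<gamma>)" for Q \<gamma>
  let ?c = "\<lambda>\<gamma>. of_nat (card (\<gamma> \<inter> (exhaustion n :: 'x set))) :: ennreal"
  have c: "(\<integral>\<^sup>+ x. indicator (exhaustion n) x \<partial>count_space \<gamma>) = ?c \<gamma>" if "\<gamma> \<in> configs" for \<gamma>
    using that exhaustion(2)[OF lc] configs_finite_Int
    by (intro nn_integral_count_space_indicator_finite) blast
  have fin: "I Q \<gamma> \<noteq> \<infinity>" if "\<gamma> \<in> configs" for Q \<gamma>
  proof -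
    have "I Q \<gamma> \<le> ?c \<gamma>"
      unfolding c[OF that, symmetric] I_def by (intro nn_integral_mono) (auto simp: indicator_def)
    then show ?thesis by (metis ennreal_of_nat_neq_top infinity_ennreal_def neq_top_trans)
  qed
  have mc: "?c \<in> borel_measurable config_space"
    using measurable_card_open[OF lc exhaustion(1,2)[OF lc]] by measurable
  have compl: "I (UNIV \<times> configs - Q) \<in> borel_measurable config_space"
    if Q: "I Q \<in> borel_measurable config_space" for Q
  proof -
    have "I (UNIV \<times> configs - Q) \<gamma> = ?c \<gamma> - I Q \<gamma>" if g: "\<gamma> \<in> configs" for \<gamma>
    proof -
      have "I (UNIV \<times> configs - Q) \<gamma>
        = (\<integral>\<^sup>+ x. indicator (exhaustion n) x - indicator Q (x, \<gamma>) * indicator (exhaustion n) x \<partial>count_space \<gamma>)"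
        unfolding I_def using g by (intro nn_integral_cong) (auto simp: indicator_def)
      also have "\<dots> = ?c \<gamma> - I Q \<gamma>"
        unfolding c[OF g, symmetric] I_def using fin[OF g, of Q]
        by (intro nn_integral_diff) (auto simp: I_def indicator_def)
      finally show ?thesis .
    qed
    then show ?thesis using mc Q by (subst measurable_cong[where g = "\<lambda>\<gamma>. ?c \<gamma> - I Q \<gamma>"]) auto
  qed
  have union: "I (\<Union>i. A i) \<in> borel_measurable config_space"
    if A: "disjoint_family A" "\<And>i. I (A i) \<in> borel_measurable config_space" for A :: "nat \<Rightarrow> _"
  proof -
    have "I (\<Union>i. A i) = (\<lambda>\<gamma>. \<Sum>i. I (A i) \<gamma>)"
      unfolding I_def
      by (intro ext, subst nn_integral_suminf[symmetric])
        (auto simp: suminf_indicator[OF A(1), symmetric] ennreal_suminf_multc)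
    then show ?thesis using A(2) by simp
  qed
  have empty: "I {} \<in> borel_measurable config_space"
    unfolding I_def by simp
  have borel: "I (A \<times> configs) \<in> borel_measurable config_space" if "A \<in> sets borel" for A
  proof -
    have "Int_stable {S :: 'x set. open S}" "{S :: 'x set. open S} \<subseteq> Pow UNIV"
      "A \<in> sigma_sets UNIV {S. open S}"
      using that by (auto simp: Int_stable_def borel_def)
    then show ?thesis
    proof (induction rule: sigma_sets_induct_disjoint)
      fix S :: "'x set" assume "S \<in> {S. open S}"
      then have S: "open S" by simp
      have cS: "compact (closure (S \<inter> exhaustion n))"
        using exhaustion(2)[OF lc, of n]
        by (metis closed_closure closure_mono compact_Int_closed inf.absorb2 inf_le2)
      have "I (S \<times> configs) \<gamma> = of_nat (card (\<gamma> \<inter> (S \<inter> exhaustion n)))" if "\<gamma> \<in> configs" for \<gamma>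
        using nn_integral_count_space_indicator_finite[OF configs_finite_Int[OF that cS]] that
        unfolding I_def by (subst nn_integral_count_space_indicator_finite[symmetric])
          (auto intro!: nn_integral_cong configs_finite_Int[OF that cS] simp: indicator_def)
      moreover have "(\<lambda>\<gamma>. of_nat (card (\<gamma> \<inter> (S \<inter> exhaustion n))) :: ennreal) \<in> borel_measurable config_space"
        using measurable_card_open[OF lc open_Int[OF S exhaustion(1)[OF lc]] cS] by measurable
      ultimately show "I (S \<times> configs) \<in> borel_measurable config_space"
        by (subst measurable_cong) auto
    next
      show "I ({} \<times> configs) \<in> borel_measurable config_space" using empty by simp
    next
      fix S assume "I (S \<times> configs) \<in> borel_measurable config_space"
      from compl[OF this] show "I ((UNIV - S) \<times> configs) \<in> borel_measurable config_space"
        by (simp add: Sigma_Diff_distrib1)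
    next
      fix S :: "nat \<Rightarrow> 'x set" assume S: "disjoint_family S" "\<And>i. I (S i \<times> configs) \<in> borel_measurable config_space"
      then show "I ((\<Union>i. S i) \<times> configs) \<in> borel_measurable config_space"
        using union[of "\<lambda>i. S i \<times> configs"] by (simp add: UN_Times_distrib disjoint_family_on_def Times_Int_Times
          Sigma_Union UN_extend_simps flip: Int_Un_distrib)
    qed
  qed
  have "Int_stable {a \<times> b | a b. a \<in> sets (borel :: 'x measure) \<and> b \<in> sets (config_space :: 'x set measure)}"
    by (rule Int_stable_pair_measure_generator)
  moreover have "{a \<times> b | a b. a \<in> sets (borel :: 'x measure) \<and> b \<in> sets (config_space :: 'x set measure)} \<subseteq> Pow (UNIV \<times> configs)"
    using sets.sets_into_space[of _ "config_space :: 'x set measure"] by auto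
  moreover have "Q \<in> sigma_sets (UNIV \<times> configs) {a \<times> b | a b. a \<in> sets (borel :: 'x measure) \<and> b \<in> sets (config_space :: 'x set measure)}"
    using assms by (simp add: sets_pair_measure)
  ultimately have "I Q \<in> borel_measurable config_space"
  proof (induction rule: sigma_sets_induct_disjoint)
    fix R assume "R \<in> {a \<times> b | a b. a \<in> sets (borel :: 'x measure) \<and> b \<in> sets (config_space :: 'x set measure)}"
    then obtain A B where R: "R = A \<times> B" "A \<in> sets borel" "B \<in> sets (config_space :: 'x set measure)" by blast
    \<comment> \<open>On a rectangle the condition on the configuration factors out of the
      sum.\<close>
    have "I R \<gamma> = indicator B \<gamma> * I (A \<times> configs) \<gamma>" if "\<gamma> \<in> configs" for \<gamma>
      unfolding I_def using that
      by (subst nn_integral_cmult[symmetric]) (auto intro!: nn_integral_cong simp: R(1) indicator_def)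
    then show "I R \<in> borel_measurable config_space"
      using borel[OF R(2)] R(3)
      by (subst measurable_cong[where g = "\<lambda>\<gamma>. indicator B \<gamma> * I (A \<times> configs) \<gamma>"]) auto
  qed (use empty compl union in auto)
  then show ?thesis by (simp add: I_def[abs_def])
qed

text \<open>Monotone approximation of f; for indicators the truncation is removed by letting the
  exhaustion increase to the whole space.\<close>

lemma measurable_nn_integral_config:
  assumes "case_prod f \<in> borel_measurable (borel \<Otimes>\<^sub>M (config_space :: 'x set measure))"
  shows "(\<lambda>\<gamma>. \<integral>\<^sup>+ x. f x \<gamma> \<partial>count_space \<gamma>) \<in> borel_measurable config_space"
proof -
  have "(\<lambda>\<gamma>. \<integral>\<^sup>+ x. h (x, \<gamma>) \<partial>count_space \<gamma>) \<in> borel_measurable config_space"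
    if "h \<in> borel_measurable (borel \<Otimes>\<^sub>M (config_space :: 'x set measure))" for h :: "_ \<Rightarrow> ennreal"
    using that
  proof (induction h rule: borel_measurable_induct)
    case (cong h g)
    have "(\<integral>\<^sup>+ x. h (x, \<gamma>) \<partial>count_space \<gamma>) = (\<integral>\<^sup>+ x. g (x, \<gamma>) \<partial>count_space \<gamma>)" if "\<gamma> \<in> configs" for \<gamma>
      using that cong(3) by (intro nn_integral_cong) (auto simp: space_pair_measure)
    then show ?case using cong(4) by (subst measurable_cong[where g = "\<lambda>\<gamma>. \<integral>\<^sup>+ x. g (x, \<gamma>) \<partial>count_space \<gamma>"]) auto
  next
    case (set Q)
    have "(\<integral>\<^sup>+ x. indicator Q (x, \<gamma>) \<partial>count_space \<gamma>)
      = (SUP n. \<integral>\<^sup>+ x. indicator Q (x, \<gamma>) * indicator (exhaustion n) x \<partial>count_space \<gamma>)" for \<gamma> :: "'x set"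
    proof (subst nn_integral_monotone_convergence_SUP[symmetric])
      show "incseq (\<lambda>n x. indicator Q (x, \<gamma>) * indicator (exhaustion n) x :: ennreal)"
        using exhaustion(3)[OF lc] by (auto simp: incseq_def le_fun_def indicator_def subset_iff)
      have "(SUP n. indicator (exhaustion n) x :: ennreal) = 1" for x :: 'x
      proof -
        obtain n where "x \<in> exhaustion n" using exhaustion(4)[OF lc] by blast
        then show ?thesis
          by (intro antisym SUP_least SUP_upper2[of n]) (auto simp: indicator_def)
      qed
      then show "(\<integral>\<^sup>+ x. indicator Q (x, \<gamma>) \<partial>count_space \<gamma>)
        = (\<integral>\<^sup>+ x. (SUP n. indicator Q (x, \<gamma>) * indicator (exhaustion n) x) \<partial>count_space \<gamma>)"
        by (simp add: SUP_mult_left_ennreal[symmetric])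
    qed simp
    then show ?case using measurable_nn_integral_config_indicator[OF set] by simp
  next
    case (mult h c)
    then show ?case by (simp add: nn_integral_cmult)
  next
    case (add h g)
    then show ?case by (simp add: nn_integral_add)
  next
    case (seq U)
    have "(\<integral>\<^sup>+ x. (SUP i. U i) (x, \<gamma>) \<partial>count_space \<gamma>) = (SUP i. \<integral>\<^sup>+ x. U i (x, \<gamma>) \<partial>count_space \<gamma>)"
      for \<gamma> :: "'x set"
      unfolding SUP_apply using seq(3)
      by (intro nn_integral_monotone_convergence_SUP) (auto simp: incseq_def le_fun_def)
    then show ?case using seq by simp
  qed
  from this[OF assms] show ?thesis by simp
qed

text \<open>Configurations are closed, so x lies outside \<gamma> exactly when some basis set around
  x contains no point of \<gamma>: a countable union of conditions on counts.\<close>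

lemma measurable_mem_config:
  "Measurable.pred (borel \<Otimes>\<^sub>M (config_space :: 'x set measure)) (\<lambda>p. fst p \<in> snd p)"
proof -
  let ?M = "borel \<Otimes>\<^sub>M (config_space :: 'x set measure)"
  have eq: "fst p \<notin> snd p \<longleftrightarrow> (\<exists>U\<in>rc_basis. fst p \<in> U \<and> card (snd p \<inter> U) = 0)"
    if "p \<in> space ?M" for p
  proof
    have g: "snd p \<in> configs" using that by (auto simp: space_pair_measure)
    assume "fst p \<notin> snd p"
    then obtain U where U: "U \<in> rc_basis" "fst p \<in> U" "U \<subseteq> - snd p"
      using rc_basis_ex[OF lc, of "- snd p" "fst p"] configs_closed[OF lc g] by auto
    then have "snd p \<inter> U = {}" by blast
    then show "\<exists>U\<in>rc_basis. fst p \<in> U \<and> card (snd p \<inter> U) = 0" using U by auto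
  next
    have g: "snd p \<in> configs" using that by (auto simp: space_pair_measure)
    assume "\<exists>U\<in>rc_basis. fst p \<in> U \<and> card (snd p \<inter> U) = 0"
    then obtain U where U: "U \<in> rc_basis" "fst p \<in> U" "card (snd p \<inter> U) = 0" by blast
    then have "snd p \<inter> U = {}"
      using configs_finite_Int[OF g rc_basisD(2)[OF lc U(1)]] by simp
    then show "fst p \<notin> snd p" using U by auto
  qed
  have [measurable]: "(\<lambda>\<gamma>. card (\<gamma> \<inter> U)) \<in> measurable config_space (count_space UNIV)"
    "U \<in> sets borel" if "U \<in> rc_basis" for U :: "'x set"
    using that rc_basisD[OF lc] measurable_card_open[OF lc] by auto
  have "Measurable.pred ?M (\<lambda>p. \<exists>U\<in>rc_basis. fst p \<in> U \<and> card (snd p \<inter> U) = 0)"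
    using countable_rc_basis[OF lc] by measurable
  then have "Measurable.pred ?M (\<lambda>p. fst p \<notin> snd p)"
    by (subst measurable_cong[OF eq]) auto
  then have "Measurable.pred ?M (\<lambda>p. \<not> fst p \<notin> snd p)" by measurable
  then show ?thesis by simp
qed

text \<open>The count in U grows by one exactly if the point lies in U and is not already present;
  joint measurability of membership decides the second condition.\<close>

lemma measurable_insert_config:
  "(\<lambda>p. insert (fst p) (snd p)) \<in> measurable (borel \<Otimes>\<^sub>M (config_space :: 'x set measure)) config_space"
proof (rule measurable_configI[OF lc])
  let ?M = "borel \<Otimes>\<^sub>M (config_space :: 'x set measure)"
  show "insert (fst p) (snd p) \<in> configs" if "p \<in> space ?M" for p
    using that by (auto simp: space_pair_measure configs_insert)
  fix U :: "'x set" assume U: "open U" "compact (closure U)"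
  note [measurable] = measurable_card_open[OF lc U] measurable_mem_config borel_open[OF U(1)]
  have "card (insert (fst p) (snd p) \<inter> U)
    = card (snd p \<inter> U) + (if fst p \<in> U \<and> \<not> fst p \<in> snd p then 1 else 0)" if "p \<in> space ?M" for p
  proof -
    have "finite (snd p \<inter> U)" using that U by (auto simp: space_pair_measure intro!: configs_finite_Int)
    then show ?thesis by (auto simp: Int_insert_left insert_absorb)
  qed
  moreover have "(\<lambda>p. card (snd p \<inter> U) + (if fst p \<in> U \<and> \<not> fst p \<in> snd p then 1 else 0))
    \<in> measurable ?M (count_space UNIV)" by measurable
  ultimately show "(\<lambda>p. card (insert (fst p) (snd p) \<inter> U)) \<in> measurable ?M (count_space UNIV)"
    by (subst measurable_cong) auto
qed

lemma measurable_remove_config: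
  "(\<lambda>p. snd p - {fst p}) \<in> measurable (borel \<Otimes>\<^sub>M (config_space :: 'x set measure)) config_space"
proof (rule measurable_configI[OF lc])
  let ?M = "borel \<Otimes>\<^sub>M (config_space :: 'x set measure)"
  show "snd p - {fst p} \<in> configs" if "p \<in> space ?M" for p
    using that by (auto simp: space_pair_measure configs_remove)
  fix U :: "'x set" assume U: "open U" "compact (closure U)"
  note [measurable] = measurable_card_open[OF lc U] measurable_mem_config borel_open[OF U(1)]
  have "card ((snd p - {fst p}) \<inter> U)
    = card (snd p \<inter> U) - (if fst p \<in> U \<and> fst p \<in> snd p then 1 else 0)" if "p \<in> space ?M" for p
  proof -
    have "finite (snd p \<inter> U)" using that U by (auto simp: space_pair_measure intro!: configs_finite_Int)
    moreover have "(snd p - {fst p}) \<inter> U = snd p \<inter> U - {fst p}" by blast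
    ultimately show ?thesis by (auto simp: card_Diff_singleton_if)
  qed
  moreover have "(\<lambda>p. card (snd p \<inter> U) - (if fst p \<in> U \<and> fst p \<in> snd p then 1 else 0))
    \<in> measurable ?M (count_space UNIV)" by measurable
  ultimately show "(\<lambda>p. card ((snd p - {fst p}) \<inter> U)) \<in> measurable ?M (count_space UNIV)"
    by (subst measurable_cong) auto
qed

end

section \<open>Cylinder functions: measurability, boundedness, locality, linear structure\<close>

lemma continuous_map_vague_pairing:
  "f \<in> C0 \<Longrightarrow> continuous_map vague_topology euclideanreal (pairing f)"
  using openin_vague_pairing by (auto simp: continuous_map_def topspace_vague_topology)

lemma cylinder_functionsE:
  assumes "F \<in> cylinder_functions"
  obtains N :: nat and \<phi> g where "\<And>i. i < N \<Longrightarrow> \<phi> i \<in> C0"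
    "continuous_map (product_topology (\<lambda>_. euclideanreal) {..<N}) euclideanreal g"
    "bounded (g ` extensional {..<N})"
    "\<And>\<gamma>. \<gamma> \<in> configs \<Longrightarrow> F \<gamma> = g (\<lambda>i\<in>{..<N}. pairing (\<phi> i) \<gamma>)"
  using assms unfolding cylinder_functions_def by blast

text \<open>Pairings with test functions are vaguely continuous by construction, so F agrees on
  configurations with a vaguely continuous function.\<close>

lemma cylinder_measurable:
  assumes "F \<in> cylinder_functions"
  shows "F \<in> borel_measurable config_space"
proof -
  obtain N :: nat and \<phi> g where F: "\<And>i. i < N \<Longrightarrow> \<phi> i \<in> C0"
    "continuous_map (product_topology (\<lambda>_. euclideanreal) {..<N}) euclideanreal g"
    "bounded (g ` extensional {..<N})"
    "\<And>\<gamma>. \<gamma> \<in> configs \<Longrightarrow> F \<gamma> = g (\<lambda>i\<in>{..<N}. pairing (\<phi> i) \<gamma>)"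
    by (rule cylinder_functionsE[OF assms], rule that)
  have "continuous_map vague_topology (product_topology (\<lambda>_. euclideanreal) {..<N})
      (\<lambda>\<gamma>. \<lambda>i\<in>{..<N}. pairing (\<phi> i) \<gamma>)"
    using F(1) by (auto simp: continuous_map_componentwise continuous_map_vague_pairing[unfolded eta_contract_eq])
  from continuous_map_compose[OF this F(2)]
  have cont: "continuous_map vague_topology euclideanreal (\<lambda>\<gamma>. g (\<lambda>i\<in>{..<N}. pairing (\<phi> i) \<gamma>))"
    by (simp add: o_def)
  show ?thesis
  proof (rule borel_measurableI)
    fix S :: "real set" assume "open S"
    then have "openin vague_topology {\<gamma> \<in> configs. g (\<lambda>i\<in>{..<N}. pairing (\<phi> i) \<gamma>) \<in> S}"
      using cont by (auto simp: continuous_map_def topspace_vague_topology)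
    moreover have "F -` S \<inter> space config_space = {\<gamma> \<in> configs. g (\<lambda>i\<in>{..<N}. pairing (\<phi> i) \<gamma>) \<in> S}"
      using F(4) by auto
    ultimately show "F -` S \<inter> space config_space \<in> sets config_space"
      by (auto simp: sets_config_space)
  qed
qed

lemma cylinder_bounded:
  assumes "F \<in> cylinder_functions"
  obtains B where "0 \<le> B" "\<And>\<gamma>. \<gamma> \<in> configs \<Longrightarrow> \<bar>F \<gamma>\<bar> \<le> B"
proof -
  obtain N :: nat and \<phi> g where F: "\<And>i. i < N \<Longrightarrow> \<phi> i \<in> C0"
    "continuous_map (product_topology (\<lambda>_. euclideanreal) {..<N}) euclideanreal g"
    "bounded (g ` extensional {..<N})"
    "\<And>\<gamma>. \<gamma> \<in> configs \<Longrightarrow> F \<gamma> = g (\<lambda>i\<in>{..<N}. pairing (\<phi> i) \<gamma>)"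
    by (rule cylinder_functionsE[OF assms], rule that)
  obtain B where B: "B > 0" "\<And>y. y \<in> g ` extensional {..<N} \<Longrightarrow> norm y \<le> B"
    using F(3) by (auto simp: bounded_pos)
  show thesis using B F(4) by (intro that[of B]) auto
qed

text \<open>L is the union of the supports of the test functions. Locality confines every transition
  that changes F to a relatively compact set, where the integrability assumptions apply.\<close>

lemma cylinder_local:
  assumes "F \<in> (cylinder_functions :: ('x::t2_space set \<Rightarrow> real) set)"
  obtains L where "L \<in> rel_compact_borel"
    "\<And>\<gamma> \<gamma>'. \<gamma> \<in> configs \<Longrightarrow> \<gamma>' \<in> configs \<Longrightarrow> \<gamma> \<inter> L = \<gamma>' \<inter> L \<Longrightarrow> F \<gamma> = F \<gamma>'"
proof -
  obtain N :: nat and \<phi> g where F: "\<And>i. i < N \<Longrightarrow> \<phi> i \<in> C0"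
    "continuous_map (product_topology (\<lambda>_. euclideanreal) {..<N}) euclideanreal g"
    "bounded (g ` extensional {..<N})"
    "\<And>\<gamma>. \<gamma> \<in> configs \<Longrightarrow> F \<gamma> = g (\<lambda>i\<in>{..<N}. pairing (\<phi> i) \<gamma>)"
    by (rule cylinder_functionsE[OF assms], rule that)
  define L where "L = (\<Union>i<N. closure {x. \<phi> i x \<noteq> 0})"
  have L: "compact L" unfolding L_def using F(1) by (intro compact_UN) (auto simp: C0_def)
  show thesis
  proof (rule that)
    show "L \<in> rel_compact_borel"
      using L compact_imp_closed[OF L] by (auto simp: rel_compact_borel_def borel_closed)
    fix \<gamma> \<gamma>' :: "'x set" assume g: "\<gamma> \<in> configs" "\<gamma>' \<in> configs" "\<gamma> \<inter> L = \<gamma>' \<inter> L"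
    have "pairing (\<phi> i) \<gamma>0 = sum (\<phi> i) (\<gamma>0 \<inter> L)" if "i < N" "\<gamma>0 \<in> configs" for i \<gamma>0
    proof (rule pairing_eq_sum)
      show "finite (\<gamma>0 \<inter> L)" using that L by (auto simp: configs_def)
      show "\<phi> i x = 0" if "x \<in> \<gamma>0" "x \<notin> \<gamma>0 \<inter> L" for x
        using that \<open>i < N\<close> closure_subset[of "{x. \<phi> i x \<noteq> 0}"] by (auto simp: L_def)
    qed auto
    then have "(\<lambda>i\<in>{..<N}. pairing (\<phi> i) \<gamma>) = (\<lambda>i\<in>{..<N}. pairing (\<phi> i) \<gamma>')"
      using g by (intro restrict_ext) auto
    then show "F \<gamma> = F \<gamma>'" using F(4) g by simp
  qed
qed

lemma cylinder_zero: "(\<lambda>_. 0) \<in> cylinder_functions"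
  unfolding cylinder_functions_def
  by (auto intro!: exI[of _ "0::nat"] exI[of _ "\<lambda>_. 0"])

lemma cylinder_scale:
  assumes "F \<in> cylinder_functions"
  shows "(\<lambda>\<gamma>. a * F \<gamma>) \<in> cylinder_functions"
proof -
  obtain N :: nat and \<phi> g where F: "\<And>i. i < N \<Longrightarrow> \<phi> i \<in> C0"
    "continuous_map (product_topology (\<lambda>_. euclideanreal) {..<N}) euclideanreal g"
    "bounded (g ` extensional {..<N})"
    "\<And>\<gamma>. \<gamma> \<in> configs \<Longrightarrow> F \<gamma> = g (\<lambda>i\<in>{..<N}. pairing (\<phi> i) \<gamma>)"
    by (rule cylinder_functionsE[OF assms], rule that)
  have "bounded ((\<lambda>z. a * g z) ` extensional {..<N})"
    using bounded_scaling[OF F(3), of a] by (simp add: image_image)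
  with F show ?thesis
    unfolding cylinder_functions_def
    by (auto intro!: exI[of _ N] exI[of _ \<phi>] exI[of _ "\<lambda>z. a * g z"] continuous_map_real_mult_left)
qed

text \<open>The two lists of test functions are concatenated; the sum depends on the first N
  coordinates through g and on the next N' through g'.\<close>

lemma cylinder_add:
  assumes "F \<in> cylinder_functions" "G \<in> cylinder_functions"
  shows "(\<lambda>\<gamma>. F \<gamma> + G \<gamma>) \<in> cylinder_functions"
proof -
  obtain N :: nat and \<phi> g where F: "\<And>i. i < N \<Longrightarrow> \<phi> i \<in> C0"
    "continuous_map (product_topology (\<lambda>_. euclideanreal) {..<N}) euclideanreal g"
    "bounded (g ` extensional {..<N})"
    "\<And>\<gamma>. \<gamma> \<in> configs \<Longrightarrow> F \<gamma> = g (\<lambda>i\<in>{..<N}. pairing (\<phi> i) \<gamma>)"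
    by (rule cylinder_functionsE[OF assms(1)], rule that)
  obtain N' :: nat and \<phi>' g' where G: "\<And>i. i < N' \<Longrightarrow> \<phi>' i \<in> C0"
    "continuous_map (product_topology (\<lambda>_. euclideanreal) {..<N'}) euclideanreal g'"
    "bounded (g' ` extensional {..<N'})"
    "\<And>\<gamma>. \<gamma> \<in> configs \<Longrightarrow> G \<gamma> = g' (\<lambda>i\<in>{..<N'}. pairing (\<phi>' i) \<gamma>)"
    by (rule cylinder_functionsE[OF assms(2)], rule that)
  define p where "p z = restrict z {..<N}" for z :: "nat \<Rightarrow> real"
  define p' where "p' z = (\<lambda>i\<in>{..<N'}. z (N + i))" for z :: "nat \<Rightarrow> real"
  define \<psi> where "\<psi> i = (if i < N then \<phi> i else \<phi>' (i - N))" for i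
  define h where "h z = g (p z) + g' (p' z)" for z
  let ?T = "product_topology (\<lambda>_. euclideanreal) {..<N + N'}"
  have p: "continuous_map ?T (product_topology (\<lambda>_. euclideanreal) {..<N}) p"
    by (auto simp: continuous_map_componentwise p_def intro!: continuous_map_product_projection)
  have p': "continuous_map ?T (product_topology (\<lambda>_. euclideanreal) {..<N'}) p'"
    by (auto simp: continuous_map_componentwise p'_def intro!: continuous_map_product_projection)
  have cont: "continuous_map ?T euclideanreal h"
    using continuous_map_add[OF continuous_map_compose[OF p F(2)] continuous_map_compose[OF p' G(2)]]
    unfolding h_def o_def .
  obtain B B' where B: "\<And>z. z \<in> extensional {..<N} \<Longrightarrow> norm (g z) \<le> B"
    "\<And>z. z \<in> extensional {..<N'} \<Longrightarrow> norm (g' z) \<le> B'"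
    using F(3) G(3) by (auto simp: bounded_iff)
  have bnd: "bounded (h ` extensional {..<N + N'})"
    unfolding bounded_iff
  proof (intro exI ballI)
    fix y assume "y \<in> h ` extensional {..<N + N'}"
    then obtain z where "y = g (p z) + g' (p' z)" by (auto simp: h_def)
    then show "norm y \<le> B + B'"
      using norm_triangle_ineq[of "g (p z)" "g' (p' z)"] B(1)[of "p z"] B(2)[of "p' z"]
      by (simp add: p_def p'_def)
  qed
  have eq: "F \<gamma> + G \<gamma> = h (\<lambda>i\<in>{..<N + N'}. pairing (\<psi> i) \<gamma>)" if "\<gamma> \<in> configs" for \<gamma>
  proof -
    have "p (\<lambda>i\<in>{..<N + N'}. pairing (\<psi> i) \<gamma>) = (\<lambda>i\<in>{..<N}. pairing (\<phi> i) \<gamma>)"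
      by (auto simp: p_def \<psi>_def fun_eq_iff restrict_def)
    moreover have "p' (\<lambda>i\<in>{..<N + N'}. pairing (\<psi> i) \<gamma>) = (\<lambda>i\<in>{..<N'}. pairing (\<phi>' i) \<gamma>)"
      by (auto simp: p'_def \<psi>_def fun_eq_iff restrict_def)
    ultimately show ?thesis using F(4) G(4) that by (simp add: h_def)
  qed
  have \<psi>: "\<psi> i \<in> C0" if "i < N + N'" for i using that F(1) G(1) by (auto simp: \<psi>_def)
  show ?thesis
    unfolding cylinder_functions_def
    by (intro CollectI exI[of _ "N + N'"] exI[of _ \<psi>] exI[of _ h] conjI allI impI ballI \<psi> cont bnd eq)
qed

section \<open>The Papangelou identity and the Glauber form\<close>

lemma ennreal_abs_integral_le:
  fixes f :: "'a \<Rightarrow> real"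
  shows "ennreal \<bar>\<integral>x. f x \<partial>M\<bar> \<le> (\<integral>\<^sup>+ x. ennreal \<bar>f x\<bar> \<partial>M)"
proof (cases "integrable M f")
  case True
  then show ?thesis using integral_norm_bound_ennreal[OF True] by simp
next
  \<comment> \<open>The Bochner integral then has its default value 0.\<close>
  case False
  then show ?thesis by (simp add: not_integrable_integral_eq)
qed

text \<open>The measure \<open>\<kappa> w\<close> changes with w, so the Bochner integral is rebuilt
  from the integrals of the positive and the negative part, with the default value 0 where one of
  them is infinite.\<close>

lemma measurable_kernel_integral:
  fixes h :: "'g \<Rightarrow> 'z \<Rightarrow> real"
  assumes h: "\<And>w. w \<in> space M \<Longrightarrow> h w \<in> borel_measurable (\<kappa> w)"
    and [measurable]: "(\<lambda>w. \<integral>\<^sup>+ z. ennreal (h w z) \<partial>\<kappa> w) \<in> borel_measurable M"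
      "(\<lambda>w. \<integral>\<^sup>+ z. ennreal (- h w z) \<partial>\<kappa> w) \<in> borel_measurable M"
  shows "(\<lambda>w. \<integral>z. h w z \<partial>\<kappa> w) \<in> borel_measurable M"
proof -
  let ?P = "\<lambda>w. \<integral>\<^sup>+ z. ennreal (h w z) \<partial>\<kappa> w" and ?N = "\<lambda>w. \<integral>\<^sup>+ z. ennreal (- h w z) \<partial>\<kappa> w"
  have "(\<integral>z. h w z \<partial>\<kappa> w) = (if ?P w \<noteq> \<infinity> \<and> ?N w \<noteq> \<infinity> then enn2real (?P w) - enn2real (?N w) else 0)"
    if "w \<in> space M" for w
  proof (cases "integrable (\<kappa> w) (h w)")
    case True
    then show ?thesis by (auto simp: real_lebesgue_integral_def real_integrable_def)
  next
    case False
    then show ?thesis using h[OF that] by (auto simp: real_integrable_def not_integrable_integral_eq)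
  qed
  then show ?thesis by (subst measurable_cong) measurable
qed

text \<open>Absolute integrability with respect to the measure composed of M and \<kappa>, kept as
  two non-negative iterated integrals because those are what the Papangelou identity transforms. In
  the applications \<open>\<kappa> w\<close> is the counting measure on a configuration, its product
  with \<nu>, or \<nu> itself.\<close>

definition kernel_integrable :: "'g measure \<Rightarrow> ('g \<Rightarrow> 'z measure) \<Rightarrow> ('g \<Rightarrow> 'z \<Rightarrow> real) \<Rightarrow> bool" where
  "kernel_integrable M \<kappa> h \<longleftrightarrow>
     (\<forall>w\<in>space M. h w \<in> borel_measurable (\<kappa> w)) \<and>
     (\<lambda>w. \<integral>\<^sup>+ z. ennreal (h w z) \<partial>\<kappa> w) \<in> borel_measurable M \<and>
     (\<lambda>w. \<integral>\<^sup>+ z. ennreal (- h w z) \<partial>\<kappa> w) \<in> borel_measurable M \<and>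
     (\<integral>\<^sup>+ w. (\<integral>\<^sup>+ z. ennreal (h w z) \<partial>\<kappa> w) \<partial>M) < \<infinity> \<and>
     (\<integral>\<^sup>+ w. (\<integral>\<^sup>+ z. ennreal (- h w z) \<partial>\<kappa> w) \<partial>M) < \<infinity>"

text \<open>Finite total mass makes both inner integrals finite for almost every w. The third
  conclusion is the point: identities between non-negative integrals of the parts yield identities
  between signed integrals.\<close>

lemma kernel_integrableD:
  fixes h :: "'g \<Rightarrow> 'z \<Rightarrow> real"
  assumes "kernel_integrable M \<kappa> h"
  shows "AE w in M. integrable (\<kappa> w) (h w)"
    "integrable M (\<lambda>w. \<integral>z. h w z \<partial>\<kappa> w)"
    "(\<integral>w. (\<integral>z. h w z \<partial>\<kappa> w) \<partial>M)
      = enn2real (\<integral>\<^sup>+ w. (\<integral>\<^sup>+ z. ennreal (h w z) \<partial>\<kappa> w) \<partial>M)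
      - enn2real (\<integral>\<^sup>+ w. (\<integral>\<^sup>+ z. ennreal (- h w z) \<partial>\<kappa> w) \<partial>M)"
proof -
  let ?P = "\<lambda>w. \<integral>\<^sup>+ z. ennreal (h w z) \<partial>\<kappa> w" and ?N = "\<lambda>w. \<integral>\<^sup>+ z. ennreal (- h w z) \<partial>\<kappa> w"
  have h: "\<And>w. w \<in> space M \<Longrightarrow> h w \<in> borel_measurable (\<kappa> w)"
    and [measurable]: "?P \<in> borel_measurable M" "?N \<in> borel_measurable M"
    and fin: "(\<integral>\<^sup>+ w. ?P w \<partial>M) \<noteq> \<infinity>" "(\<integral>\<^sup>+ w. ?N w \<partial>M) \<noteq> \<infinity>"
    using assms by (auto simp: kernel_integrable_def)
  have PN: "AE w in M. ?P w \<noteq> \<infinity>" "AE w in M. ?N w \<noteq> \<infinity>"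
    using fin by (intro nn_integral_PInf_AE; simp)+
  from this show AE: "AE w in M. integrable (\<kappa> w) (h w)"
    using AE_space by eventually_elim (simp add: real_integrable_def h)
  have part: "integrable M (\<lambda>w. enn2real (f w))"
    "(\<integral>w. enn2real (f w) \<partial>M) = enn2real (\<integral>\<^sup>+ w. f w \<partial>M)"
    if [measurable]: "f \<in> borel_measurable M" and fin: "(\<integral>\<^sup>+ w. f w \<partial>M) \<noteq> \<infinity>" for f
  proof -
    have "AE w in M. f w \<noteq> \<infinity>" using fin by (intro nn_integral_PInf_AE) simp_all
    then have "AE w in M. ennreal (enn2real (f w)) = f w"
      by eventually_elim (simp add: less_top)
    then have eq: "(\<integral>\<^sup>+ w. ennreal (enn2real (f w)) \<partial>M) = (\<integral>\<^sup>+ w. f w \<partial>M)"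
      by (rule nn_integral_cong_AE)
    show "integrable M (\<lambda>w. enn2real (f w))"
      using eq fin by (intro integrableI_nonneg) (auto simp: less_top)
    show "(\<integral>w. enn2real (f w) \<partial>M) = enn2real (\<integral>\<^sup>+ w. f w \<partial>M)"
      by (subst integral_eq_nn_integral) (auto simp: eq)
  qed
  have eq: "AE w in M. (\<integral>z. h w z \<partial>\<kappa> w) = enn2real (?P w) - enn2real (?N w)"
    using AE by eventually_elim (simp add: real_lebesgue_integral_def)
  have meas: "(\<lambda>w. \<integral>z. h w z \<partial>\<kappa> w) \<in> borel_measurable M"
    by (rule measurable_kernel_integral) (use h in measurable)
  have int: "integrable M (\<lambda>w. enn2real (?P w) - enn2real (?N w))"
    using part fin by (intro Bochner_Integration.integrable_diff) auto
  show "integrable M (\<lambda>w. \<integral>z. h w z \<partial>\<kappa> w)"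
    using int meas eq by (subst integrable_cong_AE) auto
  have "(\<integral>w. (\<integral>z. h w z \<partial>\<kappa> w) \<partial>M) = (\<integral>w. enn2real (?P w) - enn2real (?N w) \<partial>M)"
    using meas eq by (intro integral_cong_AE) auto
  also have "\<dots> = enn2real (\<integral>\<^sup>+ w. ?P w \<partial>M) - enn2real (\<integral>\<^sup>+ w. ?N w \<partial>M)"
    using part fin by (subst Bochner_Integration.integral_diff) auto
  finally show "(\<integral>w. (\<integral>z. h w z \<partial>\<kappa> w) \<partial>M) = enn2real (\<integral>\<^sup>+ w. ?P w \<partial>M) - enn2real (\<integral>\<^sup>+ w. ?N w \<partial>M)" .
qed

lemma kernel_integral_diff:
  assumes "kernel_integrable M \<kappa> h" "kernel_integrable M \<kappa> h'"
    and "kernel_integrable M \<kappa> (\<lambda>w z. h w z - h' w z)"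
  shows "(\<integral>w. (\<integral>z. h w z - h' w z \<partial>\<kappa> w) \<partial>M) = (\<integral>w. (\<integral>z. h w z \<partial>\<kappa> w) \<partial>M) - (\<integral>w. (\<integral>z. h' w z \<partial>\<kappa> w) \<partial>M)"
proof -
  note I = kernel_integrableD[OF assms(1)] kernel_integrableD[OF assms(2)] kernel_integrableD[OF assms(3)]
  have "(\<integral>w. (\<integral>z. h w z - h' w z \<partial>\<kappa> w) \<partial>M) = (\<integral>w. (\<integral>z. h w z \<partial>\<kappa> w) - (\<integral>z. h' w z \<partial>\<kappa> w) \<partial>M)"
  proof (rule integral_cong_AE)
    show "AE w in M. (\<integral>z. h w z - h' w z \<partial>\<kappa> w) = (\<integral>z. h w z \<partial>\<kappa> w) - (\<integral>z. h' w z \<partial>\<kappa> w)"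
      using I(1,4) by eventually_elim simp
  qed (use I(2,5,8) in auto)
  then show ?thesis using I(2,5) by simp
qed

lemma kernel_integrable_bound:
  fixes h :: "'g \<Rightarrow> 'z \<Rightarrow> real"
  assumes "\<And>w. w \<in> space M \<Longrightarrow> h w \<in> borel_measurable (\<kappa> w)"
    and "(\<lambda>w. \<integral>\<^sup>+ z. ennreal (h w z) \<partial>\<kappa> w) \<in> borel_measurable M"
    and "(\<lambda>w. \<integral>\<^sup>+ z. ennreal (- h w z) \<partial>\<kappa> w) \<in> borel_measurable M"
    and bound: "\<And>w z. w \<in> space M \<Longrightarrow> z \<in> space (\<kappa> w) \<Longrightarrow> ennreal \<bar>h w z\<bar> \<le> u w z"
    and fin: "(\<integral>\<^sup>+ w. (\<integral>\<^sup>+ z. u w z \<partial>\<kappa> w) \<partial>M) < \<infinity>"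
  shows "kernel_integrable M \<kappa> h"
proof -
  \<comment> \<open>The sign s = 1 or s = -1 treats the positive and the negative part at
    once.\<close>
  have "(\<integral>\<^sup>+ w. (\<integral>\<^sup>+ z. ennreal (s * h w z) \<partial>\<kappa> w) \<partial>M) < \<infinity>" if "\<bar>s\<bar> = 1" for s
  proof (rule le_less_trans[OF nn_integral_mono[OF nn_integral_mono] fin])
    fix w z assume wz: "w \<in> space M" "z \<in> space (\<kappa> w)"
    have "s * h w z \<le> \<bar>s * h w z\<bar>" by (rule abs_ge_self)
    then have "ennreal (s * h w z) \<le> ennreal \<bar>h w z\<bar>" using that by (intro ennreal_leI) (simp add: abs_mult)
    also have "\<dots> \<le> u w z" by (rule bound[OF wz])
    finally show "ennreal (s * h w z) \<le> u w z" .
  qed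
  from this[of 1] this[of "-1"] assms(1-3) show ?thesis by (simp add: kernel_integrable_def)
qed

lemma square_integrable_ennreal_bound:
  assumes u: "square_integrable_ennreal M u" and [measurable]: "f \<in> borel_measurable M"
    and le: "\<And>x. x \<in> space M \<Longrightarrow> ennreal \<bar>f x\<bar> \<le> ennreal a * u x"
  shows "square_integrable M (f :: 'a \<Rightarrow> real)"
proof -
  have [measurable]: "u \<in> borel_measurable M" using u by (simp add: square_integrable_ennreal_def)
  have "(\<integral>\<^sup>+ x. ennreal ((f x)\<^sup>2) \<partial>M) \<le> (\<integral>\<^sup>+ x. (ennreal a)\<^sup>2 * (u x)\<^sup>2 \<partial>M)"
  proof (rule nn_integral_mono)
    fix x assume "x \<in> space M"
    have "ennreal ((f x)\<^sup>2) = (ennreal \<bar>f x\<bar>)\<^sup>2" by (simp add: ennreal_power)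
    also have "\<dots> \<le> (ennreal a * u x)\<^sup>2" by (rule power_mono[OF le]) (use \<open>x \<in> space M\<close> in auto)
    finally show "ennreal ((f x)\<^sup>2) \<le> (ennreal a)\<^sup>2 * (u x)\<^sup>2" by (simp add: power_mult_distrib)
  qed
  also have "\<dots> = (ennreal a)\<^sup>2 * (\<integral>\<^sup>+ x. (u x)\<^sup>2 \<partial>M)" by (rule nn_integral_cmult) simp
  also have "\<dots> < \<infinity>" using u by (auto simp: square_integrable_ennreal_def ennreal_mult_less_top power_less_top_ennreal)
  finally show ?thesis by (auto simp: square_integrable_real intro!: integrableI_nonneg)
qed

text \<open>On a probability space $L^2$ lies in $L^1$, here through
  \<open>a \<le> 1 + a * a\<close>; this turns the square integrability assumptions into finite
  first moments.\<close>

lemma (in prob_space) square_integrable_ennreal_nn_integral: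
  assumes "square_integrable_ennreal M u"
  shows "(\<integral>\<^sup>+ x. u x \<partial>M) < \<infinity>"
proof -
  have [measurable]: "u \<in> borel_measurable M" using assms by (simp add: square_integrable_ennreal_def)
  have "a \<le> 1 + a\<^sup>2" for a :: ennreal
  proof (cases "a \<le> 1")
    case False
    then have "a * 1 \<le> a * a" by (intro mult_left_mono) auto
    then show ?thesis by (simp add: power2_eq_square add_increasing)
  qed (simp add: add_increasing2)
  then have "(\<integral>\<^sup>+ x. u x \<partial>M) \<le> (\<integral>\<^sup>+ x. 1 + (u x)\<^sup>2 \<partial>M)" by (intro nn_integral_mono)
  also have "\<dots> < \<infinity>"
    using assms by (subst nn_integral_add) (auto simp: square_integrable_ennreal_def emeasure_space_1)
  finally show ?thesis .
qed

text \<open>\<open>enn2real\<close> sends an infinite rate to 0, so the rate has to be finite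
  wherever q is non-zero. For negative q both sides are 0, so that the identity serves positive and
  negative parts alike.\<close>

lemma ennreal_enn2real_mult:
  assumes "0 \<le> d" "r * ennreal d < \<infinity> \<or> q = 0"
  shows "ennreal (enn2real (r * ennreal d) * q) = r * ennreal (d * q)"
proof (cases "q = 0")
  case False
  then have fin: "r * ennreal d < \<infinity>" using assms(2) by simp
  show ?thesis
  proof (cases "0 \<le> q")
    case True
    then show ?thesis using fin assms(1) by (simp add: ennreal_mult mult.assoc)
  next
    case False
    then show ?thesis using assms(1)
      by (simp add: ennreal_neg mult_nonneg_nonpos less_imp_le)
  qed
qed simp

section \<open>The point process and its Papangelou identity\<close>

locale papangelou_process =
  fixes \<nu> :: "'x::{second_countable_topology, t2_space} measure"
    and \<mu> :: "'x set measure" and r :: "'x \<Rightarrow> 'x set \<Rightarrow> ennreal"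
  assumes lc: "locally compact (UNIV :: 'x set)"
    and radon: "radon_measure \<nu>" and na: "non_atomic \<nu>"
    and prob: "prob_space \<mu>" and sets_mu: "sets \<mu> = sets config_space"
    and intensity: "papangelou_intensity \<nu> \<mu> r"
begin

sublocale mu: prob_space \<mu> by (rule prob)

lemma space_mu [simp]: "space \<mu> = configs"
  using sets_eq_imp_space_eq[OF sets_mu] by simp

lemma sets_nu: "sets \<nu> = sets borel"
  using radon by (simp add: radon_measure_def)

lemma space_nu [simp]: "space \<nu> = UNIV"
  using sets_eq_imp_space_eq[OF sets_nu] by simp

lemma borel_measurable_mu: "borel_measurable \<mu> = borel_measurable config_space"
  by (rule measurable_cong_sets[OF sets_mu refl])

sublocale nu: sigma_finite_measure \<nu>
proof (unfold_locales, intro exI[of _ "range exhaustion"] conjI ballI)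
  show "countable (range exhaustion)" by simp
  show "range exhaustion \<subseteq> sets \<nu>"
    using exhaustion(1)[OF lc] by (auto simp: sets_nu)
  show "\<Union>(range exhaustion) = space \<nu>"
    using exhaustion(4)[OF lc] by simp
  fix a :: "'x set" assume "a \<in> range exhaustion"
  then obtain n where a: "a = exhaustion n" by blast
  have "emeasure \<nu> a \<le> emeasure \<nu> (closure a)"
    by (intro emeasure_mono closure_subset) (simp add: sets_nu)
  also have "\<dots> < \<infinity>" using radon exhaustion(2)[OF lc] by (simp add: radon_measure_def a)
  finally show "emeasure \<nu> a \<noteq> \<infinity>" by simp
qed

lemma intensity_measurable: "case_prod r \<in> borel_measurable (borel \<Otimes>\<^sub>M config_space)"
  using intensity by (simp add: papangelou_intensity_def)

text \<open>A singleton of positive measure would contain a set of strictly smaller positive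
  measure, but its only proper subset is empty.\<close>

lemma emeasure_nu_singleton: "emeasure \<nu> {x} = 0"
proof (rule ccontr)
  assume "emeasure \<nu> {x} \<noteq> 0"
  moreover have "{x} \<in> sets \<nu>" by (simp add: sets_nu)
  ultimately obtain B where "B \<subseteq> {x}" "0 < emeasure \<nu> B" "emeasure \<nu> B < emeasure \<nu> {x}"
    using na unfolding non_atomic_def by (metis not_gr_zero)
  then show False by (auto simp: subset_singleton_iff)
qed

text \<open>Configurations are countable and singletons are null. Hence inserting \<nu>-almost any x
  and removing it again gives \<gamma> back, which simplifies the integrands produced by the
  Papangelou identity.\<close>

lemma AE_notin_config:
  assumes "\<gamma> \<in> configs" shows "AE x in \<nu>. x \<notin> \<gamma>"
proof -
  have "AE x in \<nu>. \<forall>y\<in>\<gamma>. x \<noteq> y"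
  proof (subst AE_ball_countable[OF configs_countable[OF lc assms]], intro ballI)
    fix y show "AE x in \<nu>. x \<noteq> y"
      using emeasure_nu_singleton[of y] by (intro AE_I[of _ _ "{y}"]) (auto simp: sets_nu)
  qed
  then show ?thesis by eventually_elim auto
qed

lemma papangelou:
  assumes "case_prod f \<in> borel_measurable (borel \<Otimes>\<^sub>M config_space)"
  shows "(\<integral>\<^sup>+ \<gamma>. (\<integral>\<^sup>+ x. f x \<gamma> \<partial>count_space \<gamma>) \<partial>\<mu>) = (\<integral>\<^sup>+ \<gamma>. (\<integral>\<^sup>+ x. r x \<gamma> * f x (insert x \<gamma>) \<partial>\<nu>) \<partial>\<mu>)"
  using intensity assms by (auto simp: papangelou_intensity_def)

lemma measurable_nn_integral_nu:
  assumes "case_prod f \<in> borel_measurable (borel \<Otimes>\<^sub>M config_space)"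
  shows "(\<lambda>\<gamma>. \<integral>\<^sup>+ x. f x \<gamma> \<partial>\<nu>) \<in> borel_measurable config_space"
proof -
  have "(\<lambda>p. f (snd p) (fst p)) \<in> borel_measurable (config_space \<Otimes>\<^sub>M \<nu>)"
    using measurable_compose[OF measurable_Pair[OF measurable_snd measurable_fst] assms]
    by (simp add: split_beta' sets_nu cong: measurable_cong_sets sets_pair_measure_cong)
  then show ?thesis
    by (intro nu.borel_measurable_nn_integral) (simp add: split_beta')
qed

lemma measurable_integral_nu:
  assumes "case_prod f \<in> borel_measurable (borel \<Otimes>\<^sub>M config_space)"
  shows "(\<lambda>\<gamma>. \<integral>x. f x \<gamma> \<partial>\<nu> :: real) \<in> borel_measurable config_space"
proof -
  have "(\<lambda>p. f (snd p) (fst p)) \<in> borel_measurable (config_space \<Otimes>\<^sub>M \<nu>)"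
    using measurable_compose[OF measurable_Pair[OF measurable_snd measurable_fst] assms]
    by (simp add: split_beta' sets_nu cong: measurable_cong_sets sets_pair_measure_cong)
  then show ?thesis
    by (intro nu.borel_measurable_lebesgue_integral) (simp add: split_beta')
qed

lemma measurable_integral_config:
  fixes f :: "'x \<Rightarrow> 'x set \<Rightarrow> real"
  assumes [measurable]: "case_prod f \<in> borel_measurable (borel \<Otimes>\<^sub>M config_space)"
  shows "(\<lambda>\<gamma>. \<integral>x. f x \<gamma> \<partial>count_space \<gamma>) \<in> borel_measurable config_space"
  by (rule measurable_kernel_integral) (auto intro!: measurable_nn_integral_config[OF lc] simp: split_beta')

lemma kernel_integrable_config:
  fixes f :: "'x \<Rightarrow> 'x set \<Rightarrow> real"
  assumes [measurable]: "case_prod f \<in> borel_measurable (borel \<Otimes>\<^sub>M config_space)"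
    and "\<And>\<gamma> x. \<gamma> \<in> configs \<Longrightarrow> x \<in> \<gamma> \<Longrightarrow> ennreal \<bar>f x \<gamma>\<bar> \<le> u x \<gamma>"
    and "(\<integral>\<^sup>+ \<gamma>. (\<integral>\<^sup>+ x. u x \<gamma> \<partial>count_space \<gamma>) \<partial>\<mu>) < \<infinity>"
  shows "kernel_integrable \<mu> count_space (\<lambda>\<gamma> x. f x \<gamma>)"
  by (rule kernel_integrable_bound[where u = "\<lambda>\<gamma> x. u x \<gamma>"])
    (use assms in \<open>auto simp: borel_measurable_mu split_beta' intro!: measurable_nn_integral_config[OF lc]\<close>)

lemma cylinder_square_integrable:
  assumes "F \<in> cylinder_functions"
  shows "square_integrable \<mu> F"
proof -
  obtain B where B: "0 \<le> B" "\<And>\<gamma>. \<gamma> \<in> configs \<Longrightarrow> \<bar>F \<gamma>\<bar> \<le> B"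
    using cylinder_bounded[OF assms] by blast
  show ?thesis
    by (rule square_integrable_ennreal_bound[where u = "\<lambda>_. 1" and a = B])
      (use B cylinder_measurable[OF assms] in \<open>auto simp: square_integrable_ennreal_def borel_measurable_mu
        mu.emeasure_space_1[unfolded space_mu] intro!: ennreal_leI\<close>)
qed

end

section \<open>Birth and death coefficients and the Glauber form\<close>

locale glauber_coefficients = papangelou_process \<nu> \<mu> r
  for \<nu> :: "'x::{second_countable_topology, t2_space} measure" and \<mu> r +
  fixes d :: "'x \<Rightarrow> 'x set \<Rightarrow> real"
  assumes d_measurable: "case_prod d \<in> borel_measurable (borel \<Otimes>\<^sub>M config_space)"
    and d_nonneg: "\<gamma> \<in> configs \<Longrightarrow> 0 \<le> d x \<gamma>"
    and d_square: "\<Lambda> \<in> rel_compact_borel \<Longrightarrow> square_integrable_ennreal \<mu>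
      (\<lambda>\<gamma>. \<integral>\<^sup>+ x. ennreal (d x (\<gamma> - {x})) * indicator \<Lambda> x \<partial>count_space \<gamma>)"
    and b_square: "\<Lambda> \<in> rel_compact_borel \<Longrightarrow> square_integrable_ennreal \<mu>
      (\<lambda>\<gamma>. \<integral>\<^sup>+ x. r x \<gamma> * ennreal (d x \<gamma>) * indicator \<Lambda> x \<partial>\<nu>)"
begin

text \<open>The birth rate may be infinite, and \<open>enn2real\<close> then replaces it by 0. For
  cylinder F and almost every \<gamma> the rate is finite \<nu>-almost everywhere on the set
  \<Lambda> to which the difference of F is confined, so this is the intended integral.\<close>

definition birth :: "('x set \<Rightarrow> real) \<Rightarrow> 'x set \<Rightarrow> real" where
  "birth F \<gamma> = (\<integral>x. enn2real (r x \<gamma> * ennreal (d x \<gamma>)) * D_plus x F \<gamma> \<partial>\<nu>)"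

definition death :: "('x set \<Rightarrow> real) \<Rightarrow> 'x set \<Rightarrow> real" where
  "death F \<gamma> = (\<integral>x. d x (\<gamma> - {x}) * D_minus x F \<gamma> \<partial>count_space \<gamma>)"

lemma measurable_removed:
  fixes f :: "'x \<Rightarrow> 'x set \<Rightarrow> real"
  assumes "case_prod f \<in> borel_measurable (borel \<Otimes>\<^sub>M config_space)"
  shows "(\<lambda>p. f (fst p) (snd p - {fst p})) \<in> borel_measurable (borel \<Otimes>\<^sub>M config_space)"
  using measurable_compose[OF measurable_Pair[OF measurable_fst measurable_remove_config[OF lc]] assms]
  by simp

lemma measurable_D_minus:
  fixes F :: "'x set \<Rightarrow> real"
  assumes "F \<in> cylinder_functions"
  shows "(\<lambda>p. D_minus (fst p) F (snd p)) \<in> borel_measurable (borel \<Otimes>\<^sub>M config_space)"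
  using measurable_compose[OF measurable_remove_config[OF lc] cylinder_measurable[OF assms]]
    measurable_compose[OF measurable_snd cylinder_measurable[OF assms]]
  unfolding D_minus_def by (intro borel_measurable_diff) auto

lemma measurable_D_plus:
  fixes F :: "'x set \<Rightarrow> real"
  assumes "F \<in> cylinder_functions"
  shows "(\<lambda>p. D_plus (fst p) F (snd p)) \<in> borel_measurable (borel \<Otimes>\<^sub>M config_space)"
  using measurable_compose[OF measurable_insert_config[OF lc] cylinder_measurable[OF assms]]
    measurable_compose[OF measurable_snd cylinder_measurable[OF assms]]
  unfolding D_plus_def by (intro borel_measurable_diff) auto

text \<open>Adding or removing a point outside \<Lambda> leaves the trace on \<Lambda> unchanged;
  otherwise two values bounded by B differ by at most 2B.\<close>

lemma D_bounds:
  fixes F :: "'x set \<Rightarrow> real"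
  assumes "F \<in> cylinder_functions"
  obtains B \<Lambda> where "0 \<le> B" "\<Lambda> \<in> rel_compact_borel"
    "\<And>\<gamma>. \<gamma> \<in> configs \<Longrightarrow> \<bar>F \<gamma>\<bar> \<le> B"
    "\<And>\<gamma> x. \<gamma> \<in> configs \<Longrightarrow> \<bar>D_minus x F \<gamma>\<bar> \<le> 2 * B * indicator \<Lambda> x"
    "\<And>\<gamma> x. \<gamma> \<in> configs \<Longrightarrow> \<bar>D_plus x F \<gamma>\<bar> \<le> 2 * B * indicator \<Lambda> x"
proof -
  obtain B where B: "0 \<le> B" "\<And>\<gamma>. \<gamma> \<in> configs \<Longrightarrow> \<bar>F \<gamma>\<bar> \<le> B"
    using cylinder_bounded[OF assms] by blast
  obtain \<Lambda> where L: "\<Lambda> \<in> rel_compact_borel"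
    "\<And>\<gamma> \<gamma>'. \<gamma> \<in> configs \<Longrightarrow> \<gamma>' \<in> configs \<Longrightarrow> \<gamma> \<inter> \<Lambda> = \<gamma>' \<inter> \<Lambda> \<Longrightarrow> F \<gamma> = F \<gamma>'"
    using cylinder_local[OF assms] by blast
  have diff: "\<bar>F \<gamma>' - F \<gamma>\<bar> \<le> 2 * B * indicator \<Lambda> x"
    if "\<gamma> \<in> configs" "\<gamma>' \<in> configs" "x \<notin> \<Lambda> \<Longrightarrow> \<gamma>' \<inter> \<Lambda> = \<gamma> \<inter> \<Lambda>" for \<gamma> \<gamma>' x
    using L(2)[OF that(2,1,3)] B(2)[OF that(1)] B(2)[OF that(2)] by (cases "x \<in> \<Lambda>") auto
  show thesis
  proof (rule that[OF B(1) L(1) B(2)])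
    fix \<gamma> :: "'x set" and x assume "\<gamma> \<in> configs"
    then show "\<bar>D_minus x F \<gamma>\<bar> \<le> 2 * B * indicator \<Lambda> x" "\<bar>D_plus x F \<gamma>\<bar> \<le> 2 * B * indicator \<Lambda> x"
      unfolding D_minus_def D_plus_def by (auto intro!: diff configs_remove configs_insert)
  qed
qed

text \<open>Dominated by \<open>2 * B\<close> times the integral of the birth rate over \<Lambda>,
  which is in $L^2$ by assumption.\<close>

lemma birth_square_integrable:
  assumes F: "F \<in> cylinder_functions"
  shows "square_integrable \<mu> (birth F)"
proof -
  obtain B \<Lambda> where B: "0 \<le> B" and L: "\<Lambda> \<in> rel_compact_borel"
    and bd: "\<And>\<gamma> x. \<gamma> \<in> configs \<Longrightarrow> \<bar>D_plus x F \<gamma>\<bar> \<le> 2 * B * indicator \<Lambda> x"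
    using D_bounds[OF F] by metis
  note [measurable] = intensity_measurable d_measurable measurable_D_plus[OF F]
  show ?thesis
  proof (rule square_integrable_ennreal_bound[OF b_square[OF L], where a = "2 * B"])
    show "birth F \<in> borel_measurable \<mu>"
      unfolding borel_measurable_mu birth_def
      by (rule measurable_integral_nu) (simp add: split_beta')
    fix \<gamma> assume "\<gamma> \<in> space \<mu>"
    then have g: "\<gamma> \<in> configs" by simp
    have "ennreal \<bar>birth F \<gamma>\<bar> \<le> (\<integral>\<^sup>+ x. ennreal \<bar>enn2real (r x \<gamma> * ennreal (d x \<gamma>)) * D_plus x F \<gamma>\<bar> \<partial>\<nu>)"
      unfolding birth_def by (rule ennreal_abs_integral_le)
    also have "\<dots> \<le> (\<integral>\<^sup>+ x. ennreal (2 * B) * (r x \<gamma> * ennreal (d x \<gamma>) * indicator \<Lambda> x) \<partial>\<nu>)"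
    proof (rule nn_integral_mono)
      fix x
      have "ennreal \<bar>enn2real (r x \<gamma> * ennreal (d x \<gamma>)) * D_plus x F \<gamma>\<bar>
        = ennreal (enn2real (r x \<gamma> * ennreal (d x \<gamma>))) * ennreal \<bar>D_plus x F \<gamma>\<bar>"
        by (simp add: abs_mult ennreal_mult)
      also have "\<dots> \<le> (r x \<gamma> * ennreal (d x \<gamma>)) * ennreal (2 * B * indicator \<Lambda> x)"
        using bd[OF g] by (intro mult_mono ennreal_leI) (auto simp: ennreal_enn2real_if)
      also have "ennreal (2 * B * indicator \<Lambda> x) = ennreal (2 * B) * indicator \<Lambda> x"
        by (simp add: indicator_def)
      finally show "ennreal \<bar>enn2real (r x \<gamma> * ennreal (d x \<gamma>)) * D_plus x F \<gamma>\<bar>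
        \<le> ennreal (2 * B) * (r x \<gamma> * ennreal (d x \<gamma>) * indicator \<Lambda> x)" by (simp add: mult_ac)
    qed
    also have "\<dots> = ennreal (2 * B) * (\<integral>\<^sup>+ x. r x \<gamma> * ennreal (d x \<gamma>) * indicator \<Lambda> x \<partial>\<nu>)"
    proof (rule nn_integral_cmult)
      have [measurable]: "\<Lambda> \<in> sets borel" using L by (simp add: rel_compact_borel_def)
      have pr: "(\<lambda>x. (x, \<gamma>)) \<in> measurable borel (borel \<Otimes>\<^sub>M config_space)"
        using g by (intro measurable_Pair) auto
      have [measurable]: "(\<lambda>x. r x \<gamma>) \<in> borel_measurable borel" "(\<lambda>x. d x \<gamma>) \<in> borel_measurable borel"
        using measurable_compose[OF pr intensity_measurable] measurable_compose[OF pr d_measurable] by simp_all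
      show "(\<lambda>x. r x \<gamma> * ennreal (d x \<gamma>) * indicator \<Lambda> x) \<in> borel_measurable \<nu>"
        by (simp add: measurable_cong_sets[OF sets_nu refl])
    qed
    finally show "ennreal \<bar>birth F \<gamma>\<bar> \<le> ennreal (2 * B) * (\<integral>\<^sup>+ x. r x \<gamma> * ennreal (d x \<gamma>) * indicator \<Lambda> x \<partial>\<nu>)" .
  qed
qed

lemma death_square_integrable:
  assumes F: "F \<in> cylinder_functions"
  shows "square_integrable \<mu> (death F)"
proof -
  obtain B \<Lambda> where B: "0 \<le> B" and L: "\<Lambda> \<in> rel_compact_borel"
    and bd: "\<And>\<gamma> x. \<gamma> \<in> configs \<Longrightarrow> \<bar>D_minus x F \<gamma>\<bar> \<le> 2 * B * indicator \<Lambda> x"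
    using D_bounds[OF F] by metis
  note [measurable] = measurable_removed[OF d_measurable] measurable_D_minus[OF F]
  show ?thesis
  proof (rule square_integrable_ennreal_bound[OF d_square[OF L], where a = "2 * B"])
    show "death F \<in> borel_measurable \<mu>"
      unfolding borel_measurable_mu death_def
      by (rule measurable_integral_config) (simp add: split_beta')
    fix \<gamma> assume "\<gamma> \<in> space \<mu>"
    then have g: "\<gamma> \<in> configs" by simp
    have "ennreal \<bar>death F \<gamma>\<bar> \<le> (\<integral>\<^sup>+ x. ennreal \<bar>d x (\<gamma> - {x}) * D_minus x F \<gamma>\<bar> \<partial>count_space \<gamma>)"
      unfolding death_def by (rule ennreal_abs_integral_le)
    also have "\<dots> \<le> (\<integral>\<^sup>+ x. ennreal (2 * B) * (ennreal (d x (\<gamma> - {x})) * indicator \<Lambda> x) \<partial>count_space \<gamma>)"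
    proof (rule nn_integral_mono)
      fix x
      have "ennreal \<bar>d x (\<gamma> - {x}) * D_minus x F \<gamma>\<bar> = ennreal (d x (\<gamma> - {x})) * ennreal \<bar>D_minus x F \<gamma>\<bar>"
        using d_nonneg[OF configs_remove[OF g]] by (simp add: abs_mult ennreal_mult)
      also have "\<dots> \<le> ennreal (d x (\<gamma> - {x})) * ennreal (2 * B * indicator \<Lambda> x)"
        using bd[OF g] by (intro mult_left_mono ennreal_leI) auto
      also have "ennreal (2 * B * indicator \<Lambda> x) = ennreal (2 * B) * indicator \<Lambda> x"
        by (simp add: indicator_def)
      finally show "ennreal \<bar>d x (\<gamma> - {x}) * D_minus x F \<gamma>\<bar>
        \<le> ennreal (2 * B) * (ennreal (d x (\<gamma> - {x})) * indicator \<Lambda> x)" by (simp add: mult_ac)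
    qed
    also have "\<dots> = ennreal (2 * B) * (\<integral>\<^sup>+ x. ennreal (d x (\<gamma> - {x})) * indicator \<Lambda> x \<partial>count_space \<gamma>)"
      by (rule nn_integral_cmult) simp
    finally show "ennreal \<bar>death F \<gamma>\<bar> \<le> ennreal (2 * B) * (\<integral>\<^sup>+ x. ennreal (d x (\<gamma> - {x})) * indicator \<Lambda> x \<partial>count_space \<gamma>)" .
  qed
qed

text \<open>The square integrable birth integral over \<Lambda> is finite almost surely, and then so
  is its integrand almost everywhere.\<close>

lemma AE_birth_rate_finite:
  assumes L: "\<Lambda> \<in> rel_compact_borel"
  shows "AE \<gamma> in \<mu>. AE x in \<nu>. x \<in> \<Lambda> \<longrightarrow> r x \<gamma> * ennreal (d x \<gamma>) < \<infinity>"
proof -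
  note [measurable] = intensity_measurable d_measurable
  have [measurable]: "\<Lambda> \<in> sets borel" using L by (simp add: rel_compact_borel_def)
  have "AE \<gamma> in \<mu>. (\<integral>\<^sup>+ x. r x \<gamma> * ennreal (d x \<gamma>) * indicator \<Lambda> x \<partial>\<nu>) \<noteq> \<infinity>"
    using mu.square_integrable_ennreal_nn_integral[OF b_square[OF L]] b_square[OF L]
    by (intro nn_integral_PInf_AE) (auto simp: square_integrable_ennreal_def)
  then show ?thesis
    using AE_space
  proof eventually_elim
    fix \<gamma> assume fin: "(\<integral>\<^sup>+ x. r x \<gamma> * ennreal (d x \<gamma>) * indicator \<Lambda> x \<partial>\<nu>) \<noteq> \<infinity>" and "\<gamma> \<in> space \<mu>"
    then have g: "\<gamma> \<in> configs" by simp
    have pr: "(\<lambda>x. (x, \<gamma>)) \<in> measurable borel (borel \<Otimes>\<^sub>M config_space)"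
      using g by (intro measurable_Pair) auto
    have [measurable]: "(\<lambda>x. r x \<gamma>) \<in> borel_measurable borel" "(\<lambda>x. d x \<gamma>) \<in> borel_measurable borel"
      using measurable_compose[OF pr intensity_measurable] measurable_compose[OF pr d_measurable] by simp_all
    have "AE x in \<nu>. r x \<gamma> * ennreal (d x \<gamma>) * indicator \<Lambda> x \<noteq> \<infinity>"
      using fin by (intro nn_integral_PInf_AE) (simp add: measurable_cong_sets[OF sets_nu refl])
    then show "AE x in \<nu>. x \<in> \<Lambda> \<longrightarrow> r x \<gamma> * ennreal (d x \<gamma>) < \<infinity>"
      by eventually_elim (auto simp: less_top)
  qed
qed

text \<open>Write \<open>D_minus x G \<gamma>\<close> as
  \<open>G (\<gamma> - {x}) - G \<gamma>\<close>. The second value gives \<open>- death F\<close>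
  against G. The first becomes, by the Papangelou identity, a \<nu>-integral over configurations
  with x inserted, where \<open>D_minus x F\<close> turns into \<open>- D_plus x F\<close> and G is
  evaluated at \<gamma>: this is \<open>- birth F\<close> against G.\<close>

lemma glauber_form_eq:
  assumes F: "F \<in> cylinder_functions" and G: "G \<in> cylinder_functions"
  shows "glauber_form \<mu> d F G = l2_inner \<mu> (\<lambda>\<gamma>. - birth F \<gamma> - death F \<gamma>) G"
proof -
  obtain B \<Lambda> where B: "0 \<le> B" and L: "\<Lambda> \<in> rel_compact_borel"
    and bm: "\<And>\<gamma> x. \<gamma> \<in> configs \<Longrightarrow> \<bar>D_minus x F \<gamma>\<bar> \<le> 2 * B * indicator \<Lambda> x"
    and bp: "\<And>\<gamma> x. \<gamma> \<in> configs \<Longrightarrow> \<bar>D_plus x F \<gamma>\<bar> \<le> 2 * B * indicator \<Lambda> x"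
    using D_bounds[OF F] by metis
  obtain C where C: "0 \<le> C" "\<And>\<gamma>. \<gamma> \<in> configs \<Longrightarrow> \<bar>G \<gamma>\<bar> \<le> C"
    using cylinder_bounded[OF G] by blast
  note [measurable] = intensity_measurable d_measurable measurable_removed[OF d_measurable]
    measurable_D_minus[OF F] measurable_D_plus[OF F] cylinder_measurable[OF G]
    measurable_compose[OF measurable_remove_config[OF lc] cylinder_measurable[OF G]]
    measurable_compose[OF measurable_snd cylinder_measurable[OF G]]
  let ?r = "\<lambda>x \<gamma>. d x (\<gamma> - {x}) * D_minus x F \<gamma>"
  let ?b = "\<lambda>x \<gamma>. enn2real (r x \<gamma> * ennreal (d x \<gamma>)) * D_plus x F \<gamma> * G \<gamma>"
  let ?u = "\<lambda>x \<gamma>. ennreal (d x (\<gamma> - {x})) * indicator \<Lambda> x"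
  \<comment> \<open>One domination for three integrands: the difference of F supplies \<Lambda>, the
    multiplier g only a bound.\<close>
  have ki: "kernel_integrable \<mu> count_space (\<lambda>\<gamma> x. ?r x \<gamma> * g x \<gamma>)"
    if [measurable]: "(\<lambda>p. g (fst p) (snd p)) \<in> borel_measurable (borel \<Otimes>\<^sub>M config_space)"
      and g: "\<And>\<gamma> x. \<gamma> \<in> configs \<Longrightarrow> \<bar>g x \<gamma>\<bar> \<le> a" for g a
  proof (rule kernel_integrable_config[where u = "\<lambda>x \<gamma>. ennreal (2 * B * a) * ?u x \<gamma>"])
    show "(\<lambda>(x, \<gamma>). ?r x \<gamma> * g x \<gamma>) \<in> borel_measurable (borel \<Otimes>\<^sub>M config_space)"
      by (simp add: split_beta')
    have "(\<integral>\<^sup>+ \<gamma>. (\<integral>\<^sup>+ x. ennreal (2 * B * a) * ?u x \<gamma> \<partial>count_space \<gamma>) \<partial>\<mu>)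
      = ennreal (2 * B * a) * (\<integral>\<^sup>+ \<gamma>. (\<integral>\<^sup>+ x. ?u x \<gamma> \<partial>count_space \<gamma>) \<partial>\<mu>)"
      using d_square[OF L] by (simp add: nn_integral_cmult square_integrable_ennreal_def)
    also have "\<dots> < \<infinity>"
      using mu.square_integrable_ennreal_nn_integral[OF d_square[OF L]] by (simp add: ennreal_mult_less_top)
    finally show "(\<integral>\<^sup>+ \<gamma>. (\<integral>\<^sup>+ x. ennreal (2 * B * a) * ?u x \<gamma> \<partial>count_space \<gamma>) \<partial>\<mu>) < \<infinity>" .
    fix \<gamma> and x :: 'x assume gc: "\<gamma> \<in> configs" "x \<in> \<gamma>"
    have "\<bar>?r x \<gamma> * g x \<gamma>\<bar> = d x (\<gamma> - {x}) * (\<bar>D_minus x F \<gamma>\<bar> * \<bar>g x \<gamma>\<bar>)"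
      using d_nonneg[OF configs_remove[OF gc(1)]] by (simp add: abs_mult)
    also have "\<dots> \<le> d x (\<gamma> - {x}) * (2 * B * indicator \<Lambda> x * a)"
      using B d_nonneg[OF configs_remove[OF gc(1)]] bm[OF gc(1)] g[OF gc(1)]
      by (intro mult_left_mono mult_mono) auto
    finally have "ennreal \<bar>?r x \<gamma> * g x \<gamma>\<bar> \<le> ennreal (d x (\<gamma> - {x}) * (2 * B * indicator \<Lambda> x * a))"
      by (rule ennreal_leI)
    also have "d x (\<gamma> - {x}) * (2 * B * indicator \<Lambda> x * a) = (2 * B * a) * (d x (\<gamma> - {x}) * indicator \<Lambda> x)"
      by (simp add: mult_ac)
    also have "ennreal \<dots> = ennreal (2 * B * a) * ?u x \<gamma>"
      using d_nonneg[OF configs_remove[OF gc(1)]]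
      by (auto simp: indicator_def ennreal_mult'')
    finally show "ennreal \<bar>?r x \<gamma> * g x \<gamma>\<bar> \<le> ennreal (2 * B * a) * ?u x \<gamma>" .
  qed
  have k1: "kernel_integrable \<mu> count_space (\<lambda>\<gamma> x. ?r x \<gamma> * G \<gamma>)"
    by (rule ki[of _ C]) (use C in simp_all)
  have k2: "kernel_integrable \<mu> count_space (\<lambda>\<gamma> x. ?r x \<gamma> * G (\<gamma> - {x}))"
    by (rule ki[of _ C]) (use C(2)[OF configs_remove] in simp_all)
  have k0: "kernel_integrable \<mu> count_space (\<lambda>\<gamma> x. ?r x \<gamma> * G (\<gamma> - {x}) - ?r x \<gamma> * G \<gamma>)"
    unfolding right_diff_distrib[symmetric]
  proof (rule ki[of _ "2 * C"])
    show "\<bar>G (\<gamma> - {x}) - G \<gamma>\<bar> \<le> 2 * C" if "\<gamma> \<in> configs" for \<gamma> x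
      using C(2)[OF that] C(2)[OF configs_remove[OF that], of x] by linarith
  qed simp
  \<comment> \<open>The values s = 1 and s = -1 give the positive and the negative part. They change
    places because removing x from the configuration with x inserted is the reverse of its
    birth.\<close>
  have transfer: "(\<integral>\<^sup>+ \<gamma>. (\<integral>\<^sup>+ x. ennreal (s * ?b x \<gamma>) \<partial>\<nu>) \<partial>\<mu>)
    = (\<integral>\<^sup>+ \<gamma>. (\<integral>\<^sup>+ x. ennreal (- s * (?r x \<gamma> * G (\<gamma> - {x}))) \<partial>count_space \<gamma>) \<partial>\<mu>)" for s
  proof -
    have "(\<integral>\<^sup>+ \<gamma>. (\<integral>\<^sup>+ x. ennreal (- s * (?r x \<gamma> * G (\<gamma> - {x}))) \<partial>count_space \<gamma>) \<partial>\<mu>)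
      = (\<integral>\<^sup>+ \<gamma>. (\<integral>\<^sup>+ x. r x \<gamma> * ennreal (- s * (?r x (insert x \<gamma>) * G (insert x \<gamma> - {x}))) \<partial>\<nu>) \<partial>\<mu>)"
      by (rule papangelou) (simp add: split_beta')
    also have "\<dots> = (\<integral>\<^sup>+ \<gamma>. (\<integral>\<^sup>+ x. ennreal (s * ?b x \<gamma>) \<partial>\<nu>) \<partial>\<mu>)"
    proof (rule nn_integral_cong_AE)
      show "AE \<gamma> in \<mu>. (\<integral>\<^sup>+ x. r x \<gamma> * ennreal (- s * (?r x (insert x \<gamma>) * G (insert x \<gamma> - {x}))) \<partial>\<nu>)
        = (\<integral>\<^sup>+ x. ennreal (s * ?b x \<gamma>) \<partial>\<nu>)"
        using AE_birth_rate_finite[OF L] AE_space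
      proof eventually_elim
        fix \<gamma> assume fin: "AE x in \<nu>. x \<in> \<Lambda> \<longrightarrow> r x \<gamma> * ennreal (d x \<gamma>) < \<infinity>" and "\<gamma> \<in> space \<mu>"
        then have g: "\<gamma> \<in> configs" by simp
        show "(\<integral>\<^sup>+ x. r x \<gamma> * ennreal (- s * (?r x (insert x \<gamma>) * G (insert x \<gamma> - {x}))) \<partial>\<nu>)
          = (\<integral>\<^sup>+ x. ennreal (s * ?b x \<gamma>) \<partial>\<nu>)"
        proof (rule nn_integral_cong_AE)
          show "AE x in \<nu>. r x \<gamma> * ennreal (- s * (?r x (insert x \<gamma>) * G (insert x \<gamma> - {x})))
            = ennreal (s * ?b x \<gamma>)"
            using fin AE_notin_config[OF g]
          proof eventually_elim
            fix x assume fin: "x \<in> \<Lambda> \<longrightarrow> r x \<gamma> * ennreal (d x \<gamma>) < \<infinity>" and "x \<notin> \<gamma>"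
            then have rem: "insert x \<gamma> - {x} = \<gamma>" by simp
            let ?q = "s * (D_plus x F \<gamma> * G \<gamma>)"
            \<comment> \<open>Outside \<Lambda> the rate may be infinite, but there the difference
              vanishes.\<close>
            have "D_plus x F \<gamma> = 0" if "x \<notin> \<Lambda>" using bp[OF g, of x] that by simp
            then have "r x \<gamma> * ennreal (d x \<gamma>) < \<infinity> \<or> ?q = 0" using fin by auto
            from ennreal_enn2real_mult[OF d_nonneg[OF g] this]
            show "r x \<gamma> * ennreal (- s * (?r x (insert x \<gamma>) * G (insert x \<gamma> - {x}))) = ennreal (s * ?b x \<gamma>)"
              unfolding D_minus_def rem by (simp add: D_plus_def algebra_simps)
          qed
        qed
      qed
    qed
    finally show ?thesis by simp
  qed
  \<comment> \<open>Both parts of the birth integrand have finite integral because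
    \<open>transfer\<close> equates them with the parts of \<open>k2\<close>, interchanged.\<close>
  have kb: "kernel_integrable \<mu> (\<lambda>_. \<nu>) (\<lambda>\<gamma> x. ?b x \<gamma>)"
    unfolding kernel_integrable_def
  proof (intro conjI ballI)
    have meas: "(\<lambda>p. ?b (fst p) (snd p)) \<in> borel_measurable (borel \<Otimes>\<^sub>M config_space)"
      by measurable
    show "(\<lambda>x. ?b x \<gamma>) \<in> borel_measurable \<nu>" if "\<gamma> \<in> space \<mu>" for \<gamma>
    proof -
      have "(\<lambda>x. (x, \<gamma>)) \<in> measurable borel (borel \<Otimes>\<^sub>M config_space)"
        using that by (intro measurable_Pair) auto
      from measurable_compose[OF this meas] show ?thesis
        by (simp add: measurable_cong_sets[OF sets_nu refl])
    qed
    show "(\<lambda>\<gamma>. \<integral>\<^sup>+ x. ennreal (?b x \<gamma>) \<partial>\<nu>) \<in> borel_measurable \<mu>"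
      "(\<lambda>\<gamma>. \<integral>\<^sup>+ x. ennreal (- ?b x \<gamma>) \<partial>\<nu>) \<in> borel_measurable \<mu>"
      unfolding borel_measurable_mu
      by (intro measurable_nn_integral_nu; simp add: split_beta')+
    show "(\<integral>\<^sup>+ \<gamma>. (\<integral>\<^sup>+ x. ennreal (?b x \<gamma>) \<partial>\<nu>) \<partial>\<mu>) < \<infinity>"
      "(\<integral>\<^sup>+ \<gamma>. (\<integral>\<^sup>+ x. ennreal (- ?b x \<gamma>) \<partial>\<nu>) \<partial>\<mu>) < \<infinity>"
      using transfer[of 1] transfer[of "-1"] k2 by (simp_all add: kernel_integrable_def)
  qed
  have "(\<integral>\<gamma>. (\<integral>x. ?b x \<gamma> \<partial>\<nu>) \<partial>\<mu>) = - (\<integral>\<gamma>. (\<integral>x. ?r x \<gamma> * G (\<gamma> - {x}) \<partial>count_space \<gamma>) \<partial>\<mu>)"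
    unfolding kernel_integrableD(3)[OF kb] kernel_integrableD(3)[OF k2]
    using transfer[of 1] transfer[of "-1"] by simp
  moreover have "glauber_form \<mu> d F G
    = (\<integral>\<gamma>. (\<integral>x. ?r x \<gamma> * G (\<gamma> - {x}) - ?r x \<gamma> * G \<gamma> \<partial>count_space \<gamma>) \<partial>\<mu>)"
    unfolding glauber_form_def D_minus_def[of _ G] right_diff_distrib[symmetric] ..
  moreover have "\<dots> = (\<integral>\<gamma>. (\<integral>x. ?r x \<gamma> * G (\<gamma> - {x}) \<partial>count_space \<gamma>) \<partial>\<mu>)
      - (\<integral>\<gamma>. (\<integral>x. ?r x \<gamma> * G \<gamma> \<partial>count_space \<gamma>) \<partial>\<mu>)"
    by (rule kernel_integral_diff[OF k2 k1 k0])
  moreover have "l2_inner \<mu> (\<lambda>\<gamma>. - birth F \<gamma> - death F \<gamma>) G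
    = (\<integral>\<gamma>. - (\<integral>x. ?b x \<gamma> \<partial>\<nu>) - (\<integral>x. ?r x \<gamma> * G \<gamma> \<partial>count_space \<gamma>) \<partial>\<mu>)"
    unfolding l2_inner_def by (simp add: birth_def death_def left_diff_distrib)
  moreover have "\<dots> = - (\<integral>\<gamma>. (\<integral>x. ?b x \<gamma> \<partial>\<nu>) \<partial>\<mu>) - (\<integral>\<gamma>. (\<integral>x. ?r x \<gamma> * G \<gamma> \<partial>count_space \<gamma>) \<partial>\<mu>)"
    using kernel_integrableD(2)[OF kb] kernel_integrableD(2)[OF k1] by simp
  ultimately show ?thesis by simp
qed

sublocale represented_form \<mu> cylinder_functions "glauber_form \<mu> d" "\<lambda>F \<gamma>. - birth F \<gamma> - death F \<gamma>"
proof
  fix u v :: "'x set \<Rightarrow> real" and a :: real assume u: "u \<in> cylinder_functions"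
  show "(\<lambda>x. a * u x) \<in> cylinder_functions" by (rule cylinder_scale[OF u])
  show "square_integrable \<mu> u" by (rule cylinder_square_integrable[OF u])
  show "square_integrable \<mu> (\<lambda>\<gamma>. - birth u \<gamma> - death u \<gamma>)"
    using square_integrable_diff[OF square_integrable_scale[OF birth_square_integrable[OF u], of "-1"]
        death_square_integrable[OF u]] by simp
  show "0 \<le> glauber_form \<mu> d u u"
    unfolding glauber_form_def
    by (intro Bochner_Integration.integral_nonneg) (auto simp: mult.assoc intro!: mult_nonneg_nonneg[OF d_nonneg[OF configs_remove] zero_le_square])
  assume v: "v \<in> cylinder_functions"
  show "(\<lambda>x. u x + v x) \<in> cylinder_functions" by (rule cylinder_add[OF u v])
  show "glauber_form \<mu> d u v = l2_inner \<mu> (\<lambda>\<gamma>. - birth u \<gamma> - death u \<gamma>) v"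
    by (rule glauber_form_eq[OF u v])
  show "glauber_form \<mu> d u v = glauber_form \<mu> d v u"
    by (simp add: glauber_form_def mult_ac)
qed (rule cylinder_zero)

end

section \<open>The Kawasaki form\<close>

locale kawasaki_coefficients = papangelou_process \<nu> \<mu> r
  for \<nu> :: "'x::{second_countable_topology, t2_space} measure" and \<mu> r +
  fixes c :: "'x \<Rightarrow> 'x \<Rightarrow> 'x set \<Rightarrow> real"
  assumes c_measurable: "(\<lambda>(x, y, \<gamma>). c x y \<gamma>) \<in> borel_measurable (borel \<Otimes>\<^sub>M borel \<Otimes>\<^sub>M config_space)"
    and c_nonneg: "\<gamma> \<in> configs \<Longrightarrow> 0 \<le> c x y \<gamma>"
    and balance: "\<gamma> \<in> configs \<Longrightarrow> r x \<gamma> * ennreal (c x y \<gamma>) = r y \<gamma> * ennreal (c y x \<gamma>)"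
    and c_square: "\<Lambda> \<in> rel_compact_borel \<Longrightarrow> square_integrable_ennreal \<mu>
      (\<lambda>\<gamma>. \<integral>\<^sup>+ x. (\<integral>\<^sup>+ y. ennreal (c x y (\<gamma> - {x})) * (indicator \<Lambda> x + indicator \<Lambda> y) \<partial>\<nu>) \<partial>count_space \<gamma>)"
begin

text \<open>A jump is a point \<open>((x, \<gamma>), y)\<close>: the particle at \<open>x\<close> in \<open>\<gamma>\<close> moves to \<open>y\<close>.\<close>

abbreviation jumps :: "(('x \<times> 'x set) \<times> 'x) measure" where
  "jumps \<equiv> (borel \<Otimes>\<^sub>M config_space) \<Otimes>\<^sub>M borel"

text \<open>Merging the sum over x and the \<nu>-integral over y into one measure lets the lemmas on
  parameter-dependent measures handle the double integral.\<close>

abbreviation jump_kernel :: "'x set \<Rightarrow> ('x \<times> 'x) measure" where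
  "jump_kernel \<gamma> \<equiv> count_space \<gamma> \<Otimes>\<^sub>M \<nu>"

abbreviation jump :: "'x \<Rightarrow> 'x \<Rightarrow> 'x set \<Rightarrow> 'x set" where
  "jump x y \<gamma> \<equiv> insert y (\<gamma> - {x})"

lemma jump_in_configs: "\<gamma> \<in> configs \<Longrightarrow> jump x y \<gamma> \<in> configs"
  by (intro configs_insert configs_remove)

lemma measurable_c_comp:
  assumes "f \<in> measurable M borel" "g \<in> measurable M borel" "h \<in> measurable M config_space"
  shows "(\<lambda>p. c (f p) (g p) (h p)) \<in> borel_measurable M"
  using measurable_compose[OF measurable_Pair[OF assms(1) measurable_Pair[OF assms(2,3)]] c_measurable]
  by simp

lemma measurable_insert_comp:
  assumes "f \<in> measurable M borel" "h \<in> measurable M (config_space :: 'x set measure)"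
  shows "(\<lambda>p. insert (f p) (h p)) \<in> measurable M config_space"
  using measurable_compose[OF measurable_Pair[OF assms] measurable_insert_config[OF lc]] by simp

lemma measurable_remove_comp:
  assumes "f \<in> measurable M borel" "h \<in> measurable M (config_space :: 'x set measure)"
  shows "(\<lambda>p. h p - {f p}) \<in> measurable M config_space"
  using measurable_compose[OF measurable_Pair[OF assms] measurable_remove_config[OF lc]] by simp

lemma measurable_jump:
  "(\<lambda>p. jump (fst (fst p)) (snd p) (snd (fst p))) \<in> measurable jumps config_space"
  by (intro measurable_insert_comp measurable_remove_comp) simp_all

lemma measurable_c_jump:
  "(\<lambda>p. c (fst (fst p)) (snd p) (snd (fst p) - {fst (fst p)})) \<in> borel_measurable jumps"
  by (intro measurable_c_comp measurable_remove_comp) simp_all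

lemma sets_jumps_nu: "sets ((borel \<Otimes>\<^sub>M config_space) \<Otimes>\<^sub>M \<nu>) = sets jumps"
  by (intro sets_pair_measure_cong refl sets_nu)

lemma measurable_nn_integral_target:
  assumes "(\<lambda>p. f (fst (fst p)) (snd p) (snd (fst p))) \<in> borel_measurable jumps"
  shows "(\<lambda>(x, \<gamma>). \<integral>\<^sup>+ y. f x y \<gamma> \<partial>\<nu>) \<in> borel_measurable (borel \<Otimes>\<^sub>M config_space)"
proof -
  have "(\<lambda>(q, y). f (fst q) y (snd q)) \<in> borel_measurable ((borel \<Otimes>\<^sub>M config_space) \<Otimes>\<^sub>M \<nu>)"
    using assms by (simp add: measurable_cong_sets[OF sets_jumps_nu refl] split_beta')
  from nu.borel_measurable_nn_integral[OF this] show ?thesis by (simp add: split_beta')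
qed

lemma measurable_integral_target:
  assumes "(\<lambda>p. f (fst (fst p)) (snd p) (snd (fst p)) :: real) \<in> borel_measurable jumps"
  shows "(\<lambda>(x, \<gamma>). \<integral>y. f x y \<gamma> \<partial>\<nu>) \<in> borel_measurable (borel \<Otimes>\<^sub>M config_space)"
proof -
  have "(\<lambda>(q, y). f (fst q) y (snd q)) \<in> borel_measurable ((borel \<Otimes>\<^sub>M config_space) \<Otimes>\<^sub>M \<nu>)"
    using assms by (simp add: measurable_cong_sets[OF sets_jumps_nu refl] split_beta')
  from nu.borel_measurable_lebesgue_integral[OF this] show ?thesis by (simp add: split_beta')
qed

text \<open>For a fixed configuration the first factor is a countable discrete space, so
  measurability on the product follows from that of each section in y.\<close>

lemma measurable_jump_fixed:
  assumes "(\<lambda>p. f (fst (fst p)) (snd p) (snd (fst p))) \<in> borel_measurable jumps" "\<gamma> \<in> configs"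
  shows "(\<lambda>y. f x y \<gamma>) \<in> borel_measurable \<nu>"
    "(\<lambda>z. f (fst z) (snd z) \<gamma>) \<in> borel_measurable (jump_kernel \<gamma>)"
proof -
  have x: "(\<lambda>y. f x y \<gamma>) \<in> borel_measurable \<nu>" for x
  proof -
    have "(\<lambda>y. ((x, \<gamma>), y)) \<in> measurable borel jumps"
      using assms(2) by (intro measurable_Pair) auto
    from measurable_compose[OF this assms(1)] show ?thesis
      by (simp add: measurable_cong_sets[OF sets_nu refl])
  qed
  then show "(\<lambda>y. f x y \<gamma>) \<in> borel_measurable \<nu>" .
  show "(\<lambda>z. f (fst z) (snd z) \<gamma>) \<in> borel_measurable (jump_kernel \<gamma>)"
    by (rule measurable_pair_measure_countable1[OF configs_countable[OF lc assms(2)]]) (simp add: x)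
qed

lemma nn_integral_jump_kernel:
  assumes "(\<lambda>p. f (fst (fst p)) (snd p) (snd (fst p))) \<in> borel_measurable jumps" "\<gamma> \<in> configs"
  shows "(\<integral>\<^sup>+ z. f (fst z) (snd z) \<gamma> \<partial>jump_kernel \<gamma>) = (\<integral>\<^sup>+ x. (\<integral>\<^sup>+ y. f x y \<gamma> \<partial>\<nu>) \<partial>count_space \<gamma>)"
  using nu.nn_integral_fst[OF measurable_jump_fixed(2)[OF assms]] by simp

lemma measurable_nn_integral_jumps:
  assumes "(\<lambda>p. f (fst (fst p)) (snd p) (snd (fst p))) \<in> borel_measurable jumps"
  shows "(\<lambda>\<gamma>. \<integral>\<^sup>+ x. (\<integral>\<^sup>+ y. f x y \<gamma> \<partial>\<nu>) \<partial>count_space \<gamma>) \<in> borel_measurable config_space"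
  by (rule measurable_nn_integral_config[OF lc measurable_nn_integral_target[OF assms]])

text \<open>The second conclusion is Fubini for Bochner integrals, applied at each \<gamma> for
  which the integrand is integrable; the first conclusion provides this almost everywhere.\<close>

lemma kernel_integrable_jumps:
  fixes f :: "'x \<Rightarrow> 'x \<Rightarrow> 'x set \<Rightarrow> real"
  assumes f: "(\<lambda>p. f (fst (fst p)) (snd p) (snd (fst p))) \<in> borel_measurable jumps"
    and u: "(\<lambda>p. u (fst (fst p)) (snd p) (snd (fst p))) \<in> borel_measurable jumps"
    and le: "\<And>\<gamma> x y. \<gamma> \<in> configs \<Longrightarrow> ennreal \<bar>f x y \<gamma>\<bar> \<le> u x y \<gamma>"
    and fin: "(\<integral>\<^sup>+ \<gamma>. (\<integral>\<^sup>+ x. (\<integral>\<^sup>+ y. u x y \<gamma> \<partial>\<nu>) \<partial>count_space \<gamma>) \<partial>\<mu>) < \<infinity>"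
  shows "kernel_integrable \<mu> jump_kernel (\<lambda>\<gamma> z. f (fst z) (snd z) \<gamma>)"
    "AE \<gamma> in \<mu>. (\<integral>x. (\<integral>y. f x y \<gamma> \<partial>\<nu>) \<partial>count_space \<gamma>) = (\<integral>z. f (fst z) (snd z) \<gamma> \<partial>jump_kernel \<gamma>)"
proof -
  note [measurable] = f
  have nn: "(\<lambda>\<gamma>. \<integral>\<^sup>+ z. g (fst z) (snd z) \<gamma> \<partial>jump_kernel \<gamma>) \<in> borel_measurable \<mu>"
    if g: "(\<lambda>p. g (fst (fst p)) (snd p) (snd (fst p))) \<in> borel_measurable jumps" for g
    using measurable_nn_integral_jumps[OF g]
    by (subst measurable_cong[OF nn_integral_jump_kernel[OF g]]) (simp_all add: borel_measurable_mu)
  show k: "kernel_integrable \<mu> jump_kernel (\<lambda>\<gamma> z. f (fst z) (snd z) \<gamma>)"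
  proof (rule kernel_integrable_bound[where u = "\<lambda>\<gamma> z. u (fst z) (snd z) \<gamma>"])
    show "(\<lambda>z. f (fst z) (snd z) \<gamma>) \<in> borel_measurable (jump_kernel \<gamma>)" if "\<gamma> \<in> space \<mu>" for \<gamma>
      using that by (intro measurable_jump_fixed(2)[OF f]) simp
    show "(\<lambda>\<gamma>. \<integral>\<^sup>+ z. ennreal (f (fst z) (snd z) \<gamma>) \<partial>jump_kernel \<gamma>) \<in> borel_measurable \<mu>"
      by (rule nn) measurable
    show "(\<lambda>\<gamma>. \<integral>\<^sup>+ z. ennreal (- f (fst z) (snd z) \<gamma>) \<partial>jump_kernel \<gamma>) \<in> borel_measurable \<mu>"
      by (rule nn) measurable
    have "(\<integral>\<^sup>+ \<gamma>. (\<integral>\<^sup>+ z. u (fst z) (snd z) \<gamma> \<partial>jump_kernel \<gamma>) \<partial>\<mu>)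
      = (\<integral>\<^sup>+ \<gamma>. (\<integral>\<^sup>+ x. (\<integral>\<^sup>+ y. u x y \<gamma> \<partial>\<nu>) \<partial>count_space \<gamma>) \<partial>\<mu>)"
      by (rule nn_integral_cong) (simp add: nn_integral_jump_kernel[OF u])
    then show "(\<integral>\<^sup>+ \<gamma>. (\<integral>\<^sup>+ z. u (fst z) (snd z) \<gamma> \<partial>jump_kernel \<gamma>) \<partial>\<mu>) < \<infinity>" using fin by simp
  qed (use le in simp)
  show "AE \<gamma> in \<mu>. (\<integral>x. (\<integral>y. f x y \<gamma> \<partial>\<nu>) \<partial>count_space \<gamma>) = (\<integral>z. f (fst z) (snd z) \<gamma> \<partial>jump_kernel \<gamma>)"
    using kernel_integrableD(1)[OF k] AE_space
  proof eventually_elim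
    fix \<gamma> assume int: "integrable (jump_kernel \<gamma>) (\<lambda>z. f (fst z) (snd z) \<gamma>)" and "\<gamma> \<in> space \<mu>"
    then have "countable \<gamma>" using configs_countable[OF lc] by simp
    then interpret count: sigma_finite_measure "count_space \<gamma>"
      by (rule sigma_finite_measure_count_space_countable)
    interpret pair_sigma_finite "count_space \<gamma>" \<nu> ..
    show "(\<integral>x. (\<integral>y. f x y \<gamma> \<partial>\<nu>) \<partial>count_space \<gamma>) = (\<integral>z. f (fst z) (snd z) \<gamma> \<partial>jump_kernel \<gamma>)"
      using integral_fst'[OF int] by simp
  qed
qed

text \<open>The identity of Papangelou turns a jump from \<open>x\<close> to \<open>y\<close> into a symmetric pair of insertions,
  and the balance condition exchanges their roles: the jump dynamics is reversible.\<close>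

lemma nn_integral_jump_reverse:
  assumes \<Phi>: "(\<lambda>p. \<Phi> (fst p) (snd p)) \<in> borel_measurable (config_space \<Otimes>\<^sub>M (config_space :: 'x set measure))"
  shows "(\<integral>\<^sup>+ \<gamma>. (\<integral>\<^sup>+ x. (\<integral>\<^sup>+ y. ennreal (c x y (\<gamma> - {x})) * \<Phi> \<gamma> (jump x y \<gamma>) \<partial>\<nu>) \<partial>count_space \<gamma>) \<partial>\<mu>)
    = (\<integral>\<^sup>+ \<gamma>. (\<integral>\<^sup>+ x. (\<integral>\<^sup>+ y. ennreal (c x y (\<gamma> - {x})) * \<Phi> (jump x y \<gamma>) \<gamma> \<partial>\<nu>) \<partial>count_space \<gamma>) \<partial>\<mu>)"
proof -
  interpret nn: pair_sigma_finite \<nu> \<nu> ..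
  \<comment> \<open>The jump appears as a transition from \<gamma> with x inserted to \<gamma> with
    y inserted, so that source and target play parallel roles.\<close>
  define g where "g \<Psi> \<gamma> x y = r x \<gamma> * (ennreal (c x y \<gamma>) * \<Psi> (insert x \<gamma>) (insert y \<gamma>))"
    for \<Psi> :: "'x set \<Rightarrow> 'x set \<Rightarrow> ennreal" and \<gamma> x y
  \<comment> \<open>Stated for arbitrary \<Psi> because it is applied to \<Phi> and to \<Phi> with
    its arguments exchanged.\<close>
  have insertions: "(\<integral>\<^sup>+ \<gamma>. (\<integral>\<^sup>+ x. (\<integral>\<^sup>+ y. ennreal (c x y (\<gamma> - {x})) * \<Psi> \<gamma> (jump x y \<gamma>) \<partial>\<nu>) \<partial>count_space \<gamma>) \<partial>\<mu>)
    = (\<integral>\<^sup>+ \<gamma>. (\<integral>\<^sup>+ x. (\<integral>\<^sup>+ y. g \<Psi> \<gamma> x y \<partial>\<nu>) \<partial>\<nu>) \<partial>\<mu>)"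
    if \<Psi>: "(\<lambda>p. \<Psi> (fst p) (snd p)) \<in> borel_measurable (config_space \<Otimes>\<^sub>M config_space)" for \<Psi>
  proof -
    let ?f = "\<lambda>x y \<gamma>. ennreal (c x y (\<gamma> - {x})) * \<Psi> \<gamma> (jump x y \<gamma>)"
    note [measurable] = measurable_c_jump
    have [measurable]: "(\<lambda>p. \<Psi> (snd (fst p)) (jump (fst (fst p)) (snd p) (snd (fst p)))) \<in> borel_measurable jumps"
      using measurable_compose[OF measurable_Pair[OF measurable_compose[OF measurable_fst measurable_snd] measurable_jump] \<Psi>]
      by simp
    have "(\<integral>\<^sup>+ \<gamma>. (\<integral>\<^sup>+ x. (\<integral>\<^sup>+ y. ?f x y \<gamma> \<partial>\<nu>) \<partial>count_space \<gamma>) \<partial>\<mu>)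
      = (\<integral>\<^sup>+ \<gamma>. (\<integral>\<^sup>+ x. r x \<gamma> * (\<integral>\<^sup>+ y. ?f x y (insert x \<gamma>) \<partial>\<nu>) \<partial>\<nu>) \<partial>\<mu>)"
      by (rule papangelou[OF measurable_nn_integral_target]) measurable
    also have "\<dots> = (\<integral>\<^sup>+ \<gamma>. (\<integral>\<^sup>+ x. (\<integral>\<^sup>+ y. g \<Psi> \<gamma> x y \<partial>\<nu>) \<partial>\<nu>) \<partial>\<mu>)"
    proof (rule nn_integral_cong)
      fix \<gamma> assume "\<gamma> \<in> space \<mu>"
      then have \<gamma>: "\<gamma> \<in> configs" by simp
      show "(\<integral>\<^sup>+ x. r x \<gamma> * (\<integral>\<^sup>+ y. ?f x y (insert x \<gamma>) \<partial>\<nu>) \<partial>\<nu>) = (\<integral>\<^sup>+ x. (\<integral>\<^sup>+ y. g \<Psi> \<gamma> x y \<partial>\<nu>) \<partial>\<nu>)"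
      proof (rule nn_integral_cong_AE)
        show "AE x in \<nu>. r x \<gamma> * (\<integral>\<^sup>+ y. ?f x y (insert x \<gamma>) \<partial>\<nu>) = (\<integral>\<^sup>+ y. g \<Psi> \<gamma> x y \<partial>\<nu>)"
          using AE_notin_config[OF \<gamma>]
        proof eventually_elim
          fix x assume "x \<notin> \<gamma>"
          then have rem: "insert x \<gamma> - {x} = \<gamma>" by simp
          have "(\<lambda>y. ?f x y (insert x \<gamma>)) \<in> borel_measurable \<nu>"
            by (rule measurable_jump_fixed(1)) (measurable, rule configs_insert[OF \<gamma>])
          then show "r x \<gamma> * (\<integral>\<^sup>+ y. ?f x y (insert x \<gamma>) \<partial>\<nu>) = (\<integral>\<^sup>+ y. g \<Psi> \<gamma> x y \<partial>\<nu>)"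
            unfolding g_def rem by (rule nn_integral_cmult[symmetric])
        qed
      qed
    qed
    finally show ?thesis .
  qed
  have \<Phi>': "(\<lambda>p. \<Phi> (snd p) (fst p)) \<in> borel_measurable (config_space \<Otimes>\<^sub>M (config_space :: 'x set measure))"
    using measurable_compose[OF measurable_Pair[OF measurable_snd measurable_fst] \<Phi>] by simp
  have "(\<integral>\<^sup>+ x. (\<integral>\<^sup>+ y. g \<Phi> \<gamma> x y \<partial>\<nu>) \<partial>\<nu>) = (\<integral>\<^sup>+ x. (\<integral>\<^sup>+ y. g (\<lambda>a b. \<Phi> b a) \<gamma> x y \<partial>\<nu>) \<partial>\<nu>)"
    if \<gamma>: "\<gamma> \<in> configs" for \<gamma>
  proof -
    have const: "(\<lambda>_. \<gamma>) \<in> measurable (borel \<Otimes>\<^sub>M borel) config_space" using \<gamma> by simp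
    have ins: "(\<lambda>z. insert (f z) \<gamma>) \<in> measurable (borel \<Otimes>\<^sub>M borel) config_space"
      if "f \<in> measurable (borel \<Otimes>\<^sub>M borel) borel" for f :: "'x \<times> 'x \<Rightarrow> 'x"
      by (rule measurable_insert_comp[OF that const])
    have [measurable]: "(\<lambda>z. \<Phi> (insert (fst z) \<gamma>) (insert (snd z) \<gamma>)) \<in> borel_measurable (borel \<Otimes>\<^sub>M borel)"
      using measurable_compose[OF measurable_Pair[OF ins[OF measurable_fst] ins[OF measurable_snd]] \<Phi>] by simp
    have [measurable]: "(\<lambda>z. c (fst z) (snd z) \<gamma>) \<in> borel_measurable (borel \<Otimes>\<^sub>M borel)"
      by (rule measurable_c_comp[OF _ _ const]) simp_all
    have [measurable]: "(\<lambda>z. r (fst z) \<gamma>) \<in> borel_measurable (borel \<Otimes>\<^sub>M borel)"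
      using measurable_compose[OF measurable_Pair[OF measurable_fst const] intensity_measurable] by simp
    have meas: "(\<lambda>(x, y). g \<Phi> \<gamma> x y) \<in> borel_measurable (\<nu> \<Otimes>\<^sub>M \<nu>)"
      unfolding measurable_cong_sets[OF sets_pair_measure_cong[OF sets_nu sets_nu] refl] g_def split_beta'
      by measurable
    have "(\<integral>\<^sup>+ x. (\<integral>\<^sup>+ y. g \<Phi> \<gamma> x y \<partial>\<nu>) \<partial>\<nu>) = (\<integral>\<^sup>+ y. (\<integral>\<^sup>+ x. g \<Phi> \<gamma> x y \<partial>\<nu>) \<partial>\<nu>)"
      using nn.Fubini[OF meas] by simp
    \<comment> \<open>After the exchange of integrals source and target carry each other's names.
      Balance replaces r(x) c(x,y) by r(y) c(y,x), which restores the weight with the arguments of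
      \<Phi> swapped.\<close>
    also have "\<dots> = (\<integral>\<^sup>+ x. (\<integral>\<^sup>+ y. g (\<lambda>a b. \<Phi> b a) \<gamma> x y \<partial>\<nu>) \<partial>\<nu>)"
      by (intro nn_integral_cong) (simp add: g_def mult.assoc[symmetric] balance[OF \<gamma>])
    finally show ?thesis .
  qed
  then show ?thesis
    unfolding insertions[OF \<Phi>] insertions[OF \<Phi>'] by (intro nn_integral_cong[where M = \<mu>]) simp
qed

text \<open>A jump with both endpoints outside \<Lambda> leaves the trace on \<Lambda> unchanged;
  otherwise the sum of indicators is at least 1. This sum is the weight in the integrability
  assumption. The constant provided is twice a bound of F.\<close>

lemma jump_bounds:
  assumes "F \<in> cylinder_functions"
  obtains B \<Lambda> where "0 \<le> B" "\<Lambda> \<in> rel_compact_borel"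
    "\<And>\<gamma> x y. \<gamma> \<in> configs \<Longrightarrow> \<bar>F (jump x y \<gamma>) - F \<gamma>\<bar> \<le> B * (indicator \<Lambda> x + indicator \<Lambda> y)"
proof -
  obtain B where B: "0 \<le> B" "\<And>\<gamma>. \<gamma> \<in> configs \<Longrightarrow> \<bar>F \<gamma>\<bar> \<le> B"
    using cylinder_bounded[OF assms] by blast
  obtain \<Lambda> where L: "\<Lambda> \<in> rel_compact_borel"
    "\<And>\<gamma> \<gamma>'. \<gamma> \<in> configs \<Longrightarrow> \<gamma>' \<in> configs \<Longrightarrow> \<gamma> \<inter> \<Lambda> = \<gamma>' \<inter> \<Lambda> \<Longrightarrow> F \<gamma> = F \<gamma>'"
    using cylinder_local[OF assms] by blast
  have "\<bar>F (jump x y \<gamma>) - F \<gamma>\<bar> \<le> 2 * B * (indicator \<Lambda> x + indicator \<Lambda> y)" if g: "\<gamma> \<in> configs" for \<gamma> x y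
  proof (cases "x \<in> \<Lambda> \<or> y \<in> \<Lambda>")
    case True
    have "\<bar>F (jump x y \<gamma>) - F \<gamma>\<bar> \<le> 2 * B * 1"
      using B(2)[OF g] B(2)[OF jump_in_configs[OF g], of y x] by linarith
    also have "\<dots> \<le> 2 * B * (indicator \<Lambda> x + indicator \<Lambda> y)"
      using B(1) True by (intro mult_left_mono) (auto simp: indicator_def)
    finally show ?thesis .
  next
    case False
    then have "jump x y \<gamma> \<inter> \<Lambda> = \<gamma> \<inter> \<Lambda>" by auto
    from L(2)[OF jump_in_configs[OF g] g this] show ?thesis using False by simp
  qed
  then show thesis using B(1) L(1) by (intro that[of "2 * B" \<Lambda>]) simp_all
qed

text \<open>Here the $L^2$ assumption on c enters: a multiplier h bounded by K times the indicator
  weight is dominated by K times the assumed function. The multipliers of interest are a difference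
  of F, alone or times a bounded factor.\<close>

lemma jump_dominated:
  assumes L: "\<Lambda> \<in> rel_compact_borel" and K: "0 \<le> K"
    and h: "(\<lambda>p. h (fst (fst p)) (snd p) (snd (fst p)) :: real) \<in> borel_measurable jumps"
    and le: "\<And>\<gamma> x y. \<gamma> \<in> configs \<Longrightarrow> \<bar>h x y \<gamma>\<bar> \<le> K * (indicator \<Lambda> x + indicator \<Lambda> y)"
  shows "kernel_integrable \<mu> jump_kernel (\<lambda>\<gamma> z. c (fst z) (snd z) (\<gamma> - {fst z}) * h (fst z) (snd z) \<gamma>)"
    "AE \<gamma> in \<mu>. (\<integral>x. (\<integral>y. c x y (\<gamma> - {x}) * h x y \<gamma> \<partial>\<nu>) \<partial>count_space \<gamma>)
      = (\<integral>z. c (fst z) (snd z) (\<gamma> - {fst z}) * h (fst z) (snd z) \<gamma> \<partial>jump_kernel \<gamma>)"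
    "square_integrable \<mu> (\<lambda>\<gamma>. \<integral>x. (\<integral>y. c x y (\<gamma> - {x}) * h x y \<gamma> \<partial>\<nu>) \<partial>count_space \<gamma>)"
proof -
  let ?f = "\<lambda>x y \<gamma>. c x y (\<gamma> - {x}) * h x y \<gamma>"
  let ?v = "\<lambda>x y \<gamma>. ennreal (c x y (\<gamma> - {x})) * (indicator \<Lambda> x + indicator \<Lambda> y)"
  let ?u = "\<lambda>x y \<gamma>. ennreal K * ?v x y \<gamma>"
  have [measurable]: "\<Lambda> \<in> sets borel" using L by (simp add: rel_compact_borel_def)
  note [measurable] = h measurable_c_jump
  have f: "(\<lambda>p. ?f (fst (fst p)) (snd p) (snd (fst p))) \<in> borel_measurable jumps" by measurable
  have v: "(\<lambda>p. ?v (fst (fst p)) (snd p) (snd (fst p))) \<in> borel_measurable jumps" by measurable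
  have u: "(\<lambda>p. ?u (fst (fst p)) (snd p) (snd (fst p))) \<in> borel_measurable jumps" by measurable
  have bound: "ennreal \<bar>?f x y \<gamma>\<bar> \<le> ?u x y \<gamma>" if g: "\<gamma> \<in> configs" for x y \<gamma>
  proof -
    have "ennreal \<bar>?f x y \<gamma>\<bar> = ennreal (c x y (\<gamma> - {x})) * ennreal \<bar>h x y \<gamma>\<bar>"
      using c_nonneg[OF configs_remove[OF g]] by (simp add: abs_mult ennreal_mult)
    also have "\<dots> \<le> ennreal (c x y (\<gamma> - {x})) * ennreal (K * (indicator \<Lambda> x + indicator \<Lambda> y))"
      using le[OF g] by (intro mult_left_mono ennreal_leI) auto
    also have "ennreal (K * (indicator \<Lambda> x + indicator \<Lambda> y)) = ennreal K * (indicator \<Lambda> x + indicator \<Lambda> y)"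
      using K by (auto simp: indicator_def ennreal_mult)
    finally show ?thesis by (simp add: mult_ac)
  qed
  have uv: "(\<integral>\<^sup>+ x. (\<integral>\<^sup>+ y. ?u x y \<gamma> \<partial>\<nu>) \<partial>count_space \<gamma>)
    = ennreal K * (\<integral>\<^sup>+ x. (\<integral>\<^sup>+ y. ?v x y \<gamma> \<partial>\<nu>) \<partial>count_space \<gamma>)" if g: "\<gamma> \<in> configs" for \<gamma>
    using measurable_jump_fixed(1)[OF v g] by (simp add: nn_integral_cmult)
  have "(\<integral>\<^sup>+ \<gamma>. (\<integral>\<^sup>+ x. (\<integral>\<^sup>+ y. ?u x y \<gamma> \<partial>\<nu>) \<partial>count_space \<gamma>) \<partial>\<mu>)
    = (\<integral>\<^sup>+ \<gamma>. ennreal K * (\<integral>\<^sup>+ x. (\<integral>\<^sup>+ y. ?v x y \<gamma> \<partial>\<nu>) \<partial>count_space \<gamma>) \<partial>\<mu>)"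
    by (rule nn_integral_cong) (rule uv, simp)
  also have "\<dots> = ennreal K * (\<integral>\<^sup>+ \<gamma>. (\<integral>\<^sup>+ x. (\<integral>\<^sup>+ y. ?v x y \<gamma> \<partial>\<nu>) \<partial>count_space \<gamma>) \<partial>\<mu>)"
    using c_square[OF L] by (intro nn_integral_cmult) (simp add: square_integrable_ennreal_def)
  also have "\<dots> < \<infinity>"
    using mu.square_integrable_ennreal_nn_integral[OF c_square[OF L]] by (simp add: ennreal_mult_less_top)
  finally have fin: "(\<integral>\<^sup>+ \<gamma>. (\<integral>\<^sup>+ x. (\<integral>\<^sup>+ y. ?u x y \<gamma> \<partial>\<nu>) \<partial>count_space \<gamma>) \<partial>\<mu>) < \<infinity>" .
  show "kernel_integrable \<mu> jump_kernel (\<lambda>\<gamma> z. ?f (fst z) (snd z) \<gamma>)"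
    "AE \<gamma> in \<mu>. (\<integral>x. (\<integral>y. ?f x y \<gamma> \<partial>\<nu>) \<partial>count_space \<gamma>) = (\<integral>z. ?f (fst z) (snd z) \<gamma> \<partial>jump_kernel \<gamma>)"
    by (rule kernel_integrable_jumps[OF f u bound fin]; assumption)+
  show "square_integrable \<mu> (\<lambda>\<gamma>. \<integral>x. (\<integral>y. ?f x y \<gamma> \<partial>\<nu>) \<partial>count_space \<gamma>)"
  proof (rule square_integrable_ennreal_bound[OF c_square[OF L], where a = K])
    show "(\<lambda>\<gamma>. \<integral>x. (\<integral>y. ?f x y \<gamma> \<partial>\<nu>) \<partial>count_space \<gamma>) \<in> borel_measurable \<mu>"
      unfolding borel_measurable_mu by (rule measurable_integral_config[OF measurable_integral_target[OF f]])
    fix \<gamma> assume "\<gamma> \<in> space \<mu>"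
    then have g: "\<gamma> \<in> configs" by simp
    have "ennreal \<bar>\<integral>x. (\<integral>y. ?f x y \<gamma> \<partial>\<nu>) \<partial>count_space \<gamma>\<bar>
      \<le> (\<integral>\<^sup>+ x. ennreal \<bar>\<integral>y. ?f x y \<gamma> \<partial>\<nu>\<bar> \<partial>count_space \<gamma>)"
      by (rule ennreal_abs_integral_le)
    also have "\<dots> \<le> (\<integral>\<^sup>+ x. (\<integral>\<^sup>+ y. ?u x y \<gamma> \<partial>\<nu>) \<partial>count_space \<gamma>)"
      by (intro nn_integral_mono order_trans[OF ennreal_abs_integral_le] nn_integral_mono bound[OF g])
    finally show "ennreal \<bar>\<integral>x. (\<integral>y. ?f x y \<gamma> \<partial>\<nu>) \<partial>count_space \<gamma>\<bar>
      \<le> ennreal K * (\<integral>\<^sup>+ x. (\<integral>\<^sup>+ y. ?v x y \<gamma> \<partial>\<nu>) \<partial>count_space \<gamma>)"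
      unfolding uv[OF g] .
  qed
qed

definition jump_rate :: "('x set \<Rightarrow> real) \<Rightarrow> 'x set \<Rightarrow> real" where
  "jump_rate F \<gamma> = (\<integral>x. (\<integral>y. c x y (\<gamma> - {x}) * D_minus_plus x y F \<gamma> \<partial>\<nu>) \<partial>count_space \<gamma>)"

lemma measurable_D_minus_plus:
  assumes F: "F \<in> (cylinder_functions :: ('x set \<Rightarrow> real) set)"
  shows "(\<lambda>p. D_minus_plus (fst (fst p)) (snd p) F (snd (fst p))) \<in> borel_measurable jumps"
  unfolding D_minus_plus_def
  using measurable_compose[OF measurable_jump cylinder_measurable[OF F]]
    measurable_compose[OF measurable_compose[OF measurable_fst measurable_snd] cylinder_measurable[OF F]]
  by (intro borel_measurable_diff) auto

lemma jump_rate_square_integrable: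
  assumes F: "F \<in> cylinder_functions"
  shows "square_integrable \<mu> (jump_rate F)"
proof -
  obtain B \<Lambda> where B: "0 \<le> B" "\<Lambda> \<in> rel_compact_borel"
    "\<And>\<gamma> x y. \<gamma> \<in> configs \<Longrightarrow> \<bar>F (jump x y \<gamma>) - F \<gamma>\<bar> \<le> B * (indicator \<Lambda> x + indicator \<Lambda> y)"
    using jump_bounds[OF F] by metis
  show ?thesis
    unfolding jump_rate_def[abs_def]
    by (rule jump_dominated(3)[OF B(2,1) measurable_D_minus_plus[OF F]]) (simp add: D_minus_plus_def B(3))
qed

text \<open>Let I1 and I2 be the integrals of c times the difference of F times G before,
  respectively after, the jump; the form is I2 - I1. Reversing the jump flips the sign of the
  difference and exchanges the two values of G, so I2 = - I1. The form is therefore -2 I1, whence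
  the factor 2 in the generator.\<close>

lemma kawasaki_form_eq:
  assumes F: "F \<in> cylinder_functions" and G: "G \<in> cylinder_functions"
  shows "kawasaki_form \<nu> \<mu> c F G = l2_inner \<mu> (\<lambda>\<gamma>. - 2 * jump_rate F \<gamma>) G"
proof -
  obtain B \<Lambda> where B: "0 \<le> B" and L: "\<Lambda> \<in> rel_compact_borel"
    and bF: "\<And>\<gamma> x y. \<gamma> \<in> configs \<Longrightarrow> \<bar>F (jump x y \<gamma>) - F \<gamma>\<bar> \<le> B * (indicator \<Lambda> x + indicator \<Lambda> y)"
    using jump_bounds[OF F] by metis
  obtain C where C: "0 \<le> C" "\<And>\<gamma>. \<gamma> \<in> configs \<Longrightarrow> \<bar>G \<gamma>\<bar> \<le> C"
    using cylinder_bounded[OF G] by blast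
  note [measurable] = measurable_D_minus_plus[OF F]
    measurable_compose[OF measurable_jump cylinder_measurable[OF G]]
    measurable_compose[OF measurable_compose[OF measurable_fst measurable_snd] cylinder_measurable[OF G]]
  have bD: "\<bar>D_minus_plus x y F \<gamma> * a\<bar> \<le> (B * K) * (indicator \<Lambda> x + indicator \<Lambda> y)"
    if "\<gamma> \<in> configs" "\<bar>a\<bar> \<le> K" for \<gamma> x y a K
  proof -
    have "\<bar>D_minus_plus x y F \<gamma> * a\<bar> \<le> (B * (indicator \<Lambda> x + indicator \<Lambda> y)) * K"
      unfolding abs_mult using bF[OF that(1)] that(2) B by (intro mult_mono) (auto simp: D_minus_plus_def)
    then show ?thesis by (simp add: mult_ac)
  qed
  have bG: "\<bar>G (jump x y \<gamma>) - G \<gamma>\<bar> \<le> 2 * C" if "\<gamma> \<in> configs" for \<gamma> x y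
    using C(2)[OF that] C(2)[OF jump_in_configs[OF that], of y x] by linarith
  let ?q = "\<lambda>x y \<gamma>. c x y (\<gamma> - {x})"
  let ?h1 = "\<lambda>x y \<gamma>. D_minus_plus x y F \<gamma> * G \<gamma>"
  let ?h2 = "\<lambda>x y \<gamma>. D_minus_plus x y F \<gamma> * G (jump x y \<gamma>)"
  let ?h0 = "\<lambda>x y \<gamma>. D_minus_plus x y F \<gamma> * (G (jump x y \<gamma>) - G \<gamma>)"
  have dom1: "kernel_integrable \<mu> jump_kernel (\<lambda>\<gamma> z. ?q (fst z) (snd z) \<gamma> * ?h1 (fst z) (snd z) \<gamma>)"
    and ae1: "AE \<gamma> in \<mu>. (\<integral>x. (\<integral>y. ?q x y \<gamma> * ?h1 x y \<gamma> \<partial>\<nu>) \<partial>count_space \<gamma>)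
      = (\<integral>z. ?q (fst z) (snd z) \<gamma> * ?h1 (fst z) (snd z) \<gamma> \<partial>jump_kernel \<gamma>)"
    and sq1: "square_integrable \<mu> (\<lambda>\<gamma>. \<integral>x. (\<integral>y. ?q x y \<gamma> * ?h1 x y \<gamma> \<partial>\<nu>) \<partial>count_space \<gamma>)"
    using B C by (intro jump_dominated[OF L, of "B * C"] bD; simp; measurable)+
  have dom2: "kernel_integrable \<mu> jump_kernel (\<lambda>\<gamma> z. ?q (fst z) (snd z) \<gamma> * ?h2 (fst z) (snd z) \<gamma>)"
    using B C jump_in_configs by (intro jump_dominated[OF L, of "B * C"] bD; simp; measurable)
  have dom0: "kernel_integrable \<mu> jump_kernel (\<lambda>\<gamma> z. ?q (fst z) (snd z) \<gamma> * ?h0 (fst z) (snd z) \<gamma>)"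
    and ae0: "AE \<gamma> in \<mu>. (\<integral>x. (\<integral>y. ?q x y \<gamma> * ?h0 x y \<gamma> \<partial>\<nu>) \<partial>count_space \<gamma>)
      = (\<integral>z. ?q (fst z) (snd z) \<gamma> * ?h0 (fst z) (snd z) \<gamma> \<partial>jump_kernel \<gamma>)"
    and sq0: "square_integrable \<mu> (\<lambda>\<gamma>. \<integral>x. (\<integral>y. ?q x y \<gamma> * ?h0 x y \<gamma> \<partial>\<nu>) \<partial>count_space \<gamma>)"
    using B C bG by (intro jump_dominated[OF L, of "B * (2 * C)"] bD; simp; measurable)+
  let ?I1 = "\<integral>\<gamma>. (\<integral>z. ?q (fst z) (snd z) \<gamma> * ?h1 (fst z) (snd z) \<gamma> \<partial>jump_kernel \<gamma>) \<partial>\<mu>"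
  let ?I2 = "\<integral>\<gamma>. (\<integral>z. ?q (fst z) (snd z) \<gamma> * ?h2 (fst z) (snd z) \<gamma> \<partial>jump_kernel \<gamma>) \<partial>\<mu>"
  have reverse: "(\<integral>\<^sup>+ \<gamma>. (\<integral>\<^sup>+ z. ennreal (s * (?q (fst z) (snd z) \<gamma> * ?h2 (fst z) (snd z) \<gamma>)) \<partial>jump_kernel \<gamma>) \<partial>\<mu>)
    = (\<integral>\<^sup>+ \<gamma>. (\<integral>\<^sup>+ z. ennreal (- s * (?q (fst z) (snd z) \<gamma> * ?h1 (fst z) (snd z) \<gamma>)) \<partial>jump_kernel \<gamma>) \<partial>\<mu>)" for s
  proof -
    \<comment> \<open>At \<gamma> and its jump this is the part of s times \<open>?h2\<close>, with
      the arguments exchanged that of -s times \<open>?h1\<close>; one function encodes both sides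
      of the reversal.\<close>
    define \<Phi> where "\<Phi> a b = ennreal (s * ((F b - F a) * G b))" for a b
    note [measurable] = cylinder_measurable[OF F] cylinder_measurable[OF G] measurable_c_jump measurable_jump
    have \<Phi>: "(\<lambda>p. \<Phi> (fst p) (snd p)) \<in> borel_measurable (config_space \<Otimes>\<^sub>M config_space)"
      unfolding \<Phi>_def by measurable
    have e2: "ennreal (s * (?q x y \<gamma> * ?h2 x y \<gamma>)) = ennreal (?q x y \<gamma>) * \<Phi> \<gamma> (jump x y \<gamma>)" if "\<gamma> \<in> configs" for x y \<gamma>
    proof -
      have "s * (?q x y \<gamma> * ?h2 x y \<gamma>) = ?q x y \<gamma> * (s * ?h2 x y \<gamma>)" by (simp add: mult_ac)
      then show ?thesis using c_nonneg[OF configs_remove[OF that]]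
        by (simp only: \<Phi>_def D_minus_plus_def ennreal_mult')
    qed
    have e1: "ennreal (- s * (?q x y \<gamma> * ?h1 x y \<gamma>)) = ennreal (?q x y \<gamma>) * \<Phi> (jump x y \<gamma>) \<gamma>" if "\<gamma> \<in> configs" for x y \<gamma>
    proof -
      have "- s * (?q x y \<gamma> * ?h1 x y \<gamma>) = ?q x y \<gamma> * (s * ((F \<gamma> - F (jump x y \<gamma>)) * G \<gamma>))"
        by (simp add: D_minus_plus_def algebra_simps)
      then show ?thesis using c_nonneg[OF configs_remove[OF that]]
        by (simp only: \<Phi>_def ennreal_mult')
    qed
    have m1: "(\<lambda>p. ennreal (- s * (?q (fst (fst p)) (snd p) (snd (fst p)) * ?h1 (fst (fst p)) (snd p) (snd (fst p))))) \<in> borel_measurable jumps"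
      and m2: "(\<lambda>p. ennreal (s * (?q (fst (fst p)) (snd p) (snd (fst p)) * ?h2 (fst (fst p)) (snd p) (snd (fst p))))) \<in> borel_measurable jumps"
      by measurable
    have "(\<integral>\<^sup>+ \<gamma>. (\<integral>\<^sup>+ z. ennreal (s * (?q (fst z) (snd z) \<gamma> * ?h2 (fst z) (snd z) \<gamma>)) \<partial>jump_kernel \<gamma>) \<partial>\<mu>)
      = (\<integral>\<^sup>+ \<gamma>. (\<integral>\<^sup>+ x. (\<integral>\<^sup>+ y. ennreal (s * (?q x y \<gamma> * ?h2 x y \<gamma>)) \<partial>\<nu>) \<partial>count_space \<gamma>) \<partial>\<mu>)"
      by (rule nn_integral_cong, rule nn_integral_jump_kernel[OF m2]) simp
    also have "\<dots> = (\<integral>\<^sup>+ \<gamma>. (\<integral>\<^sup>+ x. (\<integral>\<^sup>+ y. ennreal (?q x y \<gamma>) * \<Phi> \<gamma> (jump x y \<gamma>) \<partial>\<nu>) \<partial>count_space \<gamma>) \<partial>\<mu>)"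
      by (intro nn_integral_cong e2) simp
    also have "\<dots> = (\<integral>\<^sup>+ \<gamma>. (\<integral>\<^sup>+ x. (\<integral>\<^sup>+ y. ennreal (?q x y \<gamma>) * \<Phi> (jump x y \<gamma>) \<gamma> \<partial>\<nu>) \<partial>count_space \<gamma>) \<partial>\<mu>)"
      by (rule nn_integral_jump_reverse[OF \<Phi>])
    also have "\<dots> = (\<integral>\<^sup>+ \<gamma>. (\<integral>\<^sup>+ x. (\<integral>\<^sup>+ y. ennreal (- s * (?q x y \<gamma> * ?h1 x y \<gamma>)) \<partial>\<nu>) \<partial>count_space \<gamma>) \<partial>\<mu>)"
      by (intro nn_integral_cong e1[symmetric]) simp
    also have "\<dots> = (\<integral>\<^sup>+ \<gamma>. (\<integral>\<^sup>+ z. ennreal (- s * (?q (fst z) (snd z) \<gamma> * ?h1 (fst z) (snd z) \<gamma>)) \<partial>jump_kernel \<gamma>) \<partial>\<mu>)"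
      by (rule nn_integral_cong, rule nn_integral_jump_kernel[OF m1, symmetric]) simp
    finally show ?thesis .
  qed
  have "?I2 = - ?I1"
    unfolding kernel_integrableD(3)[OF dom1] kernel_integrableD(3)[OF dom2]
    using reverse[of 1] reverse[of "-1"] by simp
  moreover have "kawasaki_form \<nu> \<mu> c F G = ?I2 - ?I1"
  proof -
    have "kawasaki_form \<nu> \<mu> c F G = (\<integral>\<gamma>. (\<integral>x. (\<integral>y. ?q x y \<gamma> * ?h0 x y \<gamma> \<partial>\<nu>) \<partial>count_space \<gamma>) \<partial>\<mu>)"
      unfolding kawasaki_form_def D_minus_plus_def[of _ _ G] by (simp only: mult.assoc)
    \<comment> \<open>The form is an iterated integral while the reversal was put in terms of the
      product measure; the inner integrals agree for almost every \<gamma>.\<close>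
    also have "\<dots> = (\<integral>\<gamma>. (\<integral>z. ?q (fst z) (snd z) \<gamma> * ?h0 (fst z) (snd z) \<gamma> \<partial>jump_kernel \<gamma>) \<partial>\<mu>)"
      using ae0 sq0 kernel_integrableD(2)[OF dom0]
      by (intro integral_cong_AE) (auto simp: square_integrable_real)
    also have "\<dots> = ?I2 - ?I1"
      using kernel_integral_diff[OF dom2 dom1] dom0 by (simp add: right_diff_distrib)
    finally show ?thesis .
  qed
  moreover have "l2_inner \<mu> (\<lambda>\<gamma>. - 2 * jump_rate F \<gamma>) G = - 2 * ?I1"
  proof -
    have "l2_inner \<mu> (\<lambda>\<gamma>. - 2 * jump_rate F \<gamma>) G
      = (\<integral>\<gamma>. - 2 * (\<integral>x. (\<integral>y. ?q x y \<gamma> * ?h1 x y \<gamma> \<partial>\<nu>) \<partial>count_space \<gamma>) \<partial>\<mu>)"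
      unfolding l2_inner_def jump_rate_def by (simp add: mult.assoc[symmetric])
    also have "\<dots> = - 2 * (\<integral>\<gamma>. (\<integral>x. (\<integral>y. ?q x y \<gamma> * ?h1 x y \<gamma> \<partial>\<nu>) \<partial>count_space \<gamma>) \<partial>\<mu>)" by simp
    also have "(\<integral>\<gamma>. (\<integral>x. (\<integral>y. ?q x y \<gamma> * ?h1 x y \<gamma> \<partial>\<nu>) \<partial>count_space \<gamma>) \<partial>\<mu>) = ?I1"
      using ae1 sq1 kernel_integrableD(2)[OF dom1]
      by (intro integral_cong_AE) (auto simp: square_integrable_real)
    finally show ?thesis .
  qed
  ultimately show ?thesis by simp
qed

sublocale represented_form \<mu> cylinder_functions "kawasaki_form \<nu> \<mu> c" "\<lambda>F \<gamma>. - 2 * jump_rate F \<gamma>"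
proof
  fix u v :: "'x set \<Rightarrow> real" and a :: real assume u: "u \<in> cylinder_functions"
  show "(\<lambda>x. a * u x) \<in> cylinder_functions" by (rule cylinder_scale[OF u])
  show "square_integrable \<mu> u" by (rule cylinder_square_integrable[OF u])
  show "square_integrable \<mu> (\<lambda>\<gamma>. - 2 * jump_rate u \<gamma>)"
    by (rule square_integrable_scale[OF jump_rate_square_integrable[OF u]])
  show "0 \<le> kawasaki_form \<nu> \<mu> c u u"
    unfolding kawasaki_form_def
    by (intro Bochner_Integration.integral_nonneg)
      (auto simp: mult.assoc intro!: mult_nonneg_nonneg[OF c_nonneg[OF configs_remove] zero_le_square])
  assume v: "v \<in> cylinder_functions"
  show "(\<lambda>x. u x + v x) \<in> cylinder_functions" by (rule cylinder_add[OF u v])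
  show "kawasaki_form \<nu> \<mu> c u v = l2_inner \<mu> (\<lambda>\<gamma>. - 2 * jump_rate u \<gamma>) v"
    by (rule kawasaki_form_eq[OF u v])
  show "kawasaki_form \<nu> \<mu> c u v = kawasaki_form \<nu> \<mu> c v u"
    by (simp add: kawasaki_form_def mult_ac)
qed (rule cylinder_zero)

end

section \<open>Both generators as instances of the represented form\<close>

theorem theorem3p2:
  fixes \<nu> :: "'x::{second_countable_topology, t2_space} measure"
    and K S :: "('x \<Rightarrow> complex) \<Rightarrow> ('x \<Rightarrow> complex)"
    and K1 :: "'x \<Rightarrow> 'x \<Rightarrow> complex"
    and \<mu> :: "'x set measure"
    and r :: "'x \<Rightarrow> 'x set \<Rightarrow> ennreal"
    and d :: "'x \<Rightarrow> 'x set \<Rightarrow> real"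
    and c :: "'x \<Rightarrow> 'x \<Rightarrow> 'x set \<Rightarrow> real"
  assumes "locally compact (UNIV :: 'x set)"
    and "radon_measure \<nu>" and "non_atomic \<nu>"
    and "bounded_operator \<nu> K" and "hermitian \<nu> K"
    and "operator_le \<nu> (\<lambda>f x. 0) K" and "operator_le \<nu> K (\<lambda>f. f)"
    and "locally_trace_class \<nu> K"
    and "1 \<notin> operator_spectrum \<nu> K"
    and "is_operator_sqrt \<nu> K S" and "has_kernel \<nu> S K1"
    and "has_kernel \<nu> K (composed_kernel \<nu> K1)"
    and "fermion_process \<nu> (composed_kernel \<nu> K1) \<mu>"
    and "papangelou_intensity \<nu> \<mu> r"
    and "case_prod d \<in> borel_measurable (borel \<Otimes>\<^sub>M config_space)"
    and "\<And>x \<gamma>. \<gamma> \<in> configs \<Longrightarrow> 0 \<le> d x \<gamma>"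
    and "(\<lambda>(x, y, \<gamma>). c x y \<gamma>) \<in> borel_measurable (borel \<Otimes>\<^sub>M borel \<Otimes>\<^sub>M config_space)"
    and "\<And>x y \<gamma>. \<gamma> \<in> configs \<Longrightarrow> 0 \<le> c x y \<gamma>"
    and "\<And>x y \<gamma>. \<gamma> \<in> configs \<Longrightarrow>
           c x y \<gamma> = c x y \<gamma> * (if r x \<gamma> > 0 \<and> r y \<gamma> > 0 then 1 else 0)"
    and "\<And>x y \<gamma>. \<gamma> \<in> configs \<Longrightarrow>
           r x \<gamma> * ennreal (c x y \<gamma>) = r y \<gamma> * ennreal (c y x \<gamma>)"
  shows
    "((\<forall>\<Lambda>\<in>rel_compact_borel.
         square_integrable_ennreal \<mu>
           (\<lambda>\<gamma>. \<integral>\<^sup>+ x. ennreal (d x (\<gamma> - {x})) * indicator \<Lambda> x \<partial>count_space \<gamma>) \<and>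
         square_integrable_ennreal \<mu>
           (\<lambda>\<gamma>. \<integral>\<^sup>+ x. r x \<gamma> * ennreal (d x \<gamma>) * indicator \<Lambda> x \<partial>\<nu>))
      \<longrightarrow>
      (\<forall>H DH. is_closure_generator \<mu> (glauber_form \<mu> d) cylinder_functions H DH \<longrightarrow>
         cylinder_functions \<subseteq> DH \<and>
         (\<forall>F\<in>cylinder_functions. AE \<gamma> in \<mu>.
            H F \<gamma> = - (\<integral>x. enn2real (r x \<gamma> * ennreal (d x \<gamma>)) * D_plus x F \<gamma> \<partial>\<nu>)
                    - (\<integral>x. d x (\<gamma> - {x}) * D_minus x F \<gamma> \<partial>count_space \<gamma>)) \<and>
         is_friedrichs_extension \<mu> H cylinder_functions H DH))
     \<and>
     ((\<forall>\<Lambda>\<in>rel_compact_borel.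
         square_integrable_ennreal \<mu>
           (\<lambda>\<gamma>. \<integral>\<^sup>+ x. (\<integral>\<^sup>+ y. ennreal (c x y (\<gamma> - {x})) * (indicator \<Lambda> x + indicator \<Lambda> y) \<partial>\<nu>)
                  \<partial>count_space \<gamma>))
      \<longrightarrow>
      (\<forall>H DH. is_closure_generator \<mu> (kawasaki_form \<nu> \<mu> c) cylinder_functions H DH \<longrightarrow>
         cylinder_functions \<subseteq> DH \<and>
         (\<forall>F\<in>cylinder_functions. AE \<gamma> in \<mu>.
            H F \<gamma> = - 2 * (\<integral>x. (\<integral>y. c x y (\<gamma> - {x}) * D_minus_plus x y F \<gamma> \<partial>\<nu>)
                            \<partial>count_space \<gamma>)) \<and>
         is_friedrichs_extension \<mu> H cylinder_functions H DH))"
proof -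
  have proc: "papangelou_process \<nu> \<mu> r"
    using assms(1-3,13,14) by (simp add: papangelou_process_def fermion_process_def)
  have glauber: "cylinder_functions \<subseteq> DH \<and>
      (\<forall>F\<in>cylinder_functions. AE \<gamma> in \<mu>.
        H F \<gamma> = - (\<integral>x. enn2real (r x \<gamma> * ennreal (d x \<gamma>)) * D_plus x F \<gamma> \<partial>\<nu>)
          - (\<integral>x. d x (\<gamma> - {x}) * D_minus x F \<gamma> \<partial>count_space \<gamma>)) \<and>
      is_friedrichs_extension \<mu> H cylinder_functions H DH"
    if sq: "\<forall>\<Lambda>\<in>rel_compact_borel.
         square_integrable_ennreal \<mu>
           (\<lambda>\<gamma>. \<integral>\<^sup>+ x. ennreal (d x (\<gamma> - {x})) * indicator \<Lambda> x \<partial>count_space \<gamma>) \<and>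
         square_integrable_ennreal \<mu>
           (\<lambda>\<gamma>. \<integral>\<^sup>+ x. r x \<gamma> * ennreal (d x \<gamma>) * indicator \<Lambda> x \<partial>\<nu>)"
      and gen: "is_closure_generator \<mu> (glauber_form \<mu> d) cylinder_functions H DH" for H DH
  proof -
    interpret glauber_coefficients \<nu> \<mu> r d
      by (rule glauber_coefficients.intro[OF proc], unfold_locales) (use assms(15,16) sq in auto)
    show ?thesis
      using closure_generator_extends[OF gen] unfolding birth_def death_def by blast
  qed
  have kawasaki: "cylinder_functions \<subseteq> DH \<and>
      (\<forall>F\<in>cylinder_functions. AE \<gamma> in \<mu>.
        H F \<gamma> = - 2 * (\<integral>x. (\<integral>y. c x y (\<gamma> - {x}) * D_minus_plus x y F \<gamma> \<partial>\<nu>) \<partial>count_space \<gamma>)) \<and>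
      is_friedrichs_extension \<mu> H cylinder_functions H DH"
    if sq: "\<forall>\<Lambda>\<in>rel_compact_borel.
         square_integrable_ennreal \<mu>
           (\<lambda>\<gamma>. \<integral>\<^sup>+ x. (\<integral>\<^sup>+ y. ennreal (c x y (\<gamma> - {x})) * (indicator \<Lambda> x + indicator \<Lambda> y) \<partial>\<nu>)
                  \<partial>count_space \<gamma>)"
      and gen: "is_closure_generator \<mu> (kawasaki_form \<nu> \<mu> c) cylinder_functions H DH" for H DH
  proof -
    interpret kawasaki_coefficients \<nu> \<mu> r c
      by (rule kawasaki_coefficients.intro[OF proc], unfold_locales) (use assms(17,18,20) sq in auto)
    show ?thesis
      using closure_generator_extends[OF gen] unfolding jump_rate_def by blast
  qed
  show ?thesis using glauber kawasaki by blast
qed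

end
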